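(* Let $R$ be a ring and let $M$ be an indecomposable automorphism-invariant right $R$-module with finite Goldie dimension such that $M$ is not quasi-injective. Then: (1) $\mathrm{End}(M)/J(\mathrm{End}(M))\cong\mathbb F_2$. (2) There exists a finite set of (pairwise) non-isomorphic indecomposable injective modules $\{E_i\}_{i=1}^n$, with $n\ge 2$, such that $E(M)=\bigoplus_{i=1}^n E_i$ and $\mathrm{End}(E_i)/J(\mathrm{End}(E_i))\cong\mathbb F_2$ for every $i=1,\ldots,n$.
   Context: Rings are associative with identity, modules are unitary right modules, $J(\cdot)$ is the Jacobson radical, $\mathbb F_2$ is the field with two elements, and $E(M)$ is the injective envelope of $M$. A module $M$ is automorphism-invariant if $f(M)\subseteq M$ for every automorphism $f$ of $E(M)$, and quasi-injective if $f(M)\subseteq M$ for every endomorphism $f$ of $E(M)$. *)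

theory Defs
  imports "HOL-Algebra.QuotRing" "HOL-Algebra.Module" "HOL-Number_Theory.Residues"
begin

section \<open>Right modules over a ring that need not be commutative\<close>

text \<open>
  The record \<^type>\<open>module\<close> of HOL-Algebra is reused, but the locale \<^locale>\<open>module\<close> is not,
  since it forces the scalars to be commutative.  Here \<open>a \<odot> x\<close> stands for \<open>x \<cdot> a\<close>: associativity
  is \<open>x \<cdot> (ab) = (x \<cdot> a) \<cdot> b\<close>.  The fields \<open>mult\<close> and \<open>one\<close> of a module record play no role.
\<close>

locale right_module = R?: ring R + M?: abelian_group M
  for R :: "('r, 's) ring_scheme" (structure) and M :: "('r, 'm, 't) module_scheme" (structure) +
  assumes smult_closed [simp, intro]:
      "\<lbrakk>a \<in> carrier R; x \<in> carrier M\<rbrakk> \<Longrightarrow> a \<odot>\<^bsub>M\<^esub> x \<in> carrier M"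
    and smult_l_distr:
      "\<lbrakk>a \<in> carrier R; b \<in> carrier R; x \<in> carrier M\<rbrakk> \<Longrightarrow>
        (a \<oplus>\<^bsub>R\<^esub> b) \<odot>\<^bsub>M\<^esub> x = a \<odot>\<^bsub>M\<^esub> x \<oplus>\<^bsub>M\<^esub> b \<odot>\<^bsub>M\<^esub> x"
    and smult_r_distr:
      "\<lbrakk>a \<in> carrier R; x \<in> carrier M; y \<in> carrier M\<rbrakk> \<Longrightarrow>
        a \<odot>\<^bsub>M\<^esub> (x \<oplus>\<^bsub>M\<^esub> y) = a \<odot>\<^bsub>M\<^esub> x \<oplus>\<^bsub>M\<^esub> a \<odot>\<^bsub>M\<^esub> y"
    and smult_assoc:
      "\<lbrakk>a \<in> carrier R; b \<in> carrier R; x \<in> carrier M\<rbrakk> \<Longrightarrow>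
        (a \<otimes>\<^bsub>R\<^esub> b) \<odot>\<^bsub>M\<^esub> x = b \<odot>\<^bsub>M\<^esub> (a \<odot>\<^bsub>M\<^esub> x)"
    and smult_one [simp]:
      "x \<in> carrier M \<Longrightarrow> \<one>\<^bsub>R\<^esub> \<odot>\<^bsub>M\<^esub> x = x"

text \<open>
  Submodules are given by the library locale \<^locale>\<open>submodule\<close>, which does not constrain the
  scalars; the submodule \<open>A\<close> of \<open>M\<close>, regarded as a module, is \<open>M\<lparr>carrier := A\<rparr>\<close>.
\<close>

definition rmod_hom ::
    "('r, 's) ring_scheme \<Rightarrow> ('r, 'a, 't) module_scheme \<Rightarrow> ('r, 'b, 'u) module_scheme \<Rightarrow> ('a \<Rightarrow> 'b) set"
  where "rmod_hom R M N = {f \<in> carrier M \<rightarrow> carrier N.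
    (\<forall>x \<in> carrier M. \<forall>y \<in> carrier M. f (x \<oplus>\<^bsub>M\<^esub> y) = f x \<oplus>\<^bsub>N\<^esub> f y) \<and>
    (\<forall>a \<in> carrier R. \<forall>x \<in> carrier M. f (a \<odot>\<^bsub>M\<^esub> x) = a \<odot>\<^bsub>N\<^esub> f x)}"

definition rmod_iso ::
    "('r, 's) ring_scheme \<Rightarrow> ('r, 'a, 't) module_scheme \<Rightarrow> ('r, 'b, 'u) module_scheme \<Rightarrow> ('a \<Rightarrow> 'b) set"
  where "rmod_iso R M N = {f \<in> rmod_hom R M N. bij_betw f (carrier M) (carrier N)}"

definition rmod_isomorphic ::
    "('r, 's) ring_scheme \<Rightarrow> ('r, 'a, 't) module_scheme \<Rightarrow> ('r, 'b, 'u) module_scheme \<Rightarrow> bool"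
  where "rmod_isomorphic R M N \<longleftrightarrow> rmod_iso R M N \<noteq> {}"

text \<open>Endomorphisms are taken extensional, so that equal maps on the carrier are equal elements.\<close>

definition endo_ring :: "('r, 's) ring_scheme \<Rightarrow> ('r, 'm, 't) module_scheme \<Rightarrow> ('m \<Rightarrow> 'm) ring"
  where "endo_ring R M =
    \<lparr>carrier = rmod_hom R M M \<inter> extensional (carrier M),
     monoid.mult = (\<lambda>f g. compose (carrier M) f g),
     one = (\<lambda>x \<in> carrier M. x),
     zero = (\<lambda>x \<in> carrier M. \<zero>\<^bsub>M\<^esub>),
     add = (\<lambda>f g. \<lambda>x \<in> carrier M. f x \<oplus>\<^bsub>M\<^esub> g x)\<rparr>"


section \<open>The Jacobson radical\<close>

definition right_regular :: "('r, 's) ring_scheme \<Rightarrow> ('r, 'r) module"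
  where "right_regular R =
    \<lparr>carrier = carrier R, monoid.mult = monoid.mult R, one = \<one>\<^bsub>R\<^esub>, zero = \<zero>\<^bsub>R\<^esub>, add = add R,
     smult = (\<lambda>a x. x \<otimes>\<^bsub>R\<^esub> a)\<rparr>"

definition right_ideal :: "('r, 's) ring_scheme \<Rightarrow> 'r set \<Rightarrow> bool"
  where "right_ideal R I \<longleftrightarrow> submodule I R (right_regular R)"

definition maximal_right_ideal :: "('r, 's) ring_scheme \<Rightarrow> 'r set \<Rightarrow> bool"
  where "maximal_right_ideal R I \<longleftrightarrow> right_ideal R I \<and> I \<noteq> carrier R \<and>
    (\<forall>K. right_ideal R K \<and> I \<subseteq> K \<longrightarrow> K = I \<or> K = carrier R)"

definition jacobson_radical :: "('r, 's) ring_scheme \<Rightarrow> 'r set"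
  where "jacobson_radical R = {x \<in> carrier R. \<forall>I. maximal_right_ideal R I \<longrightarrow> x \<in> I}"


section \<open>Direct sums, indecomposability and Goldie dimension\<close>

definition independent_family ::
    "('r, 's) ring_scheme \<Rightarrow> ('r, 'm, 't) module_scheme \<Rightarrow> 'i set \<Rightarrow> ('i \<Rightarrow> 'm set) \<Rightarrow> bool"
  where "independent_family R M I N \<longleftrightarrow> (\<forall>i \<in> I. submodule (N i) R M) \<and>
    (\<forall>F x. finite F \<and> F \<subseteq> I \<and> (\<forall>i \<in> F. x i \<in> N i) \<and> finsum M x F = \<zero>\<^bsub>M\<^esub> \<longrightarrow>
      (\<forall>i \<in> F. x i = \<zero>\<^bsub>M\<^esub>))"

definition internal_direct_sum ::
    "('r, 's) ring_scheme \<Rightarrow> ('r, 'm, 't) module_scheme \<Rightarrow> 'i set \<Rightarrow> ('i \<Rightarrow> 'm set) \<Rightarrow> bool"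
  where "internal_direct_sum R M I N \<longleftrightarrow> independent_family R M I N \<and>
    (\<forall>m \<in> carrier M. \<exists>F x. finite F \<and> F \<subseteq> I \<and> (\<forall>i \<in> F. x i \<in> N i) \<and> m = finsum M x F)"

definition indecomposable_module :: "('r, 's) ring_scheme \<Rightarrow> ('r, 'm, 't) module_scheme \<Rightarrow> bool"
  where "indecomposable_module R M \<longleftrightarrow> carrier M \<noteq> {\<zero>\<^bsub>M\<^esub>} \<and>
    (\<forall>A B. submodule A R M \<and> submodule B R M \<and> A \<inter> B = {\<zero>\<^bsub>M\<^esub>} \<and> A <+>\<^bsub>M\<^esub> B = carrier M \<longrightarrow>
      A = {\<zero>\<^bsub>M\<^esub>} \<or> B = {\<zero>\<^bsub>M\<^esub>})"

text \<open>\<open>M\<close> contains no infinite direct sum of nonzero submodules.\<close>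

definition finite_Goldie_dimension :: "('r, 's) ring_scheme \<Rightarrow> ('r, 'm, 't) module_scheme \<Rightarrow> bool"
  where "finite_Goldie_dimension R M \<longleftrightarrow>
    \<not> (\<exists>N :: nat \<Rightarrow> 'm set. independent_family R M UNIV N \<and> (\<forall>i. N i \<noteq> {\<zero>\<^bsub>M\<^esub>}))"


section \<open>Injective modules and injective envelopes\<close>

text \<open>
  A definition cannot quantify over types, so the test modules \<open>B\<close> are those carried by
  \<^typ>\<open>'r + 'e\<close>, a type containing copies of \<open>R\<close> and of \<open>E\<close>.  This is no restriction: by Baer's
  argument the extension property then holds for test modules over every type, which is the theorem
  \<open>injective_module_extends\<close> below.
\<close>

definition injective_module :: "('r, 's) ring_scheme \<Rightarrow> ('r, 'e, 't) module_scheme \<Rightarrow> bool"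
  where "injective_module R E \<longleftrightarrow> right_module R E \<and>
    (\<forall>(B :: ('r, 'r + 'e) module) A f.
      right_module R B \<and> submodule A R B \<and> f \<in> rmod_hom R (B\<lparr>carrier := A\<rparr>) E \<longrightarrow>
      (\<exists>g \<in> rmod_hom R B E. \<forall>x \<in> A. g x = f x))"

subsection \<open>Independence of the type of the test modules\<close>

lemma injective_module_extends_right_ideal:
  fixes R :: "('r, 's) ring_scheme" and E :: "('r, 'e, 't) module_scheme"
  assumes inj: "injective_module R E"
    and I: "right_ideal R I"
    and h: "h \<in> rmod_hom R ((right_regular R)\<lparr>carrier := I\<rparr>) E"
  shows "\<exists>e \<in> carrier E. \<forall>a \<in> I. h a = a \<odot>\<^bsub>E\<^esub> e"
proof -
  interpret R: ring R
    using inj by (simp add: injective_module_def right_module_def)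
  interpret E: right_module R E
    using inj by (simp add: injective_module_def)
  define p :: "'r + 'e \<Rightarrow> 'r" where "p = projl"
  define B :: "('r, 'r + 'e) module" where "B =
    \<lparr>carrier = Inl ` carrier R, monoid.mult = (\<lambda>x y. x), one = Inl \<zero>\<^bsub>R\<^esub>, zero = Inl \<zero>\<^bsub>R\<^esub>,
     add = (\<lambda>x y. Inl (p x \<oplus>\<^bsub>R\<^esub> p y)), smult = (\<lambda>a x. Inl (p x \<otimes>\<^bsub>R\<^esub> a))\<rparr>"
  have [simp]: "p (Inl x) = x" for x by (simp add: p_def)
  have Bs: "carrier B = Inl ` carrier R" "zero B = Inl \<zero>\<^bsub>R\<^esub>"
    "x \<oplus>\<^bsub>B\<^esub> y = Inl (p x \<oplus>\<^bsub>R\<^esub> p y)" "a \<odot>\<^bsub>B\<^esub> x = Inl (p x \<otimes>\<^bsub>R\<^esub> a)" for x y a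
    by (simp_all add: B_def)
  have Bgrp: "abelian_group B"
  proof (rule abelian_groupI, goal_cases)
    case (6 x)
    then show ?case
      by (auto simp: Bs intro!: bexI[of _ "\<ominus>\<^bsub>R\<^esub> p x"] R.l_neg)
  qed (auto simp: Bs R.a_ac)
  have Bmod: "right_module R B"
    by (intro right_module.intro Bgrp R.ring_axioms right_module_axioms.intro)
      (auto simp: Bs R.r_distr R.l_distr R.m_assoc)
  interpret B: right_module R B by (rule Bmod)
  have I_sub: "I \<subseteq> carrier R" and I0: "\<zero>\<^bsub>R\<^esub> \<in> I"
    and Iadd: "\<And>x y. x \<in> I \<Longrightarrow> y \<in> I \<Longrightarrow> x \<oplus>\<^bsub>R\<^esub> y \<in> I"
    and Ismult: "\<And>a x. a \<in> carrier R \<Longrightarrow> x \<in> I \<Longrightarrow> x \<otimes>\<^bsub>R\<^esub> a \<in> I"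
    using I subgroup.subset[of I "add_monoid (right_regular R)"]
      subgroup.one_closed[of I "add_monoid (right_regular R)"]
      subgroup.m_closed[of I "add_monoid (right_regular R)"]
      submodule.smult_closed[of I R "right_regular R"]
    unfolding right_ideal_def submodule_def by (auto simp: right_regular_def submodule_axioms_def)
  have Iinv: "\<ominus>\<^bsub>R\<^esub> x \<in> I" if "x \<in> I" for x
  proof -
    have "x \<otimes>\<^bsub>R\<^esub> (\<ominus>\<^bsub>R\<^esub> \<one>\<^bsub>R\<^esub>) \<in> I" using that by (intro Ismult) auto
    moreover have "x \<otimes>\<^bsub>R\<^esub> (\<ominus>\<^bsub>R\<^esub> \<one>\<^bsub>R\<^esub>) = \<ominus>\<^bsub>R\<^esub> x" using that I_sub by (auto simp: R.r_minus)
    ultimately show ?thesis by simp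
  qed
  have sub: "submodule (Inl ` I) R B"
  proof (intro submodule.intro subgroup.intro submodule_axioms.intro, goal_cases)
    case (4 x)
    then obtain y where y: "x = Inl y" "y \<in> I" by auto
    have "\<ominus>\<^bsub>B\<^esub> x = Inl (\<ominus>\<^bsub>R\<^esub> y)"
      using y I_sub Iinv[OF y(2)]
      by (intro B.M.minus_equality) (auto simp: Bs R.l_neg)
    then show ?case using y Iinv by (auto simp: a_inv_def)
  qed (use I_sub in \<open>auto simp: Bs I0 Iadd Ismult\<close>)
  define f where "f = (\<lambda>x :: 'r + 'e. h (p x))"
  have f: "f \<in> rmod_hom R (B\<lparr>carrier := Inl ` I\<rparr>) E"
  proof -
    have "h x \<in> carrier E" if "x \<in> I" for x
      using h that by (auto simp: rmod_hom_def)
    moreover have "h (x \<oplus>\<^bsub>R\<^esub> y) = h x \<oplus>\<^bsub>E\<^esub> h y" if "x \<in> I" "y \<in> I" for x y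
      using h that by (simp add: rmod_hom_def right_regular_def)
    moreover have "h (x \<otimes>\<^bsub>R\<^esub> a) = a \<odot>\<^bsub>E\<^esub> h x" if "x \<in> I" "a \<in> carrier R" for x a
      using h that by (simp add: rmod_hom_def right_regular_def)
    ultimately show ?thesis by (simp add: rmod_hom_def f_def Bs Pi_iff)
  qed
  obtain g where g: "g \<in> rmod_hom R B E" "\<And>x. x \<in> Inl ` I \<Longrightarrow> g x = f x"
    using inj[unfolded injective_module_def, THEN conjunct2, rule_format, of B "Inl ` I" f] Bmod sub f
    by blast
  let ?e = "g (Inl \<one>\<^bsub>R\<^esub>)"
  have e: "?e \<in> carrier E" using g(1) by (auto simp: rmod_hom_def Bs)
  have "h a = a \<odot>\<^bsub>E\<^esub> ?e" if a: "a \<in> I" for a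
  proof -
    have aR: "a \<in> carrier R" using a I_sub by auto
    have "h a = g (Inl a)" using g(2)[of "Inl a"] a by (simp add: f_def)
    also have "Inl a = a \<odot>\<^bsub>B\<^esub> Inl \<one>\<^bsub>R\<^esub>" using aR by (simp add: Bs)
    also have "g \<dots> = a \<odot>\<^bsub>E\<^esub> ?e"
      using g(1) aR by (auto simp: rmod_hom_def Bs(1))
    finally show ?thesis .
  qed
  with e show ?thesis by blast
qed

theorem injective_module_extends:
  fixes R :: "('r, 's) ring_scheme" and E :: "('r, 'e, 't) module_scheme"
    and B :: "('r, 'b, 'u) module_scheme"
  assumes inj: "injective_module R E"
    and B: "right_module R B"
    and A: "submodule A R B"
    and f: "f \<in> rmod_hom R (B\<lparr>carrier := A\<rparr>) E"
  shows "\<exists>g \<in> rmod_hom R B E. \<forall>x \<in> A. g x = f x"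
proof -
  interpret R: ring R
    using inj by (simp add: injective_module_def right_module_def)
  interpret E: right_module R E
    using inj by (simp add: injective_module_def)
  interpret B: right_module R B by (rule B)
  have A_sub: "A \<subseteq> carrier B" and A0: "\<zero>\<^bsub>B\<^esub> \<in> A"
    and Aadd: "\<And>x y. x \<in> A \<Longrightarrow> y \<in> A \<Longrightarrow> x \<oplus>\<^bsub>B\<^esub> y \<in> A"
    and Asmult: "\<And>a x. a \<in> carrier R \<Longrightarrow> x \<in> A \<Longrightarrow> a \<odot>\<^bsub>B\<^esub> x \<in> A"
    using A subgroup.subset[of A "add_monoid B"] subgroup.one_closed[of A "add_monoid B"]
      subgroup.m_closed[of A "add_monoid B"]
    unfolding submodule_def by (auto simp: submodule_axioms_def)
  have fE: "\<And>x. x \<in> A \<Longrightarrow> f x \<in> carrier E"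
    and fadd: "\<And>x y. x \<in> A \<Longrightarrow> y \<in> A \<Longrightarrow> f (x \<oplus>\<^bsub>B\<^esub> y) = f x \<oplus>\<^bsub>E\<^esub> f y"
    and fsmult: "\<And>a x. a \<in> carrier R \<Longrightarrow> x \<in> A \<Longrightarrow> f (a \<odot>\<^bsub>B\<^esub> x) = a \<odot>\<^bsub>E\<^esub> f x"
    using f by (auto simp: rmod_hom_def)
  have B0s: "\<zero>\<^bsub>R\<^esub> \<odot>\<^bsub>B\<^esub> x = \<zero>\<^bsub>B\<^esub>" if "x \<in> carrier B" for x
    by (metis B.M.add.l_cancel_one' B.smult_closed B.smult_l_distr R.l_zero R.zero_closed that)
  have E0s: "\<zero>\<^bsub>R\<^esub> \<odot>\<^bsub>E\<^esub> x = \<zero>\<^bsub>E\<^esub>" if "x \<in> carrier E" for x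
    by (metis E.M.add.l_cancel_one' E.smult_closed E.smult_l_distr R.l_zero R.zero_closed that)
  have Bneg: "(\<ominus>\<^bsub>R\<^esub> a) \<odot>\<^bsub>B\<^esub> x = \<ominus>\<^bsub>B\<^esub> (a \<odot>\<^bsub>B\<^esub> x)" if "a \<in> carrier R" "x \<in> carrier B" for a x
    using that B.smult_l_distr[of "\<ominus>\<^bsub>R\<^esub> a" a x]
    by (intro B.M.minus_equality[symmetric]) (auto simp: R.l_neg B0s)
  have Eneg: "(\<ominus>\<^bsub>R\<^esub> a) \<odot>\<^bsub>E\<^esub> x = \<ominus>\<^bsub>E\<^esub> (a \<odot>\<^bsub>E\<^esub> x)" if "a \<in> carrier R" "x \<in> carrier E" for a x
    using that E.smult_l_distr[of "\<ominus>\<^bsub>R\<^esub> a" a x]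
    by (intro E.M.minus_equality[symmetric]) (auto simp: R.l_neg E0s)

  define P where "P = (\<lambda>G :: ('b \<times> 'e) set. G \<subseteq> carrier B \<times> carrier E \<and>
    (\<lambda>x. (x, f x)) ` A \<subseteq> G \<and>
    (\<forall>x y x' y'. (x, y) \<in> G \<longrightarrow> (x', y') \<in> G \<longrightarrow> (x \<oplus>\<^bsub>B\<^esub> x', y \<oplus>\<^bsub>E\<^esub> y') \<in> G) \<and>
    (\<forall>a x y. a \<in> carrier R \<longrightarrow> (x, y) \<in> G \<longrightarrow> (a \<odot>\<^bsub>B\<^esub> x, a \<odot>\<^bsub>E\<^esub> y) \<in> G) \<and>
    (\<forall>y. (\<zero>\<^bsub>B\<^esub>, y) \<in> G \<longrightarrow> y = \<zero>\<^bsub>E\<^esub>))"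
  have f0: "f \<zero>\<^bsub>B\<^esub> = \<zero>\<^bsub>E\<^esub>"
    using fsmult[OF R.zero_closed A0] by (simp add: B0s E0s fE A0)
  have P_graph: "P ((\<lambda>x. (x, f x)) ` A)"
    using A_sub unfolding P_def by (auto simp: fE fadd fsmult Aadd Asmult f0)
  have "\<exists>G\<in>Collect P. \<forall>X\<in>Collect P. G \<subseteq> X \<longrightarrow> X = G"
  proof (rule subset_Zorn_nonempty)
    show "Collect P \<noteq> {}" using P_graph by auto
  next
    fix C assume C: "C \<noteq> {}" "subset.chain (Collect P) C"
    have CP: "X \<in> C \<Longrightarrow> P X" for X using C(2) by (auto simp: subset.chain_def)
    have lin: "X \<in> C \<Longrightarrow> Y \<in> C \<Longrightarrow> X \<subseteq> Y \<or> Y \<subseteq> X" for X Y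
      using C(2) by (auto simp: subset.chain_def)
    have "P (\<Union>C)"
      unfolding P_def
    proof (intro conjI allI impI)
      show "\<Union>C \<subseteq> carrier B \<times> carrier E" using CP unfolding P_def by blast
      show "(\<lambda>x. (x, f x)) ` A \<subseteq> \<Union>C" using CP C(1) unfolding P_def by blast
    next
      fix x y x' y' assume "(x, y) \<in> \<Union>C" "(x', y') \<in> \<Union>C"
      then obtain X Y where "X \<in> C" "Y \<in> C" "(x, y) \<in> X" "(x', y') \<in> Y" by auto
      then obtain Z where "Z \<in> C" "(x, y) \<in> Z" "(x', y') \<in> Z" using lin by blast
      then have "(x \<oplus>\<^bsub>B\<^esub> x', y \<oplus>\<^bsub>E\<^esub> y') \<in> Z" using CP[of Z] unfolding P_def by blast
      with \<open>Z \<in> C\<close> show "(x \<oplus>\<^bsub>B\<^esub> x', y \<oplus>\<^bsub>E\<^esub> y') \<in> \<Union>C" by auto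
    next
      fix a x y assume a: "a \<in> carrier R" and "(x, y) \<in> \<Union>C"
      then obtain Z where Z: "Z \<in> C" "(x, y) \<in> Z" by auto
      then have "(a \<odot>\<^bsub>B\<^esub> x, a \<odot>\<^bsub>E\<^esub> y) \<in> Z" using CP[of Z] a unfolding P_def by blast
      with Z show "(a \<odot>\<^bsub>B\<^esub> x, a \<odot>\<^bsub>E\<^esub> y) \<in> \<Union>C" by auto
    next
      fix y assume "(\<zero>\<^bsub>B\<^esub>, y) \<in> \<Union>C"
      then show "y = \<zero>\<^bsub>E\<^esub>" using CP unfolding P_def by blast
    qed
    then show "\<Union>C \<in> Collect P" by simp
  qed
  then obtain G where PG: "P G" and Gmax: "\<And>X. P X \<Longrightarrow> G \<subseteq> X \<Longrightarrow> X = G" by auto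
  note PG' = PG[unfolded P_def]
  have GB: "\<And>x y. (x, y) \<in> G \<Longrightarrow> x \<in> carrier B" and GE: "\<And>x y. (x, y) \<in> G \<Longrightarrow> y \<in> carrier E"
    using PG'[THEN conjunct1] by blast+
  have Gf: "\<And>x. x \<in> A \<Longrightarrow> (x, f x) \<in> G"
    using PG'[THEN conjunct2, THEN conjunct1] by blast
  note Gadd = PG'[THEN conjunct2, THEN conjunct2, THEN conjunct1, rule_format]
    and Gsmult = PG'[THEN conjunct2, THEN conjunct2, THEN conjunct2, THEN conjunct1, rule_format]
    and G0 = PG'[THEN conjunct2, THEN conjunct2, THEN conjunct2, THEN conjunct2, rule_format]
  have G00: "(\<zero>\<^bsub>B\<^esub>, \<zero>\<^bsub>E\<^esub>) \<in> G" using Gf[OF A0] f0 by simp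
  have Gneg: "(\<ominus>\<^bsub>B\<^esub> x, \<ominus>\<^bsub>E\<^esub> y) \<in> G" if "(x, y) \<in> G" for x y
    using Gsmult[OF _ that, of "\<ominus>\<^bsub>R\<^esub> \<one>\<^bsub>R\<^esub>"] GB[OF that] GE[OF that] by (simp add: Bneg Eneg)
  have Guniq: "y = y'" if "(x, y) \<in> G" "(x, y') \<in> G" for x y y'
  proof -
    have "(x \<oplus>\<^bsub>B\<^esub> \<ominus>\<^bsub>B\<^esub> x, y \<oplus>\<^bsub>E\<^esub> \<ominus>\<^bsub>E\<^esub> y') \<in> G" using that by (intro Gadd Gneg)
    then have "y \<oplus>\<^bsub>E\<^esub> \<ominus>\<^bsub>E\<^esub> y' = \<zero>\<^bsub>E\<^esub>" using G0 GB[OF that(1)] by (simp add: B.M.r_neg)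
    then show ?thesis using GE that
      by (metis E.M.add.inv_closed E.M.minus_equality E.M.minus_minus)
  qed
  have dom: "\<exists>y. (b, y) \<in> G" if b: "b \<in> carrier B" for b
  proof -
    define I where "I = {a \<in> carrier R. \<exists>y. (a \<odot>\<^bsub>B\<^esub> b, y) \<in> G}"
    define h where "h = (\<lambda>a. THE y. (a \<odot>\<^bsub>B\<^esub> b, y) \<in> G)"
    have h_eq: "h a = y" if "(a \<odot>\<^bsub>B\<^esub> b, y) \<in> G" for a y
      unfolding h_def using that Guniq by blast
    have hG: "(a \<odot>\<^bsub>B\<^esub> b, h a) \<in> G" if "a \<in> I" for a
      using that h_eq unfolding I_def by blast
    have I_R: "I \<subseteq> carrier R" by (auto simp: I_def)
    have hadd: "((x \<oplus>\<^bsub>R\<^esub> y) \<odot>\<^bsub>B\<^esub> b, h x \<oplus>\<^bsub>E\<^esub> h y) \<in> G" if "x \<in> I" "y \<in> I" for x y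
      using Gadd[OF hG[OF that(1)] hG[OF that(2)]] that I_R b
      by (auto simp: B.smult_l_distr subset_iff)
    have hsmult: "((x \<otimes>\<^bsub>R\<^esub> a) \<odot>\<^bsub>B\<^esub> b, a \<odot>\<^bsub>E\<^esub> h x) \<in> G" if "x \<in> I" "a \<in> carrier R" for x a
      using Gsmult[OF that(2) hG[OF that(1)]] that I_R b
      by (auto simp: B.smult_assoc subset_iff)
    have hneg: "((\<ominus>\<^bsub>R\<^esub> x) \<odot>\<^bsub>B\<^esub> b, \<ominus>\<^bsub>E\<^esub> h x) \<in> G" if "x \<in> I" for x
      using Gneg[OF hG[OF that]] that I_R b by (auto simp: Bneg subset_iff)
    have "right_ideal R I"
      unfolding right_ideal_def
    proof (intro submodule.intro subgroup.intro submodule_axioms.intro, goal_cases)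
      case (4 x)
      then have xR: "x \<in> carrier R" using I_R by auto
      have "inv\<^bsub>add_monoid (right_regular R)\<^esub> x = \<ominus>\<^bsub>R\<^esub> x"
        by (simp add: m_inv_def a_inv_def right_regular_def)
      then show ?case using hneg[OF 4] xR unfolding I_def by auto
    next
      case 1
      then show ?case using I_R by (simp add: right_regular_def)
    next
      case (2 x y)
      then show ?case using hadd[OF 2] I_R unfolding I_def by (auto simp: right_regular_def)
    next
      case 3
      then show ?case using G00 b unfolding I_def by (auto simp: right_regular_def B0s)
    next
      case (5 a x)
      then show ?case using hsmult[OF 5(2,1)] I_R unfolding I_def by (auto simp: right_regular_def)
    qed
    moreover have "h \<in> rmod_hom R ((right_regular R)\<lparr>carrier := I\<rparr>) E"
    proof -
      have "h x \<in> carrier E" if "x \<in> I" for x using GE[OF hG[OF that]] .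
      moreover have "h (x \<oplus>\<^bsub>R\<^esub> y) = h x \<oplus>\<^bsub>E\<^esub> h y" if "x \<in> I" "y \<in> I" for x y
        using h_eq[OF hadd[OF that]] .
      moreover have "h (x \<otimes>\<^bsub>R\<^esub> a) = a \<odot>\<^bsub>E\<^esub> h x" if "x \<in> I" "a \<in> carrier R" for x a
        using h_eq[OF hsmult[OF that]] .
      ultimately show ?thesis by (simp add: rmod_hom_def right_regular_def)
    qed
    ultimately obtain e where e: "e \<in> carrier E" "\<And>a. a \<in> I \<Longrightarrow> h a = a \<odot>\<^bsub>E\<^esub> e"
      using injective_module_extends_right_ideal[OF inj, of I h] by blast
    define G' where "G' = {(x \<oplus>\<^bsub>B\<^esub> a \<odot>\<^bsub>B\<^esub> b, y \<oplus>\<^bsub>E\<^esub> a \<odot>\<^bsub>E\<^esub> e) |x y a. (x, y) \<in> G \<and> a \<in> carrier R}"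
    have G'I: "(u, v) \<in> G'" if "(x, y) \<in> G" "a \<in> carrier R" "u = x \<oplus>\<^bsub>B\<^esub> a \<odot>\<^bsub>B\<^esub> b" "v = y \<oplus>\<^bsub>E\<^esub> a \<odot>\<^bsub>E\<^esub> e"
      for u v x y a using that unfolding G'_def by blast
    have GG': "G \<subseteq> G'"
    proof
      fix z assume z: "z \<in> G"
      obtain x y where xy: "z = (x, y)" by (cases z)
      show "z \<in> G'" unfolding xy
        using z b e(1) GB[of x y] GE[of x y] by (intro G'I[of x y "\<zero>\<^bsub>R\<^esub>"]) (auto simp: xy B0s E0s)
    qed
    have "P G'"
      unfolding P_def
    proof (intro conjI allI impI)
      show "G' \<subseteq> carrier B \<times> carrier E" using GB GE b e(1) by (auto simp: G'_def)
      show "(\<lambda>x. (x, f x)) ` A \<subseteq> G'" using Gf GG' by auto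
    next
      fix u v u' v' assume "(u, v) \<in> G'" "(u', v') \<in> G'"
      then obtain x y a x' y' a' where 1: "(x, y) \<in> G" "a \<in> carrier R"
        "u = x \<oplus>\<^bsub>B\<^esub> a \<odot>\<^bsub>B\<^esub> b" "v = y \<oplus>\<^bsub>E\<^esub> a \<odot>\<^bsub>E\<^esub> e" "(x', y') \<in> G" "a' \<in> carrier R"
        "u' = x' \<oplus>\<^bsub>B\<^esub> a' \<odot>\<^bsub>B\<^esub> b" "v' = y' \<oplus>\<^bsub>E\<^esub> a' \<odot>\<^bsub>E\<^esub> e"
        unfolding G'_def by blast
      show "(u \<oplus>\<^bsub>B\<^esub> u', v \<oplus>\<^bsub>E\<^esub> v') \<in> G'"
        using 1 b e(1) GB[OF 1(1)] GE[OF 1(1)] GB[OF 1(5)] GE[OF 1(5)]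
        by (intro G'I[OF Gadd[OF 1(1) 1(5)], of "a \<oplus>\<^bsub>R\<^esub> a'"])
          (auto simp: B.smult_l_distr E.smult_l_distr B.M.a_ac E.M.a_ac)
    next
      fix c u v assume c: "c \<in> carrier R" and "(u, v) \<in> G'"
      then obtain x y a where 1: "(x, y) \<in> G" "a \<in> carrier R"
        "u = x \<oplus>\<^bsub>B\<^esub> a \<odot>\<^bsub>B\<^esub> b" "v = y \<oplus>\<^bsub>E\<^esub> a \<odot>\<^bsub>E\<^esub> e"
        unfolding G'_def by blast
      show "(c \<odot>\<^bsub>B\<^esub> u, c \<odot>\<^bsub>E\<^esub> v) \<in> G'"
        using 1 c b e(1) GB[OF 1(1)] GE[OF 1(1)]
        by (intro G'I[OF Gsmult[OF c 1(1)], of "a \<otimes>\<^bsub>R\<^esub> c"])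
          (auto simp: B.smult_r_distr E.smult_r_distr B.smult_assoc E.smult_assoc)
    next
      fix v assume "(\<zero>\<^bsub>B\<^esub>, v) \<in> G'"
      then obtain x y a where 1: "(x, y) \<in> G" "a \<in> carrier R"
        "\<zero>\<^bsub>B\<^esub> = x \<oplus>\<^bsub>B\<^esub> a \<odot>\<^bsub>B\<^esub> b" "v = y \<oplus>\<^bsub>E\<^esub> a \<odot>\<^bsub>E\<^esub> e"
        unfolding G'_def by blast
      have "a \<odot>\<^bsub>B\<^esub> b = \<ominus>\<^bsub>B\<^esub> x"
        using 1(2,3) b GB[OF 1(1)]
        by (intro B.M.minus_equality[symmetric]) (simp_all add: B.M.a_comm)
      then have ab: "(a \<odot>\<^bsub>B\<^esub> b, \<ominus>\<^bsub>E\<^esub> y) \<in> G" using Gneg[OF 1(1)] by simp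
      then have "a \<in> I" using 1(2) by (auto simp: I_def)
      then have "a \<odot>\<^bsub>E\<^esub> e = \<ominus>\<^bsub>E\<^esub> y" using e(2) h_eq[OF ab] by simp
      then show "v = \<zero>\<^bsub>E\<^esub>" using 1(4) GE[OF 1(1)] by (simp add: E.M.r_neg)
    qed
    then have "G' = G" using Gmax GG' by blast
    moreover have "(b, e) \<in> G'"
      using b e(1) by (intro G'I[OF G00 R.one_closed]) auto
    ultimately show ?thesis by blast
  qed
  define g where "g = (\<lambda>b. THE y. (b, y) \<in> G)"
  have g_eq: "g x = y" if "(x, y) \<in> G" for x y
    unfolding g_def using that Guniq by blast
  have gG: "(x, g x) \<in> G" if "x \<in> carrier B" for x
    using dom[OF that] g_eq by blast
  have "g \<in> rmod_hom R B E"
  proof -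
    have "g x \<in> carrier E" if "x \<in> carrier B" for x using GE[OF gG[OF that]] .
    moreover have "g (x \<oplus>\<^bsub>B\<^esub> y) = g x \<oplus>\<^bsub>E\<^esub> g y" if "x \<in> carrier B" "y \<in> carrier B" for x y
      using g_eq[OF Gadd[OF gG[OF that(1)] gG[OF that(2)]]] .
    moreover have "g (a \<odot>\<^bsub>B\<^esub> x) = a \<odot>\<^bsub>E\<^esub> g x" if "a \<in> carrier R" "x \<in> carrier B" for x a
      using g_eq[OF Gsmult[OF that(1) gG[OF that(2)]]] .
    ultimately show ?thesis by (simp add: rmod_hom_def)
  qed
  moreover have "\<forall>x \<in> A. g x = f x" using g_eq[OF Gf] by blast
  ultimately show ?thesis by blast
qed


subsection \<open>Envelopes\<close>

definition essential_submodule ::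
    "('r, 's) ring_scheme \<Rightarrow> ('r, 'e, 't) module_scheme \<Rightarrow> 'e set \<Rightarrow> bool"
  where "essential_submodule R E A \<longleftrightarrow> submodule A R E \<and>
    (\<forall>B. submodule B R E \<and> B \<noteq> {\<zero>\<^bsub>E\<^esub>} \<longrightarrow> A \<inter> B \<noteq> {\<zero>\<^bsub>E\<^esub>})"

text \<open>
  \<open>E\<close> is an injective envelope of \<open>M\<close> by way of the embedding \<open>\<iota>\<close>.  The carriers of \<open>M\<close> and \<open>E\<close>
  may have different types, so \<open>M \<subseteq> E(M)\<close> becomes \<open>\<iota> ` carrier M \<subseteq> carrier E\<close>.
\<close>

definition injective_envelope ::
    "('r, 's) ring_scheme \<Rightarrow> ('r, 'm, 't) module_scheme \<Rightarrow> ('r, 'e, 'u) module_scheme \<Rightarrow> ('m \<Rightarrow> 'e) \<Rightarrow> bool"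
  where "injective_envelope R M E \<iota> \<longleftrightarrow> right_module R M \<and> injective_module R E \<and>
    \<iota> \<in> rmod_hom R M E \<and> inj_on \<iota> (carrier M) \<and> essential_submodule R E (\<iota> ` carrier M)"

text \<open>
  In the next two definitions \<open>E\<close>, \<open>\<iota>\<close> is meant to be an injective envelope of \<open>M\<close>; by uniqueness
  of envelopes the choice does not matter.
\<close>

definition automorphism_invariant ::
    "('r, 's) ring_scheme \<Rightarrow> ('r, 'm, 't) module_scheme \<Rightarrow> ('r, 'e, 'u) module_scheme \<Rightarrow> ('m \<Rightarrow> 'e) \<Rightarrow> bool"
  where "automorphism_invariant R M E \<iota> \<longleftrightarrow>
    (\<forall>f \<in> rmod_iso R E E. f ` (\<iota> ` carrier M) \<subseteq> \<iota> ` carrier M)"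

definition quasi_injective ::
    "('r, 's) ring_scheme \<Rightarrow> ('r, 'm, 't) module_scheme \<Rightarrow> ('r, 'e, 'u) module_scheme \<Rightarrow> ('m \<Rightarrow> 'e) \<Rightarrow> bool"
  where "quasi_injective R M E \<iota> \<longleftrightarrow>
    (\<forall>f \<in> rmod_hom R E E. f ` (\<iota> ` carrier M) \<subseteq> \<iota> ` carrier M)"

end

theory Submission
  imports Defs
begin

text \<open>
  Regard \<open>M\<close> as an essential submodule of \<open>E\<close>.  Finite Goldie dimension makes \<open>E\<close> a finite direct
  sum of indecomposable injective, hence uniform, modules \<open>E i\<close> with projections \<open>e i\<close>, and for every
  endomorphism \<open>u\<close> of \<open>E i\<close> one of \<open>u\<close>, \<open>1 - u\<close> is bijective.  As \<open>M\<close> is indecomposable and essential,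
  an idempotent endomorphism of \<open>E\<close> that preserves \<open>M\<close> is \<open>0\<close> or \<open>1\<close>.  A homomorphism \<open>h : E i \<rightarrow> E j\<close>
  with \<open>i \<noteq> j\<close> preserves \<open>M\<close>, because \<open>1 + h\<close> is an automorphism of \<open>E\<close>; an isomorphism \<open>E i \<cong> E j\<close>, or
  an endomorphism \<open>u\<close> of \<open>E i\<close> with both \<open>u\<close> and \<open>1 - u\<close> bijective, would therefore make \<open>e i\<close> preserve
  \<open>M\<close>, which is impossible once there are two summands.  A single summand is excluded since
  \<open>u = 1 - (1 - u)\<close> would then always preserve \<open>M\<close>.  Finally, an endomorphism of \<open>M\<close> extends to some
  \<open>g\<close> on \<open>E\<close>, and \<open>g\<close> is an automorphism plus a sum of some of the \<open>e i\<close>; this sum preserves \<open>M\<close>, so it is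
  \<open>0\<close> or \<open>1\<close> and \<open>g\<close> or \<open>1 - g\<close> is an automorphism.
\<close>

section \<open>Rings with residue field of two elements\<close>

text \<open>The obstacle is that non-isomorphic indecomposable injectives may still have nonzero
  homomorphisms between them, so an endomorphism \<open>g\<close> of \<open>E\<close> need not be
  diagonal. Non-isomorphism only gives each off-diagonal component a nonzero kernel. As each summand
  is uniform and there are finitely many of them, every summand contains a nonzero submodule on
  which \<open>g\<close> is diagonal, and these together span an essential submodule of
  \<open>E\<close>. Hence injective diagonal components already force \<open>g\<close> to be
  bijective, which is why subtracting suitable \<open>e i\<close> from \<open>g\<close> leaves an
  automorphism. For \<open>M\<close> the dichotomy has to travel both ways between \<open>f\<close>
  and a non-unique extension \<open>g\<close>: a bijective \<open>g\<close> restricts to a bijection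
  of \<open>M\<close> because its inverse also preserves \<open>M\<close>, while injectivity passes
  from \<open>f\<close> to \<open>g\<close> because \<open>M\<close> is essential. The decomposition
  of \<open>E\<close> is found in its endomorphism ring: infinitely many nonzero orthogonal
  idempotents would give an infinite independent family in \<open>M\<close>.\<close>

lemma (in ring) right_ideal_iff:
  "right_ideal R I \<longleftrightarrow> I \<subseteq> carrier R \<and> \<zero> \<in> I \<and> (\<forall>x\<in>I. \<forall>y\<in>I. x \<oplus> y \<in> I) \<and>
    (\<forall>x\<in>I. \<forall>a\<in>carrier R. x \<otimes> a \<in> I)" (is "?L \<longleftrightarrow> ?Q")
proof
  assume ?L
  then show ?Q
    using subgroup.subset[of I "add_monoid (right_regular R)"]
      subgroup.one_closed[of I "add_monoid (right_regular R)"]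
      subgroup.m_closed[of I "add_monoid (right_regular R)"]
      submodule.smult_closed[of I R "right_regular R"]
    unfolding right_ideal_def submodule_def by (auto simp: right_regular_def submodule_axioms_def)
next
  assume Q: ?Q
  have inv: "inv\<^bsub>add_monoid (right_regular R)\<^esub> x = \<ominus> x" for x
    by (simp add: m_inv_def a_inv_def right_regular_def)
  \<comment> \<open>Closure under negation comes from multiplication by
    \<open>\<ominus> \<one>\<close>.\<close>
  have "\<ominus> x \<in> I" if "x \<in> I" for x
  proof -
    have "x \<otimes> (\<ominus> \<one>) \<in> I" using Q that by auto
    moreover have "x \<otimes> (\<ominus> \<one>) = \<ominus> x" using that Q by (auto simp: r_minus)
    ultimately show ?thesis by simp
  qed
  then show ?L
    unfolding right_ideal_def
    by (intro submodule.intro subgroup.intro submodule_axioms.intro)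
      (use Q in \<open>simp_all add: inv subset_iff, simp_all add: right_regular_def\<close>)
qed

text \<open>The equivalence joins two demands: that one of \<open>x\<close>,
  \<open>\<one> \<ominus> x\<close> be a unit makes the ring local, and that they not both be units
  leaves a residue field with the elements 0 and 1 only. The case \<open>x = \<zero>\<close>
  excludes the zero ring.\<close>

locale F2_local_ring = ring +
  assumes Units_xor: "x \<in> carrier R \<Longrightarrow> x \<in> Units R \<longleftrightarrow> \<one> \<ominus> x \<notin> Units R"
begin

lemma zero_nonunit: "\<zero> \<notin> Units R"
  using Units_xor[of \<zero>] by (simp add: minus_eq)

lemma one_neq_zero: "\<one> \<noteq> \<zero>"
  using zero_nonunit Units_one_closed by metis

text \<open>A unit can be cancelled from \<open>f \<otimes> f = f\<close>; if \<open>f\<close> is no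
  unit, then \<open>\<one> \<ominus> f\<close> is one and can be cancelled from
  \<open>f \<otimes> (\<one> \<ominus> f) = \<zero>\<close>.\<close>

lemma idempotent_cases:
  assumes f: "f \<in> carrier R" "f \<otimes> f = f"
  shows "f = \<zero> \<or> f = \<one>"
proof (cases "f \<in> Units R")
  case True
  then have "inv f \<otimes> (f \<otimes> f) = f" using f(1) by (simp only: m_assoc[symmetric] Units_inv_closed Units_l_inv l_one)
  then show ?thesis using f True by simp
next
  case False
  then have u: "\<one> \<ominus> f \<in> Units R" using Units_xor f by blast
  have "f \<otimes> (\<one> \<ominus> f) = \<zero>" using f by (simp add: minus_eq r_distr r_minus r_neg)
  then have "f \<otimes> (\<one> \<ominus> f) \<otimes> inv (\<one> \<ominus> f) = \<zero>" using u by simp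
  then have "f = \<zero>" using f u by (simp add: m_assoc)
  then show ?thesis ..
qed

text \<open>The element \<open>y \<otimes> x\<close> is idempotent, hence 0 or 1, and 0 would give
  \<open>x = x \<otimes> (y \<otimes> x) = \<zero>\<close>. So one-sided inverses are two-sided,
  although the ring need not be commutative.\<close>

lemma unit_of_right_inverse:
  assumes "x \<in> carrier R" "y \<in> carrier R" "x \<otimes> y = \<one>"
  shows "x \<in> Units R" "y \<in> Units R"
proof -
  have "y \<otimes> x \<otimes> (y \<otimes> x) = y \<otimes> (x \<otimes> y) \<otimes> x" using assms(1,2) by (simp add: m_assoc)
  then have "y \<otimes> x = \<zero> \<or> y \<otimes> x = \<one>" using assms by (intro idempotent_cases) auto
  moreover have "y \<otimes> x \<noteq> \<zero>"
  proof
    assume "y \<otimes> x = \<zero>"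
    then have "x \<otimes> (y \<otimes> x) = \<zero>" using assms by simp
    then have "x = \<zero>" using assms by (simp add: m_assoc[symmetric])
    then show False using assms one_neq_zero by simp
  qed
  ultimately show "x \<in> Units R" "y \<in> Units R" using assms unfolding Units_def by blast+
qed

lemma Units_mult_iff:
  assumes "x \<in> carrier R" "y \<in> carrier R"
  shows "x \<otimes> y \<in> Units R \<longleftrightarrow> x \<in> Units R \<and> y \<in> Units R"
proof
  assume u: "x \<otimes> y \<in> Units R"
  have "x \<otimes> (y \<otimes> inv (x \<otimes> y)) = \<one>" "(inv (x \<otimes> y) \<otimes> x) \<otimes> y = \<one>"
    using assms u by (simp_all add: m_assoc[symmetric] Units_r_inv) (simp add: m_assoc)
  then show "x \<in> Units R \<and> y \<in> Units R"
    using unit_of_right_inverse assms u by (meson Units_inv_closed m_closed)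
qed auto

lemma Units_neg_iff:
  assumes "x \<in> carrier R" shows "\<ominus> x \<in> Units R \<longleftrightarrow> x \<in> Units R"
proof -
  have "\<ominus> \<one> \<in> Units R" by (rule unit_of_right_inverse[of _ "\<ominus> \<one>"]) (auto simp: l_minus r_minus)
  then show ?thesis using Units_mult_iff[of "\<ominus> \<one>" x] assms by (simp add: l_minus)
qed

text \<open>Factoring out \<open>y\<close> leaves 1 minus the nonunit
  \<open>\<ominus> (x \<otimes> inv y)\<close>.\<close>

lemma nonunit_add_unit:
  assumes "x \<in> carrier R" "y \<in> Units R" "x \<notin> Units R"
  shows "x \<oplus> y \<in> Units R"
proof -
  have "\<ominus> (x \<otimes> inv y) \<notin> Units R" using assms by (simp add: Units_neg_iff Units_mult_iff)
  then have "\<one> \<ominus> (\<ominus> (x \<otimes> inv y)) \<in> Units R" using Units_xor assms by (metis Units_inv_closed a_inv_closed m_closed)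
  moreover have "(\<one> \<ominus> (\<ominus> (x \<otimes> inv y))) \<otimes> y = x \<oplus> y"
    using assms by (simp add: minus_eq l_distr m_assoc a_comm Units_closed)
  ultimately show ?thesis using assms Units_m_closed by metis
qed

text \<open>Together with \<open>Units_mult_iff\<close> this makes the indicator function of the
  units a ring homomorphism to the integers mod 2.\<close>

lemma Units_add_iff:
  assumes "x \<in> carrier R" "y \<in> carrier R"
  shows "x \<oplus> y \<in> Units R \<longleftrightarrow> (x \<in> Units R \<longleftrightarrow> y \<notin> Units R)"
proof (cases "x \<in> Units R"; cases "y \<in> Units R")
  assume u: "x \<in> Units R" "y \<in> Units R"
  \<comment> \<open>The sum of two units is a unit times 1 minus the unit
    \<open>\<ominus> (inv x \<otimes> y)\<close>, and \<open>Units_xor\<close> makes such a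
    difference a nonunit.\<close>
  have "x \<oplus> y = x \<otimes> (\<one> \<ominus> (\<ominus> (inv x \<otimes> y)))"
    using u assms by (simp add: minus_eq r_distr m_assoc[symmetric])
  moreover have "\<one> \<ominus> (\<ominus> (inv x \<otimes> y)) \<notin> Units R"
    using u assms by (subst Units_xor[symmetric]) (auto simp: Units_neg_iff)
  ultimately show ?thesis using u assms by (simp add: Units_mult_iff)
next
  assume u: "x \<notin> Units R" "y \<notin> Units R"
  have "x \<oplus> y \<notin> Units R"
  proof
    assume "x \<oplus> y \<in> Units R"
    then have "\<ominus> y \<oplus> (x \<oplus> y) \<in> Units R" using assms u by (intro nonunit_add_unit[of "\<ominus> y"]) (auto simp: Units_neg_iff)
    moreover have "\<ominus> y \<oplus> (x \<oplus> y) = x" using assms by (simp add: a_comm[of x y] r_neg1)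
    ultimately show False using u by simp
  qed
  then show ?thesis using u by simp
qed (use nonunit_add_unit[of x y] nonunit_add_unit[of y x] assms in \<open>auto simp: a_comm\<close>)

text \<open>The nonunits form a right ideal by the parity rules, and a right ideal containing a unit
  is the whole ring; so they form the only maximal right ideal.\<close>

lemma jacobson_radical_eq: "jacobson_radical R = carrier R - Units R"
proof -
  let ?N = "carrier R - Units R"
  have rN: "right_ideal R ?N"
    unfolding right_ideal_iff using zero_nonunit by (auto simp: Units_add_iff Units_mult_iff)
  have sub: "K \<subseteq> ?N" if K: "right_ideal R K" "K \<noteq> carrier R" for K
  proof -
    have "x \<notin> Units R" if "x \<in> K" for x
    proof
      assume u: "x \<in> Units R"
      have "y \<in> K" if "y \<in> carrier R" for y
      proof -
        have "x \<otimes> (inv x \<otimes> y) \<in> K" using K(1) u that \<open>x \<in> K\<close> unfolding right_ideal_iff by auto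
        then show ?thesis using u that by (simp add: m_assoc[symmetric] Units_closed)
      qed
      then show False using K unfolding right_ideal_iff by auto
    qed
    then show ?thesis using K unfolding right_ideal_iff by auto
  qed
  have "maximal_right_ideal R ?N"
    unfolding maximal_right_ideal_def using rN sub Units_one_closed by blast
  moreover have "K = ?N" if "maximal_right_ideal R K" for K
    using that sub rN Units_one_closed unfolding maximal_right_ideal_def by blast
  ultimately show ?thesis unfolding jacobson_radical_def by blast
qed

text \<open>The unit indicator \<open>h\<close> is a homomorphism onto the field with two elements
  whose kernel is the set of nonunits, so the first isomorphism theorem applies.\<close>

theorem Quot_jacobson_radical_iso: "R Quot jacobson_radical R \<simeq> residue_ring 2"
proof -
  have c: "carrier (residue_ring 2) = {0, 1}" unfolding residue_ring_def by auto
  define h where "h x = (if x \<in> Units R then 1 else 0 :: int)" for x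
  interpret F: residues 2 "residue_ring 2" by unfold_locales auto
  interpret h: ring_hom_ring R "residue_ring 2" h
    by (rule ring_hom_ringI)
      (simp_all add: ring_axioms F.ring_axioms h_def Units_mult_iff Units_add_iff F.res_mult_eq F.res_add_eq F.res_one_eq c)
  have "a_kernel R (residue_ring 2) h = jacobson_radical R"
    unfolding a_kernel_def' jacobson_radical_eq by (auto simp: h_def residue_ring_def)
  moreover have "h ` carrier R = carrier (residue_ring 2)"
  proof -
    have "h \<zero> = 0" "h \<one> = 1" using zero_nonunit by (auto simp: h_def)
    moreover have "h ` carrier R \<subseteq> {0, 1}" by (auto simp: h_def)
    ultimately show ?thesis unfolding c using zero_closed one_closed
      by (metis (no_types, lifting) empty_subsetI imageI insert_subset subset_antisym)
  qed
  ultimately show ?thesis using h.FactRing_iso by simp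
qed

end

section \<open>Primitive idempotents\<close>

definition (in ring) orth_idem :: "'a \<Rightarrow> 'a \<Rightarrow> bool"
  where "orth_idem a b \<longleftrightarrow> a \<in> carrier R \<and> b \<in> carrier R \<and> a \<otimes> a = a \<and> b \<otimes> b = b \<and>
    a \<otimes> b = \<zero> \<and> b \<otimes> a = \<zero>"

definition (in ring) primitive_idem :: "'a \<Rightarrow> bool"
  where "primitive_idem e \<longleftrightarrow> e \<in> carrier R \<and> e \<otimes> e = e \<and> e \<noteq> \<zero> \<and>
    (\<forall>a b. orth_idem a b \<and> e = a \<oplus> b \<longrightarrow> a = \<zero> \<or> b = \<zero>)"

text \<open>A set can stand for the family of summands because nonzero orthogonal idempotents are
  distinct. The empty set decomposes \<open>\<zero>\<close>.\<close>

definition (in ring) primitive_decomposition :: "'a set \<Rightarrow> 'a \<Rightarrow> bool"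
  where "primitive_decomposition F p \<longleftrightarrow> finite F \<and> (\<forall>e\<in>F. primitive_idem e) \<and>
    (\<forall>e\<in>F. \<forall>f\<in>F. e \<noteq> f \<longrightarrow> e \<otimes> f = \<zero>) \<and> finsum R (\<lambda>e. e) F = p"

context ring
begin

text \<open>The hypotheses put the idempotent \<open>a\<close> into the corner ring
  \<open>eRe\<close>, whose identity is \<open>e\<close>, so \<open>e \<ominus> a\<close> is its
  complementary idempotent.\<close>

lemma orth_idem_complement:
  assumes "e \<in> carrier R" "a \<in> carrier R" "e \<otimes> e = e" "a \<otimes> a = a" "a \<otimes> e = a" "e \<otimes> a = a"
  shows "orth_idem a (e \<ominus> a)" "e = a \<oplus> (e \<ominus> a)"
proof -
  have "(e \<ominus> a) \<otimes> (e \<ominus> a) = e \<ominus> a" "a \<otimes> (e \<ominus> a) = \<zero>" "(e \<ominus> a) \<otimes> a = \<zero>"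
    using assms by (simp_all add: minus_eq l_distr r_distr l_minus r_minus r_neg l_neg a_assoc)
  then show "orth_idem a (e \<ominus> a)" using assms unfolding orth_idem_def by simp
  show "e = a \<oplus> (e \<ominus> a)" using assms(1,2) by (simp add: minus_eq a_comm[of e] r_neg2)
qed

lemma primitive_decomposition_absorb:
  assumes "primitive_decomposition F p" "e \<in> F"
  shows "p \<otimes> e = e" "e \<otimes> p = e"
proof -
  have F: "finite F" "\<And>e. e \<in> F \<Longrightarrow> e \<in> carrier R" "e \<otimes> e = e" and p: "p = finsum R (\<lambda>e. e) F"
    and o: "\<And>f. f \<in> F \<Longrightarrow> f \<noteq> e \<Longrightarrow> f \<otimes> e = \<zero> \<and> e \<otimes> f = \<zero>"
    using assms unfolding primitive_decomposition_def primitive_idem_def by auto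
  have "p \<otimes> e = finsum R (\<lambda>f. f \<otimes> e) F"
    unfolding p using F assms(2) by (intro finsum_ldistr) auto
  also have "\<dots> = finsum R (\<lambda>f. if f = e then e else \<zero>) F"
    using F o assms(2) by (intro finsum_cong') auto
  also have "\<dots> = e" using F assms(2) by (subst add.finprod_singleton_swap) auto
  finally show "p \<otimes> e = e" .
  have "e \<otimes> p = finsum R (\<lambda>f. e \<otimes> f) F"
    unfolding p using F assms(2) by (intro finsum_rdistr) auto
  also have "\<dots> = finsum R (\<lambda>f. if f = e then e else \<zero>) F"
    using F o assms(2) by (intro finsum_cong') auto
  also have "\<dots> = e" using F assms(2) by (subst add.finprod_singleton_swap) auto
  finally show "e \<otimes> p = e" .
qed

lemma primitive_decomposition_add:
  assumes o: "orth_idem p q" and F: "primitive_decomposition F p" and G: "primitive_decomposition G q"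
  shows "primitive_decomposition (F \<union> G) (p \<oplus> q)"
proof -
  have c: "e \<in> carrier R" "e \<noteq> \<zero>" "primitive_idem e" if "e \<in> F \<union> G" for e
    using that F G unfolding primitive_decomposition_def primitive_idem_def by auto
  have FG: "e \<otimes> f = \<zero>" "f \<otimes> e = \<zero>" if "e \<in> F" "f \<in> G" for e f
  proof -
    have pq: "p \<in> carrier R" "q \<in> carrier R" "p \<otimes> q = \<zero>" "q \<otimes> p = \<zero>"
      using o unfolding orth_idem_def by auto
    note e = primitive_decomposition_absorb[OF F that(1)]
    note f = primitive_decomposition_absorb[OF G that(2)]
    have ef: "e \<in> carrier R" "f \<in> carrier R" using c that by auto
    \<comment> \<open>Inserting the absorbed factors \<open>p\<close> and \<open>q\<close> passes
      their orthogonality on to \<open>e\<close> and \<open>f\<close>.\<close>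
    have "e \<otimes> f = (e \<otimes> p) \<otimes> (q \<otimes> f)" using e f by simp
    also have "\<dots> = e \<otimes> (p \<otimes> q) \<otimes> f" using ef pq(1,2) by (simp add: m_assoc)
    finally show "e \<otimes> f = \<zero>" using ef pq by simp
    have "f \<otimes> e = (f \<otimes> q) \<otimes> (p \<otimes> e)" using e f by simp
    also have "\<dots> = f \<otimes> (q \<otimes> p) \<otimes> e" using ef pq(1,2) by (simp add: m_assoc)
    finally show "f \<otimes> e = \<zero>" using ef pq by simp
  qed
  \<comment> \<open>A common element would be orthogonal to itself, hence zero; without this the sum
    over the union would count it only once.\<close>
  have "F \<inter> G = {}"
  proof (rule ccontr)
    assume "F \<inter> G \<noteq> {}"
    then obtain e where e: "e \<in> F" "e \<in> G" by auto
    then have "e \<otimes> e = \<zero>" using FG by simp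
    then show False using c[of e] e unfolding primitive_idem_def by auto
  qed
  moreover have "finite F" "finite G" "finsum R (\<lambda>e. e) F = p" "finsum R (\<lambda>e. e) G = q"
    using F G unfolding primitive_decomposition_def by auto
  ultimately have "finsum R (\<lambda>e. e) (F \<union> G) = p \<oplus> q"
    using c by (subst finsum_Un_disjoint) auto
  then show ?thesis using F G FG c unfolding primitive_decomposition_def by auto
qed

text \<open>A splitting that never ends peels off one nonzero idempotent after another, and these
  are pairwise orthogonal, which \<open>fin\<close> forbids.\<close>

theorem ex_primitive_decomposition:
  assumes fin: "\<And>f :: nat \<Rightarrow> 'a. (\<And>i j. i \<noteq> j \<Longrightarrow> orth_idem (f i) (f j)) \<Longrightarrow> \<exists>i. f i = \<zero>"
    and p: "p \<in> carrier R" "p \<otimes> p = p"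
  shows "\<exists>F. primitive_decomposition F p"
proof (rule ccontr)
  assume bad: "\<nexists>F. primitive_decomposition F p"
  \<comment> \<open>\<open>B\<close> marks the idempotents without a decomposition. When such an
    idempotent is split, one part is again of this kind; the other part is the one peeled
    off.\<close>
  define B where "B q \<longleftrightarrow> q \<in> carrier R \<and> q \<otimes> q = q \<and> (\<nexists>F. primitive_decomposition F q)" for q
  have step: "\<exists>b. B b \<and> (\<exists>a. orth_idem a b \<and> a \<noteq> \<zero> \<and> q = a \<oplus> b)" if q: "B q" for q
  proof -
    have "primitive_decomposition {} \<zero>" by (simp add: primitive_decomposition_def)
    moreover have "primitive_decomposition {q} q" if "primitive_idem q"
      using that by (auto simp: primitive_decomposition_def primitive_idem_def)
    ultimately have "q \<noteq> \<zero>" "\<not> primitive_idem q" using q unfolding B_def by blast+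
    then obtain a b where ab: "orth_idem a b" "q = a \<oplus> b" "a \<noteq> \<zero>" "b \<noteq> \<zero>"
      using q unfolding primitive_idem_def B_def by blast
    then have ba: "orth_idem b a" "q = b \<oplus> a" by (auto simp: orth_idem_def a_comm)
    have "B a \<or> B b"
      using primitive_decomposition_add[OF ab(1)] q ab(1) unfolding B_def ab(2) orth_idem_def by blast
    then show ?thesis using ab ba by blast
  qed
  have "\<exists>b. \<forall>n. B (b n) \<and> (\<exists>a. orth_idem a (b (Suc n)) \<and> a \<noteq> \<zero> \<and> b n = a \<oplus> b (Suc n))"
    using dependent_nat_choice[of "\<lambda>_ q. B q" "\<lambda>_ q b. \<exists>a. orth_idem a b \<and> a \<noteq> \<zero> \<and> q = a \<oplus> b"]
      step bad p unfolding B_def by (metis (no_types, lifting))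
  then obtain b a where b: "\<And>n. B (b n)" and a: "\<And>n. orth_idem (a n) (b (Suc n))" "\<And>n. a n \<noteq> \<zero>"
      "\<And>n. b n = a n \<oplus> b (Suc n)" by metis
  have c: "a n \<in> carrier R" "b n \<in> carrier R" "a n \<otimes> a n = a n" "b n \<otimes> b n = b n"
    "a n \<otimes> b (Suc n) = \<zero>" "b (Suc n) \<otimes> a n = \<zero>" for n
    using a(1)[of n] b[of n] by (auto simp: orth_idem_def B_def)
  \<comment> \<open>The remainders decrease: for \<open>m > n\<close>, \<open>a m\<close> lies below
    \<open>b m\<close>, hence below \<open>b (Suc n)\<close>, which is orthogonal to
    \<open>a n\<close>.\<close>
  have bb: "b (n + k) \<otimes> b n = b (n + k)" "b n \<otimes> b (n + k) = b (n + k)" for n k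
  proof (induction k)
    case (Suc k)
    have "b (Suc m) \<otimes> b m = b (Suc m)" "b m \<otimes> b (Suc m) = b (Suc m)" for m
      unfolding a(3)[of m] using c[of m] c[of "Suc m"] by (simp_all add: l_distr r_distr)
    then show "b (n + Suc k) \<otimes> b n = b (n + Suc k)" "b n \<otimes> b (n + Suc k) = b (n + Suc k)"
      using Suc c by (metis add_Suc_right m_assoc)+
  qed (auto simp: c)
  have ab: "b n \<otimes> a n = a n" "a n \<otimes> b n = a n" for n
    using c[of n] c(2)[of "Suc n"] by (subst a(3), simp add: l_distr r_distr)+
  have lt: "a n \<otimes> a m = \<zero>" "a m \<otimes> a n = \<zero>" if nm: "n < m" for n m
  proof -
    obtain k where m: "m = Suc n + k" using less_imp_Suc_add[OF nm] by auto
    have "b (Suc n) \<otimes> a m = a m"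
      using bb(2)[of "Suc n" k] ab(1)[of m] m_assoc[of "b (Suc n)" "b m" "a m"] c(1,2) unfolding m
      by simp
    then have "a n \<otimes> a m = (a n \<otimes> b (Suc n)) \<otimes> a m"
      using m_assoc[of "a n" "b (Suc n)" "a m"] c(1,2) by simp
    then show "a n \<otimes> a m = \<zero>" using c by simp
    have "a m \<otimes> b (Suc n) = a m"
      using bb(1)[of "Suc n" k] ab(2)[of m] m_assoc[of "a m" "b m" "b (Suc n)"] c(1,2) unfolding m
      by simp
    then have "a m \<otimes> a n = a m \<otimes> (b (Suc n) \<otimes> a n)"
      using m_assoc[of "a m" "b (Suc n)" "a n"] c(1,2) by simp
    then show "a m \<otimes> a n = \<zero>" using c by simp
  qed
  have "orth_idem (a i) (a j)" if "i \<noteq> j" for i j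
    using lt[of i j] lt[of j i] that c unfolding orth_idem_def by (cases "i < j") auto
  then show False using fin a(2) by blast
qed

end

section \<open>Right modules and their endomorphism rings\<close>

lemma rmod_homI:
  assumes "\<And>x. x \<in> carrier M \<Longrightarrow> f x \<in> carrier N"
    and "\<And>x y. x \<in> carrier M \<Longrightarrow> y \<in> carrier M \<Longrightarrow> f (x \<oplus>\<^bsub>M\<^esub> y) = f x \<oplus>\<^bsub>N\<^esub> f y"
    and "\<And>a x. a \<in> carrier R \<Longrightarrow> x \<in> carrier M \<Longrightarrow> f (a \<odot>\<^bsub>M\<^esub> x) = a \<odot>\<^bsub>N\<^esub> f x"
  shows "f \<in> rmod_hom R M N"
  using assms by (auto simp: rmod_hom_def)

lemma rmod_homD:
  assumes "f \<in> rmod_hom R M N"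
  shows "x \<in> carrier M \<Longrightarrow> f x \<in> carrier N"
    and "x \<in> carrier M \<Longrightarrow> y \<in> carrier M \<Longrightarrow> f (x \<oplus>\<^bsub>M\<^esub> y) = f x \<oplus>\<^bsub>N\<^esub> f y"
    and "a \<in> carrier R \<Longrightarrow> x \<in> carrier M \<Longrightarrow> f (a \<odot>\<^bsub>M\<^esub> x) = a \<odot>\<^bsub>N\<^esub> f x"
  using assms by (auto simp: rmod_hom_def)

lemma rmod_hom_compose:
  "f \<in> rmod_hom R L M \<Longrightarrow> g \<in> rmod_hom R M N \<Longrightarrow> (\<lambda>x. g (f x)) \<in> rmod_hom R L N"
  by (rule rmod_homI) (simp_all add: rmod_homD[of _ R])

lemma rmod_hom_cong:
  assumes "right_module R M" "f \<in> rmod_hom R M N" "\<And>x. x \<in> carrier M \<Longrightarrow> g x = f x"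
  shows "g \<in> rmod_hom R M N"
proof -
  interpret right_module R M by fact
  show ?thesis using assms(2,3) by (auto intro!: rmod_homI simp: rmod_homD[of _ R])
qed

lemma rmod_hom_restrict_dom:
  "f \<in> rmod_hom R M N \<Longrightarrow> A \<subseteq> carrier M \<Longrightarrow> f \<in> rmod_hom R (M\<lparr>carrier := A\<rparr>) N"
  unfolding rmod_hom_def by (auto simp: subset_iff)

lemma rmod_hom_restrict_cod:
  "f \<in> rmod_hom R M N \<Longrightarrow> f ` carrier M \<subseteq> B \<Longrightarrow> f \<in> rmod_hom R M (N\<lparr>carrier := B\<rparr>)"
  unfolding rmod_hom_def by auto

lemma rmod_hom_extend_cod:
  "f \<in> rmod_hom R M (N\<lparr>carrier := B\<rparr>) \<Longrightarrow> B \<subseteq> carrier N \<Longrightarrow> f \<in> rmod_hom R M N"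
  unfolding rmod_hom_def by auto

lemma rmod_hom_inverse:
  assumes M: "right_module R M" and f: "f \<in> rmod_hom R M N" "bij_betw f (carrier M) (carrier N)"
  shows "inv_into (carrier M) f \<in> rmod_hom R N M"
proof -
  interpret right_module R M by fact
  let ?g = "inv_into (carrier M) f"
  have g: "?g y \<in> carrier M" "f (?g y) = y" if "y \<in> carrier N" for y
    using f(2) that by (auto simp: bij_betw_def inv_into_into f_inv_into_f)
  have eq: "?g y = x" if "x \<in> carrier M" "f x = y" for x y
    using f(2) that by (auto simp: bij_betw_def)
  show ?thesis
    by (rule rmod_homI) (use f(1) g in \<open>auto intro!: eq simp: rmod_homD\<close>)
qed

lemma set_add_carrier_update [simp]: "A <+>\<^bsub>M\<lparr>carrier := X\<rparr>\<^esub> B = A <+>\<^bsub>M\<^esub> B"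
  by (simp add: set_add_def')

section \<open>Submodules, their sums and cyclic submodules\<close>

context right_module
begin

lemma zero_smult [simp]: "x \<in> carrier M \<Longrightarrow> \<zero>\<^bsub>R\<^esub> \<odot>\<^bsub>M\<^esub> x = \<zero>\<^bsub>M\<^esub>"
  using smult_l_distr[of "\<zero>\<^bsub>R\<^esub>" "\<zero>\<^bsub>R\<^esub>" x] by (simp add: M.add.l_cancel_one)

lemma smult_zero [simp]: "a \<in> carrier R \<Longrightarrow> a \<odot>\<^bsub>M\<^esub> \<zero>\<^bsub>M\<^esub> = \<zero>\<^bsub>M\<^esub>"
  using smult_r_distr[of a "\<zero>\<^bsub>M\<^esub>" "\<zero>\<^bsub>M\<^esub>"] by (simp add: M.add.l_cancel_one)

lemma neg_zero [simp]: "\<ominus>\<^bsub>M\<^esub> \<zero>\<^bsub>M\<^esub> = \<zero>\<^bsub>M\<^esub>"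
  by (intro M.minus_equality) simp_all

lemma eq_minus_iff: "x \<in> carrier M \<Longrightarrow> y \<in> carrier M \<Longrightarrow> x \<ominus>\<^bsub>M\<^esub> y = \<zero>\<^bsub>M\<^esub> \<longleftrightarrow> x = y"
  by (metis M.add.inv_solve_right' M.l_zero M.minus_eq M.r_neg M.zero_closed)

lemma minus_one_smult: "x \<in> carrier M \<Longrightarrow> (\<ominus>\<^bsub>R\<^esub> \<one>\<^bsub>R\<^esub>) \<odot>\<^bsub>M\<^esub> x = \<ominus>\<^bsub>M\<^esub> x"
  using smult_l_distr[of "\<ominus>\<^bsub>R\<^esub> \<one>\<^bsub>R\<^esub>" "\<one>\<^bsub>R\<^esub>" x]
  by (intro M.minus_equality[symmetric]) (auto simp: R.l_neg)

lemma smult_minus: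
  assumes "a \<in> carrier R" "x \<in> carrier M"
  shows "a \<odot>\<^bsub>M\<^esub> (\<ominus>\<^bsub>M\<^esub> x) = \<ominus>\<^bsub>M\<^esub> (a \<odot>\<^bsub>M\<^esub> x)"
proof -
  have "a \<odot>\<^bsub>M\<^esub> (\<ominus>\<^bsub>M\<^esub> x) \<oplus>\<^bsub>M\<^esub> a \<odot>\<^bsub>M\<^esub> x = \<zero>\<^bsub>M\<^esub>"
    using assms by (simp add: smult_r_distr[symmetric] M.l_neg)
  then show ?thesis using assms by (intro M.minus_equality[symmetric]) auto
qed

lemma submodule_iff:
  "submodule A R M \<longleftrightarrow> A \<subseteq> carrier M \<and> \<zero>\<^bsub>M\<^esub> \<in> A \<and> (\<forall>x\<in>A. \<forall>y\<in>A. x \<oplus>\<^bsub>M\<^esub> y \<in> A) \<and>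
    (\<forall>a\<in>carrier R. \<forall>x\<in>A. a \<odot>\<^bsub>M\<^esub> x \<in> A)" (is "?L \<longleftrightarrow> ?Q")
proof
  assume ?L
  then interpret submodule A R M .
  show ?Q using subset one_closed m_closed smult_closed by simp
next
  assume Q: ?Q
  have inv: "inv\<^bsub>add_monoid M\<^esub> x \<in> A" if "x \<in> A" for x
  proof -
    have "x \<in> carrier M" "(\<ominus>\<^bsub>R\<^esub> \<one>\<^bsub>R\<^esub>) \<odot>\<^bsub>M\<^esub> x \<in> A" using Q that by auto
    then show ?thesis using minus_one_smult[of x] by (simp add: a_inv_def)
  qed
  show ?L
    by (intro submodule.intro subgroup.intro submodule_axioms.intro) (simp_all add: Q inv)
qed

lemma submoduleI:
  assumes "A \<subseteq> carrier M" "\<zero>\<^bsub>M\<^esub> \<in> A" "\<And>x y. x \<in> A \<Longrightarrow> y \<in> A \<Longrightarrow> x \<oplus>\<^bsub>M\<^esub> y \<in> A"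
    "\<And>a x. a \<in> carrier R \<Longrightarrow> x \<in> A \<Longrightarrow> a \<odot>\<^bsub>M\<^esub> x \<in> A"
  shows "submodule A R M"
  using assms unfolding submodule_iff by blast

lemma submoduleD:
  assumes "submodule A R M"
  shows "A \<subseteq> carrier M" "x \<in> A \<Longrightarrow> x \<in> carrier M" "\<zero>\<^bsub>M\<^esub> \<in> A"
    "x \<in> A \<Longrightarrow> y \<in> A \<Longrightarrow> x \<oplus>\<^bsub>M\<^esub> y \<in> A"
    "a \<in> carrier R \<Longrightarrow> x \<in> A \<Longrightarrow> a \<odot>\<^bsub>M\<^esub> x \<in> A"
    "x \<in> A \<Longrightarrow> \<ominus>\<^bsub>M\<^esub> x \<in> A" "x \<in> A \<Longrightarrow> y \<in> A \<Longrightarrow> x \<ominus>\<^bsub>M\<^esub> y \<in> A"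
proof -
  have 1: "A \<subseteq> carrier M" "\<zero>\<^bsub>M\<^esub> \<in> A" "\<And>x y. x \<in> A \<Longrightarrow> y \<in> A \<Longrightarrow> x \<oplus>\<^bsub>M\<^esub> y \<in> A"
    "\<And>a x. a \<in> carrier R \<Longrightarrow> x \<in> A \<Longrightarrow> a \<odot>\<^bsub>M\<^esub> x \<in> A"
    using assms unfolding submodule_iff by blast+
  have 2: "\<ominus>\<^bsub>M\<^esub> x \<in> A" if "x \<in> A" for x
    using 1(1) 1(4)[of "\<ominus>\<^bsub>R\<^esub> \<one>\<^bsub>R\<^esub>" x] that minus_one_smult[of x] by auto
  show "A \<subseteq> carrier M" "x \<in> A \<Longrightarrow> x \<in> carrier M" "\<zero>\<^bsub>M\<^esub> \<in> A"
    "x \<in> A \<Longrightarrow> y \<in> A \<Longrightarrow> x \<oplus>\<^bsub>M\<^esub> y \<in> A"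
    "a \<in> carrier R \<Longrightarrow> x \<in> A \<Longrightarrow> a \<odot>\<^bsub>M\<^esub> x \<in> A"
    "x \<in> A \<Longrightarrow> \<ominus>\<^bsub>M\<^esub> x \<in> A" "x \<in> A \<Longrightarrow> y \<in> A \<Longrightarrow> x \<ominus>\<^bsub>M\<^esub> y \<in> A"
    using 1 2 by (auto simp: M.minus_eq)
qed

lemma right_module_submodule:
  assumes A: "submodule A R M" shows "right_module R (M\<lparr>carrier := A\<rparr>)"
proof -
  note D = submoduleD[OF A]
  have "abelian_group (M\<lparr>carrier := A\<rparr>)"
  proof (rule abelian_groupI, goal_cases)
    case (6 x)
    then show ?case using D by (auto intro!: bexI[of _ "\<ominus>\<^bsub>M\<^esub> x"] M.l_neg)
  qed (use D in \<open>auto simp: M.a_ac\<close>)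
  then show ?thesis
    by (intro right_module.intro R.ring_axioms right_module_axioms.intro)
      (use D in \<open>auto simp: smult_l_distr smult_r_distr smult_assoc\<close>)
qed

lemma submodule_submodule_iff:
  assumes A: "submodule A R M"
  shows "submodule B R (M\<lparr>carrier := A\<rparr>) \<longleftrightarrow> submodule B R M \<and> B \<subseteq> A"
proof -
  interpret A: right_module R "M\<lparr>carrier := A\<rparr>" by (rule right_module_submodule[OF A])
  show ?thesis unfolding A.submodule_iff submodule_iff using submoduleD(1)[OF A] by auto
qed

text \<open>Negation in the restricted record is defined by an inverse sought inside
  \<open>A\<close>, so agreement with \<open>M\<close> rests on uniqueness of inverses and on
  \<open>A\<close> being closed under negation.\<close>

lemma submodule_minus:
  assumes A: "submodule A R M" and y: "y \<in> A"
  shows "x \<ominus>\<^bsub>M\<lparr>carrier := A\<rparr>\<^esub> y = x \<ominus>\<^bsub>M\<^esub> y"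
proof -
  interpret A: right_module R "M\<lparr>carrier := A\<rparr>" by (rule right_module_submodule[OF A])
  have "\<ominus>\<^bsub>M\<lparr>carrier := A\<rparr>\<^esub> y = \<ominus>\<^bsub>M\<^esub> y"
    using submoduleD(2,6)[OF A y] y by (intro A.M.minus_equality) (simp_all add: M.l_neg)
  then show ?thesis by (simp add: a_minus_def)
qed

lemma submodule_carrier: "submodule (carrier M) R M"
  by (rule submoduleI) auto

lemma submodule_Int: "submodule A R M \<Longrightarrow> submodule B R M \<Longrightarrow> submodule (A \<inter> B) R M"
  unfolding submodule_iff by blast

lemma submodule_cyclic:
  assumes "x \<in> carrier M" shows "submodule ((\<lambda>a. a \<odot>\<^bsub>M\<^esub> x) ` carrier R) R M"
proof (rule submoduleI)
  show "\<zero>\<^bsub>M\<^esub> \<in> (\<lambda>a. a \<odot>\<^bsub>M\<^esub> x) ` carrier R" using assms by (auto intro!: image_eqI[of _ _ "\<zero>\<^bsub>R\<^esub>"])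
next
  fix y z assume "y \<in> (\<lambda>a. a \<odot>\<^bsub>M\<^esub> x) ` carrier R" "z \<in> (\<lambda>a. a \<odot>\<^bsub>M\<^esub> x) ` carrier R"
  then obtain a b where "a \<in> carrier R" "b \<in> carrier R" "y = a \<odot>\<^bsub>M\<^esub> x" "z = b \<odot>\<^bsub>M\<^esub> x" by auto
  then show "y \<oplus>\<^bsub>M\<^esub> z \<in> (\<lambda>a. a \<odot>\<^bsub>M\<^esub> x) ` carrier R"
    using assms by (auto simp: smult_l_distr intro!: image_eqI[of _ _ "a \<oplus>\<^bsub>R\<^esub> b"])
next
  fix b y assume b: "b \<in> carrier R" and "y \<in> (\<lambda>a. a \<odot>\<^bsub>M\<^esub> x) ` carrier R"
  then obtain a where "a \<in> carrier R" "y = a \<odot>\<^bsub>M\<^esub> x" by auto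
  then show "b \<odot>\<^bsub>M\<^esub> y \<in> (\<lambda>a. a \<odot>\<^bsub>M\<^esub> x) ` carrier R"
    using assms b by (auto simp: smult_assoc intro!: image_eqI[of _ _ "a \<otimes>\<^bsub>R\<^esub> b"])
qed (use assms in auto)

lemma mem_set_add: "x \<in> A <+>\<^bsub>M\<^esub> B \<longleftrightarrow> (\<exists>a\<in>A. \<exists>b\<in>B. x = a \<oplus>\<^bsub>M\<^esub> b)"
  by (auto simp: set_add_def')

lemma submodule_set_add:
  assumes A: "submodule A R M" and B: "submodule B R M"
  shows "submodule (A <+>\<^bsub>M\<^esub> B) R M" "A \<subseteq> A <+>\<^bsub>M\<^esub> B" "B \<subseteq> A <+>\<^bsub>M\<^esub> B"
proof -
  note DA = submoduleD[OF A] note DB = submoduleD[OF B]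
  show "submodule (A <+>\<^bsub>M\<^esub> B) R M"
  proof (rule submoduleI)
    show "A <+>\<^bsub>M\<^esub> B \<subseteq> carrier M" using DA DB by (auto simp: mem_set_add)
    show "\<zero>\<^bsub>M\<^esub> \<in> A <+>\<^bsub>M\<^esub> B"
      using DA(3) DB(3) unfolding mem_set_add by (intro bexI[of _ "\<zero>\<^bsub>M\<^esub>"]) auto
  next
    fix x y assume "x \<in> A <+>\<^bsub>M\<^esub> B" "y \<in> A <+>\<^bsub>M\<^esub> B"
    then obtain a b a' b' where 1: "a \<in> A" "b \<in> B" "a' \<in> A" "b' \<in> B" "x = a \<oplus>\<^bsub>M\<^esub> b" "y = a' \<oplus>\<^bsub>M\<^esub> b'"
      unfolding mem_set_add by blast
    then have "x \<oplus>\<^bsub>M\<^esub> y = (a \<oplus>\<^bsub>M\<^esub> a') \<oplus>\<^bsub>M\<^esub> (b \<oplus>\<^bsub>M\<^esub> b')"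
      using DA(2) DB(2) by (simp add: M.a_ac)
    then show "x \<oplus>\<^bsub>M\<^esub> y \<in> A <+>\<^bsub>M\<^esub> B" using 1 DA(4) DB(4) unfolding mem_set_add by blast
  next
    fix r x assume r: "r \<in> carrier R" and "x \<in> A <+>\<^bsub>M\<^esub> B"
    then obtain a b where ab: "a \<in> A" "b \<in> B" "x = a \<oplus>\<^bsub>M\<^esub> b" unfolding mem_set_add by blast
    then have "r \<odot>\<^bsub>M\<^esub> x = r \<odot>\<^bsub>M\<^esub> a \<oplus>\<^bsub>M\<^esub> r \<odot>\<^bsub>M\<^esub> b"
      using r DA(2) DB(2) by (simp add: smult_r_distr)
    then show "r \<odot>\<^bsub>M\<^esub> x \<in> A <+>\<^bsub>M\<^esub> B"
      using r ab DA(5) DB(5) unfolding mem_set_add by blast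
  qed
  have "a \<in> A <+>\<^bsub>M\<^esub> B" if "a \<in> A" for a
    unfolding mem_set_add using that DA(2) DB(3) by (intro bexI[of _ a] bexI[of _ "\<zero>\<^bsub>M\<^esub>"]) auto
  then show "A \<subseteq> A <+>\<^bsub>M\<^esub> B" by blast
  have "b \<in> A <+>\<^bsub>M\<^esub> B" if "b \<in> B" for b
    unfolding mem_set_add using that DB(2) DA(3) by (intro bexI[of _ b] bexI[of _ "\<zero>\<^bsub>M\<^esub>"]) auto
  then show "B \<subseteq> A <+>\<^bsub>M\<^esub> B" by blast
qed

lemma finsum_single:
  assumes "finite J" "\<And>i. i \<in> J \<Longrightarrow> i \<noteq> j \<Longrightarrow> f i = \<zero>\<^bsub>M\<^esub>" "f j \<in> carrier M"
  shows "finsum M f J = (if j \<in> J then f j else \<zero>\<^bsub>M\<^esub>)"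
proof -
  have "finsum M f J = finsum M (\<lambda>i. if i = j then f j else \<zero>\<^bsub>M\<^esub>) J"
    using assms(2,3) by (intro M.finsum_cong') auto
  also have "\<dots> = (if j \<in> J then f j else \<zero>\<^bsub>M\<^esub>)"
  proof (cases "j \<in> J")
    case True
    then show ?thesis
      using M.add.finprod_singleton_swap[of j J "\<lambda>_. f j"] assms(1,3) by simp
  next
    case False
    then have "finsum M (\<lambda>i. if i = j then f j else \<zero>\<^bsub>M\<^esub>) J = finsum M (\<lambda>i. \<zero>\<^bsub>M\<^esub>) J"
      by (intro M.finsum_cong') auto
    then show ?thesis using False by simp
  qed
  finally show ?thesis .
qed

lemma rmod_hom_id: "(\<lambda>x. x) \<in> rmod_hom R M M"
  by (rule rmod_homI) auto

end

section \<open>Kernels, images and sums of homomorphisms\<close>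

locale right_module_hom = M: right_module R M + N: right_module R N
  for R :: "('r, 's) ring_scheme" and M :: "('r, 'm, 't) module_scheme"
    and N :: "('r, 'n, 'u) module_scheme" + fixes f
  assumes hom: "f \<in> rmod_hom R M N"
begin

lemma closed [simp]: "x \<in> carrier M \<Longrightarrow> f x \<in> carrier N"
  and add [simp]: "x \<in> carrier M \<Longrightarrow> y \<in> carrier M \<Longrightarrow> f (x \<oplus>\<^bsub>M\<^esub> y) = f x \<oplus>\<^bsub>N\<^esub> f y"
  and smult [simp]: "a \<in> carrier R \<Longrightarrow> x \<in> carrier M \<Longrightarrow> f (a \<odot>\<^bsub>M\<^esub> x) = a \<odot>\<^bsub>N\<^esub> f x"
  using hom by (auto simp: rmod_homD)

lemma zero [simp]: "f \<zero>\<^bsub>M\<^esub> = \<zero>\<^bsub>N\<^esub>"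
  using smult[of "\<zero>\<^bsub>R\<^esub>" "\<zero>\<^bsub>M\<^esub>"] by (simp del: smult)

lemma neg [simp]: "x \<in> carrier M \<Longrightarrow> f (\<ominus>\<^bsub>M\<^esub> x) = \<ominus>\<^bsub>N\<^esub> f x"
  using smult[of "\<ominus>\<^bsub>R\<^esub> \<one>\<^bsub>R\<^esub>" x] by (simp add: M.minus_one_smult N.minus_one_smult del: smult)

lemma minus [simp]: "x \<in> carrier M \<Longrightarrow> y \<in> carrier M \<Longrightarrow> f (x \<ominus>\<^bsub>M\<^esub> y) = f x \<ominus>\<^bsub>N\<^esub> f y"
  by (simp add: M.minus_eq N.minus_eq)

lemma finsum:
  assumes "finite F" "\<And>i. i \<in> F \<Longrightarrow> x i \<in> carrier M"
  shows "f (finsum M x F) = finsum N (\<lambda>i. f (x i)) F"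
  using assms
proof (induction F rule: finite_induct)
  case (insert i F)
  then show ?case by (simp add: M.finsum_insert N.finsum_insert Pi_iff M.finsum_closed)
qed simp

lemma submodule_vimage:
  assumes "submodule B R N" shows "submodule {x \<in> carrier M. f x \<in> B} R M"
  using N.submoduleD[OF assms] by (intro M.submoduleI) auto

lemma submodule_image:
  assumes "submodule A R M" shows "submodule (f ` A) R N"
proof (rule N.submoduleI)
  note D = M.submoduleD[OF assms]
  show "f ` A \<subseteq> carrier N" using D by auto
  show "\<zero>\<^bsub>N\<^esub> \<in> f ` A" using D(3) zero by (metis imageI)
  show "x \<oplus>\<^bsub>N\<^esub> y \<in> f ` A" if "x \<in> f ` A" "y \<in> f ` A" for x y
    using that D(2,4) by (auto simp: add[symmetric] simp del: add)
  show "a \<odot>\<^bsub>N\<^esub> x \<in> f ` A" if "a \<in> carrier R" "x \<in> f ` A" for x a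
    using that D(2,5) by (auto simp: smult[symmetric] simp del: smult)
qed

lemma submodule_kernel:
  assumes "submodule A R M" shows "submodule {x \<in> A. f x = \<zero>\<^bsub>N\<^esub>} R M"
  using M.submoduleD[OF assms] by (intro M.submoduleI) auto

lemma inj_on_iff:
  assumes "submodule A R M"
  shows "inj_on f A \<longleftrightarrow> (\<forall>x\<in>A. f x = \<zero>\<^bsub>N\<^esub> \<longrightarrow> x = \<zero>\<^bsub>M\<^esub>)"
proof
  assume "inj_on f A"
  then show "\<forall>x\<in>A. f x = \<zero>\<^bsub>N\<^esub> \<longrightarrow> x = \<zero>\<^bsub>M\<^esub>"
    using M.submoduleD(3)[OF assms] zero by (metis inj_onD)
next
  note D = M.submoduleD[OF assms]
  assume 0: "\<forall>x\<in>A. f x = \<zero>\<^bsub>N\<^esub> \<longrightarrow> x = \<zero>\<^bsub>M\<^esub>"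
  show "inj_on f A"
  proof (rule inj_onI)
    fix x y assume xy: "x \<in> A" "y \<in> A" "f x = f y"
    then have "f (x \<ominus>\<^bsub>M\<^esub> y) = \<zero>\<^bsub>N\<^esub>" using D(2) by (simp add: N.minus_eq N.M.r_neg)
    then have "x \<ominus>\<^bsub>M\<^esub> y = \<zero>\<^bsub>M\<^esub>" using 0 D(7) xy by blast
    then show "x = y" using D(2)[OF xy(1)] D(2)[OF xy(2)] by (simp add: M.eq_minus_iff)
  qed
qed

end

lemma rmod_isoI:
  assumes "f \<in> rmod_hom R M M" "g \<in> rmod_hom R M M"
    "\<And>x. x \<in> carrier M \<Longrightarrow> g (f x) = x" "\<And>x. x \<in> carrier M \<Longrightarrow> f (g x) = x"
  shows "f \<in> rmod_iso R M M"
proof -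
  have "bij_betw f (carrier M) (carrier M)"
    by (rule bij_betwI[of _ _ _ g]) (use assms rmod_homD(1)[OF assms(1)] rmod_homD(1)[OF assms(2)] in \<open>simp_all\<close>)
  then show ?thesis using assms(1) by (simp add: rmod_iso_def)
qed

lemma right_module_homI:
  "right_module R M \<Longrightarrow> right_module R N \<Longrightarrow> f \<in> rmod_hom R M N \<Longrightarrow> right_module_hom R M N f"
  by (simp add: right_module_hom_def right_module_hom_axioms_def)

lemma rmod_hom_add:
  assumes "right_module R M" "right_module R N" "f \<in> rmod_hom R M N" "g \<in> rmod_hom R M N"
  shows "(\<lambda>x. f x \<oplus>\<^bsub>N\<^esub> g x) \<in> rmod_hom R M N"
proof -
  interpret f: right_module_hom R M N f using assms by (intro right_module_homI)
  interpret g: right_module_hom R M N g using assms by (intro right_module_homI)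
  show ?thesis by (rule rmod_homI) (auto simp: f.N.M.a_ac f.N.smult_r_distr)
qed

lemma rmod_hom_minus:
  assumes "right_module R M" "right_module R N" "f \<in> rmod_hom R M N" "g \<in> rmod_hom R M N"
  shows "(\<lambda>x. f x \<ominus>\<^bsub>N\<^esub> g x) \<in> rmod_hom R M N"
proof -
  interpret f: right_module_hom R M N f using assms by (intro right_module_homI)
  interpret g: right_module_hom R M N g using assms by (intro right_module_homI)
  show ?thesis
    by (rule rmod_homI)
      (auto simp: f.N.M.minus_eq f.N.M.minus_add f.N.M.a_ac f.N.smult_r_distr f.N.smult_minus)
qed

lemma rmod_hom_zero:
  assumes "right_module R M" "right_module R N"
  shows "(\<lambda>x. \<zero>\<^bsub>N\<^esub>) \<in> rmod_hom R M N"
proof -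
  interpret M: right_module R M by fact
  interpret N: right_module R N by fact
  show ?thesis by (rule rmod_homI) auto
qed

lemma rmod_hom_finsum:
  assumes "right_module R M" "right_module R N" "finite J" "\<And>j. j \<in> J \<Longrightarrow> f j \<in> rmod_hom R M N"
  shows "(\<lambda>x. finsum N (\<lambda>j. f j x) J) \<in> rmod_hom R M N"
  using assms(3,4)
proof (induction J rule: finite_induct)
  case empty
  interpret N: right_module R N by fact
  show ?case using rmod_hom_zero[OF assms(1,2)] by simp
next
  case (insert j J)
  interpret N: right_module R N by fact
  have "(\<lambda>x. f j x \<oplus>\<^bsub>N\<^esub> finsum N (\<lambda>j. f j x) J) \<in> rmod_hom R M N"
    using insert by (intro rmod_hom_add assms(1,2)) auto
  moreover have "f i x \<in> carrier N" if "x \<in> carrier M" "i \<in> insert j J" for x i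
    using rmod_homD(1)[OF insert.prems[OF that(2)]] that by blast
  ultimately show ?case
    by (elim rmod_hom_cong[OF assms(1)]) (use insert.hyps in \<open>simp add: N.finsum_insert Pi_iff\<close>)
qed

section \<open>The endomorphism ring\<close>

lemma endo_ring_simps:
  "carrier (endo_ring R M) = rmod_hom R M M \<inter> extensional (carrier M)"
  "f \<otimes>\<^bsub>endo_ring R M\<^esub> g = compose (carrier M) f g"
  "\<one>\<^bsub>endo_ring R M\<^esub> = (\<lambda>x \<in> carrier M. x)"
  "\<zero>\<^bsub>endo_ring R M\<^esub> = (\<lambda>x \<in> carrier M. \<zero>\<^bsub>M\<^esub>)"
  "f \<oplus>\<^bsub>endo_ring R M\<^esub> g = (\<lambda>x \<in> carrier M. f x \<oplus>\<^bsub>M\<^esub> g x)"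
  by (simp_all add: endo_ring_def)

context right_module
begin

lemma rmod_hom_restrict: "f \<in> rmod_hom R M M \<Longrightarrow> restrict f (carrier M) \<in> carrier (endo_ring R M)"
  unfolding endo_ring_simps by (simp add: rmod_hom_def Pi_iff)

lemma endoD:
  assumes "f \<in> carrier (endo_ring R M)"
  shows "f \<in> rmod_hom R M M" "x \<in> carrier M \<Longrightarrow> f x \<in> carrier M"
  using assms by (auto simp: endo_ring_simps rmod_hom_def)

lemma endo_eqI:
  assumes "f \<in> carrier (endo_ring R M)" "g \<in> carrier (endo_ring R M)"
    "\<And>x. x \<in> carrier M \<Longrightarrow> f x = g x"
  shows "f = g"
  using assms by (intro extensionalityI[of _ "carrier M"]) (auto simp: endo_ring_simps)

lemma endo_closed:
  assumes "f \<in> carrier (endo_ring R M)" "g \<in> carrier (endo_ring R M)"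
  shows "f \<otimes>\<^bsub>endo_ring R M\<^esub> g \<in> carrier (endo_ring R M)"
    "f \<oplus>\<^bsub>endo_ring R M\<^esub> g \<in> carrier (endo_ring R M)"
  unfolding endo_ring_simps(2,5) compose_def
  by (intro rmod_hom_restrict rmod_hom_compose[OF endoD(1)[OF assms(2)] endoD(1)[OF assms(1)]]
      rmod_hom_add[OF right_module_axioms right_module_axioms endoD(1)[OF assms(1)] endoD(1)[OF assms(2)]])+

lemma endo_apply [simp]:
  assumes "x \<in> carrier M"
  shows "(f \<otimes>\<^bsub>endo_ring R M\<^esub> g) x = f (g x)" "(f \<oplus>\<^bsub>endo_ring R M\<^esub> g) x = f x \<oplus>\<^bsub>M\<^esub> g x"
    "\<one>\<^bsub>endo_ring R M\<^esub> x = x" "\<zero>\<^bsub>endo_ring R M\<^esub> x = \<zero>\<^bsub>M\<^esub>"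
  unfolding endo_ring_simps by (simp_all only: compose_eq[OF assms] restrict_apply'[OF assms])

lemma endo_one_closed: "\<one>\<^bsub>endo_ring R M\<^esub> \<in> carrier (endo_ring R M)"
  using rmod_hom_restrict[OF rmod_hom_id] by (simp add: endo_ring_simps)

lemma endo_zero_closed: "\<zero>\<^bsub>endo_ring R M\<^esub> \<in> carrier (endo_ring R M)"
  using rmod_hom_restrict[OF rmod_hom_zero[OF right_module_axioms right_module_axioms]]
  by (simp add: endo_ring_simps)

lemma endo_ring: "ring (endo_ring R M)"
proof -
  let ?S = "endo_ring R M"
  note cl = endo_closed endo_one_closed endo_zero_closed
  have ab: "abelian_group ?S"
  proof (rule abelian_groupI)
    fix f assume f: "f \<in> carrier ?S"
    \<comment> \<open>Written as zero minus \<open>f\<close>, the negative is a homomorphism by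
      \<open>rmod_hom_minus\<close>; the restriction makes it extensional.\<close>
    let ?g = "restrict (\<lambda>x. \<zero>\<^bsub>M\<^esub> \<ominus>\<^bsub>M\<^esub> f x) (carrier M)"
    have "?g \<in> carrier ?S"
      using f by (intro rmod_hom_restrict rmod_hom_minus rmod_hom_zero right_module_axioms endoD(1))
    moreover from this have "?g \<oplus>\<^bsub>?S\<^esub> f = \<zero>\<^bsub>?S\<^esub>"
      using f endoD(2)[OF f] by (intro endo_eqI cl) (simp_all add: M.minus_eq M.l_neg)
    ultimately show "\<exists>g\<in>carrier ?S. g \<oplus>\<^bsub>?S\<^esub> f = \<zero>\<^bsub>?S\<^esub>" by blast
    show "\<zero>\<^bsub>?S\<^esub> \<oplus>\<^bsub>?S\<^esub> f = f"
      using f endoD(2)[OF f] by (intro endo_eqI cl) simp_all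
    fix g assume g: "g \<in> carrier ?S"
    show "f \<oplus>\<^bsub>?S\<^esub> g = g \<oplus>\<^bsub>?S\<^esub> f"
      using f g endoD(2)[OF f] endoD(2)[OF g] by (intro endo_eqI cl) (simp_all add: M.a_comm)
    fix h assume h: "h \<in> carrier ?S"
    show "f \<oplus>\<^bsub>?S\<^esub> g \<oplus>\<^bsub>?S\<^esub> h = f \<oplus>\<^bsub>?S\<^esub> (g \<oplus>\<^bsub>?S\<^esub> h)"
      using f g h endoD(2)[OF f] endoD(2)[OF g] endoD(2)[OF h]
      by (intro endo_eqI cl) (simp_all add: M.a_assoc)
  qed (intro cl; assumption)+
  have mon: "monoid ?S"
  proof (rule monoidI)
    fix f assume f: "f \<in> carrier ?S"
    show "\<one>\<^bsub>?S\<^esub> \<otimes>\<^bsub>?S\<^esub> f = f" "f \<otimes>\<^bsub>?S\<^esub> \<one>\<^bsub>?S\<^esub> = f"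
      using f endoD(2)[OF f] by (intro endo_eqI cl; simp)+
    fix g h assume gh: "g \<in> carrier ?S" "h \<in> carrier ?S"
    show "f \<otimes>\<^bsub>?S\<^esub> g \<otimes>\<^bsub>?S\<^esub> h = f \<otimes>\<^bsub>?S\<^esub> (g \<otimes>\<^bsub>?S\<^esub> h)"
      using f gh endoD(2)[OF gh(2)] by (intro endo_eqI cl) simp_all
  qed (intro cl; assumption)+
  show ?thesis
  proof (rule ringI[OF ab mon])
    fix f g h assume fgh: "f \<in> carrier ?S" "g \<in> carrier ?S" "h \<in> carrier ?S"
    note v = endoD(2)[OF fgh(1)] endoD(2)[OF fgh(2)] endoD(2)[OF fgh(3)]
    show "(f \<oplus>\<^bsub>?S\<^esub> g) \<otimes>\<^bsub>?S\<^esub> h = f \<otimes>\<^bsub>?S\<^esub> h \<oplus>\<^bsub>?S\<^esub> g \<otimes>\<^bsub>?S\<^esub> h"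
      using fgh v by (intro endo_eqI cl) simp_all
    show "h \<otimes>\<^bsub>?S\<^esub> (f \<oplus>\<^bsub>?S\<^esub> g) = h \<otimes>\<^bsub>?S\<^esub> f \<oplus>\<^bsub>?S\<^esub> h \<otimes>\<^bsub>?S\<^esub> g"
      using fgh v rmod_homD(2)[OF endoD(1)[OF fgh(3)]] by (intro endo_eqI cl) simp_all
  qed
qed

lemma endo_minus_apply:
  assumes "f \<in> carrier (endo_ring R M)" "x \<in> carrier M"
  shows "(\<one>\<^bsub>endo_ring R M\<^esub> \<ominus>\<^bsub>endo_ring R M\<^esub> f) x = x \<ominus>\<^bsub>M\<^esub> f x"
proof -
  interpret S: ring "endo_ring R M" by (rule endo_ring)
  have "(\<ominus>\<^bsub>endo_ring R M\<^esub> f) x = \<ominus>\<^bsub>M\<^esub> f x"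
  proof -
    have "(\<ominus>\<^bsub>endo_ring R M\<^esub> f \<oplus>\<^bsub>endo_ring R M\<^esub> f) x = \<zero>\<^bsub>M\<^esub>"
      unfolding S.l_neg[OF assms(1)] using assms(2) by simp
    then show ?thesis
      using assms(2) endoD(2)[OF S.a_inv_closed[OF assms(1)]] endoD(2)[OF assms(1)]
      by (intro M.minus_equality[symmetric]) simp_all
  qed
  then show ?thesis using assms(2) by (simp add: S.minus_eq M.minus_eq)
qed

lemma endo_Units_iff:
  assumes f: "f \<in> carrier (endo_ring R M)"
  shows "f \<in> Units (endo_ring R M) \<longleftrightarrow> bij_betw f (carrier M) (carrier M)"
proof
  interpret S: ring "endo_ring R M" by (rule endo_ring)
  assume "f \<in> Units (endo_ring R M)"
  then obtain g where g: "g \<in> carrier (endo_ring R M)"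
    "g \<otimes>\<^bsub>endo_ring R M\<^esub> f = \<one>\<^bsub>endo_ring R M\<^esub>" "f \<otimes>\<^bsub>endo_ring R M\<^esub> g = \<one>\<^bsub>endo_ring R M\<^esub>"
    unfolding Units_def by blast
  have 1: "g (f x) = x" "f (g x) = x" if "x \<in> carrier M" for x
    using fun_cong[OF g(2), of x] fun_cong[OF g(3), of x] unfolding endo_apply[OF that] .
  show "bij_betw f (carrier M) (carrier M)"
    by (rule bij_betwI[of _ _ _ g]) (simp_all add: 1 endoD(2)[OF f] endoD(2)[OF g(1)])
next
  assume b: "bij_betw f (carrier M) (carrier M)"
  let ?g = "restrict (inv_into (carrier M) f) (carrier M)"
  have g: "?g \<in> carrier (endo_ring R M)"
    using rmod_hom_restrict[OF rmod_hom_inverse[OF right_module_axioms endoD(1)[OF f] b]] .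
  have 1: "?g (f x) = x" "f (?g x) = x" if "x \<in> carrier M" for x
    unfolding restrict_apply'[OF that] restrict_apply'[OF endoD(2)[OF f that]]
    by (rule bij_betw_inv_into_left[OF b that], rule bij_betw_inv_into_right[OF b that])
  have 2: "?g \<otimes>\<^bsub>endo_ring R M\<^esub> f = \<one>\<^bsub>endo_ring R M\<^esub>"
    by (rule endo_eqI[OF endo_closed(1)[OF g f] endo_one_closed]) (simp only: endo_apply 1)
  have 3: "f \<otimes>\<^bsub>endo_ring R M\<^esub> ?g = \<one>\<^bsub>endo_ring R M\<^esub>"
    by (rule endo_eqI[OF endo_closed(1)[OF f g] endo_one_closed]) (simp only: endo_apply 1)
  show "f \<in> Units (endo_ring R M)"
    unfolding Units_def by (intro CollectI conjI f bexI[of _ ?g] 2 3 g)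
qed

text \<open>The hypothesis is \<open>Units_xor\<close> with units read as bijections. It serves both
  claims, for \<open>M\<close> and for the summands of its envelope.\<close>

theorem endo_Quot_jacobson_radical_iso:
  assumes "\<And>f. f \<in> rmod_hom R M M \<Longrightarrow>
    bij_betw f (carrier M) (carrier M) \<longleftrightarrow> \<not> bij_betw (\<lambda>x. x \<ominus>\<^bsub>M\<^esub> f x) (carrier M) (carrier M)"
  shows "endo_ring R M Quot jacobson_radical (endo_ring R M) \<simeq> residue_ring 2"
proof -
  interpret S: ring "endo_ring R M" by (rule endo_ring)
  have "f \<in> Units (endo_ring R M) \<longleftrightarrow> \<one>\<^bsub>endo_ring R M\<^esub> \<ominus>\<^bsub>endo_ring R M\<^esub> f \<notin> Units (endo_ring R M)"
    if f: "f \<in> carrier (endo_ring R M)" for f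
  proof -
    have "bij_betw (\<one>\<^bsub>endo_ring R M\<^esub> \<ominus>\<^bsub>endo_ring R M\<^esub> f) (carrier M) (carrier M) =
      bij_betw (\<lambda>x. x \<ominus>\<^bsub>M\<^esub> f x) (carrier M) (carrier M)"
      by (rule bij_betw_cong) (rule endo_minus_apply[OF f])
    then show ?thesis
      unfolding endo_Units_iff[OF f] endo_Units_iff[OF S.minus_closed[OF S.one_closed f]]
      using assms[OF endoD(1)[OF f]] by simp
  qed
  then interpret F2_local_ring "endo_ring R M"
    by (rule F2_local_ring.intro[OF endo_ring F2_local_ring_axioms.intro])
  show ?thesis by (rule Quot_jacobson_radical_iso)
qed

end

section \<open>Injective modules\<close>

context right_module
begin

text \<open>Rearranged, the equation gives \<open>a - a' = b' - b\<close>, an element of both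
  \<open>A\<close> and \<open>B\<close>.\<close>

lemma direct_sum_unique:
  assumes A: "submodule A R M" and B: "submodule B R M" and AB: "A \<inter> B = {\<zero>\<^bsub>M\<^esub>}"
    and x: "a \<in> A" "b \<in> B" "a' \<in> A" "b' \<in> B" "a \<oplus>\<^bsub>M\<^esub> b = a' \<oplus>\<^bsub>M\<^esub> b'"
  shows "a = a'"
proof -
  note c = submoduleD(2)[OF A x(1)] submoduleD(2)[OF B x(2)] submoduleD(2)[OF A x(3)]
    submoduleD(2)[OF B x(4)]
  have "a \<ominus>\<^bsub>M\<^esub> a' = (a \<oplus>\<^bsub>M\<^esub> b) \<oplus>\<^bsub>M\<^esub> (\<ominus>\<^bsub>M\<^esub> b \<oplus>\<^bsub>M\<^esub> \<ominus>\<^bsub>M\<^esub> a')"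
    using c by (simp add: M.minus_eq M.a_assoc M.r_neg2)
  also have "\<dots> = (b' \<oplus>\<^bsub>M\<^esub> a') \<oplus>\<^bsub>M\<^esub> (\<ominus>\<^bsub>M\<^esub> a' \<oplus>\<^bsub>M\<^esub> \<ominus>\<^bsub>M\<^esub> b)"
    using x(5) c by (simp add: M.a_comm)
  also have "\<dots> = b' \<ominus>\<^bsub>M\<^esub> b"
    using c by (simp add: M.minus_eq M.a_assoc M.r_neg2)
  finally have "a \<ominus>\<^bsub>M\<^esub> a' \<in> A \<inter> B"
    using submoduleD(7)[OF A x(1,3)] submoduleD(7)[OF B x(4,2)] by simp
  then show ?thesis using AB eq_minus_iff[of a a'] c by simp
qed

text \<open>The projection lives on the sum and takes values in \<open>M\<close>, the form in which
  injectivity of \<open>M\<close> can extend it to the whole module.\<close>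

lemma ex_projection:
  assumes A: "submodule A R M" and B: "submodule B R M" and AB: "A \<inter> B = {\<zero>\<^bsub>M\<^esub>}"
  shows "\<exists>\<pi>\<in>rmod_hom R (M\<lparr>carrier := A <+>\<^bsub>M\<^esub> B\<rparr>) M. (\<forall>a\<in>A. \<forall>b\<in>B. \<pi> (a \<oplus>\<^bsub>M\<^esub> b) = a)"
proof -
  define \<pi> where "\<pi> x = (THE a. a \<in> A \<and> (\<exists>b\<in>B. x = a \<oplus>\<^bsub>M\<^esub> b))" for x
  have pi: "\<pi> (a \<oplus>\<^bsub>M\<^esub> b) = a" if "a \<in> A" "b \<in> B" for a b
    unfolding \<pi>_def using direct_sum_unique[OF A B AB] that by (intro the_equality) metis+
  have "\<pi> \<in> rmod_hom R (M\<lparr>carrier := A <+>\<^bsub>M\<^esub> B\<rparr>) M"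
  proof (rule rmod_homI)
    fix x assume "x \<in> carrier (M\<lparr>carrier := A <+>\<^bsub>M\<^esub> B\<rparr>)"
    then obtain a b where x: "a \<in> A" "b \<in> B" "x = a \<oplus>\<^bsub>M\<^esub> b" by (auto simp: mem_set_add)
    note cx = submoduleD(2)[OF A x(1)] submoduleD(2)[OF B x(2)]
    show "\<pi> x \<in> carrier M" using x pi cx by simp
    {
      fix r assume r: "r \<in> carrier R"
      have "\<pi> (r \<odot>\<^bsub>M\<^esub> a \<oplus>\<^bsub>M\<^esub> r \<odot>\<^bsub>M\<^esub> b) = r \<odot>\<^bsub>M\<^esub> a"
        by (rule pi[OF submoduleD(5)[OF A r x(1)] submoduleD(5)[OF B r x(2)]])
      then show "\<pi> (r \<odot>\<^bsub>M\<lparr>carrier := A <+>\<^bsub>M\<^esub> B\<rparr>\<^esub> x) = r \<odot>\<^bsub>M\<^esub> \<pi> x"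
        using x pi cx r by (simp add: smult_r_distr)
    }
    fix y assume "y \<in> carrier (M\<lparr>carrier := A <+>\<^bsub>M\<^esub> B\<rparr>)"
    then obtain a' b' where y: "a' \<in> A" "b' \<in> B" "y = a' \<oplus>\<^bsub>M\<^esub> b'" by (auto simp: mem_set_add)
    note cy = submoduleD(2)[OF A y(1)] submoduleD(2)[OF B y(2)]
    have "\<pi> ((a \<oplus>\<^bsub>M\<^esub> a') \<oplus>\<^bsub>M\<^esub> (b \<oplus>\<^bsub>M\<^esub> b')) = a \<oplus>\<^bsub>M\<^esub> a'"
      by (rule pi[OF submoduleD(4)[OF A x(1) y(1)] submoduleD(4)[OF B x(2) y(2)]])
    moreover have "x \<oplus>\<^bsub>M\<^esub> y = (a \<oplus>\<^bsub>M\<^esub> a') \<oplus>\<^bsub>M\<^esub> (b \<oplus>\<^bsub>M\<^esub> b')"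
      using x(3) y(3) cx cy by (simp add: M.a_ac)
    ultimately show "\<pi> (x \<oplus>\<^bsub>M\<lparr>carrier := A <+>\<^bsub>M\<^esub> B\<rparr>\<^esub> y) = \<pi> x \<oplus>\<^bsub>M\<^esub> \<pi> y"
      using pi x y by simp
  qed
  then show ?thesis using pi by blast
qed

text \<open>The union of a chain of submodules meeting \<open>B\<close> only in zero is of the same
  kind, so Zorn's lemma applies.\<close>

lemma ex_maximal_disjoint:
  assumes A: "submodule A R M" and AB: "A \<inter> B = {\<zero>\<^bsub>M\<^esub>}"
  shows "\<exists>C. submodule C R M \<and> A \<subseteq> C \<and> C \<inter> B = {\<zero>\<^bsub>M\<^esub>} \<and>
    (\<forall>D. submodule D R M \<and> C \<subseteq> D \<and> D \<inter> B = {\<zero>\<^bsub>M\<^esub>} \<longrightarrow> D = C)"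
proof -
  define P where "P = (\<lambda>C. submodule C R M \<and> A \<subseteq> C \<and> C \<inter> B = {\<zero>\<^bsub>M\<^esub>})"
  have "\<exists>C\<in>Collect P. \<forall>X\<in>Collect P. C \<subseteq> X \<longrightarrow> X = C"
  proof (rule subset_Zorn_nonempty)
    show "Collect P \<noteq> {}" using A AB by (auto simp: P_def)
  next
    fix \<C> assume ne: "\<C> \<noteq> {}" and ch: "subset.chain (Collect P) \<C>"
    have P: "submodule X R M" "A \<subseteq> X" "X \<inter> B = {\<zero>\<^bsub>M\<^esub>}" if "X \<in> \<C>" for X
      using ch that by (auto simp: subset.chain_def P_def)
    have lin: "X \<subseteq> Y \<or> Y \<subseteq> X" if "X \<in> \<C>" "Y \<in> \<C>" for X Y
      using ch that by (auto simp: subset.chain_def)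
    have "submodule (\<Union>\<C>) R M"
    proof (rule submoduleI)
      show "\<Union>\<C> \<subseteq> carrier M" using P(1) submoduleD(1) by blast
      show "\<zero>\<^bsub>M\<^esub> \<in> \<Union>\<C>" using P(1) submoduleD(3) ne by blast
      show "x \<oplus>\<^bsub>M\<^esub> y \<in> \<Union>\<C>" if xy: "x \<in> \<Union>\<C>" "y \<in> \<Union>\<C>" for x y
      proof -
        from xy obtain X Y where "X \<in> \<C>" "x \<in> X" "Y \<in> \<C>" "y \<in> Y" by blast
        then obtain Z where Z: "Z \<in> \<C>" "x \<in> Z" "y \<in> Z" using lin by blast
        show ?thesis using submoduleD(4)[OF P(1)[OF Z(1)] Z(2,3)] Z(1) by blast
      qed
      show "a \<odot>\<^bsub>M\<^esub> x \<in> \<Union>\<C>" if "a \<in> carrier R" "x \<in> \<Union>\<C>" for a x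
        using that submoduleD(5)[OF P(1)] by blast
    qed
    moreover have "A \<subseteq> \<Union>\<C>" "\<Union>\<C> \<inter> B = {\<zero>\<^bsub>M\<^esub>}" using P ne by blast+
    ultimately show "\<Union>\<C> \<in> Collect P" by (simp add: P_def)
  qed
  then obtain C where C: "P C" "\<And>X. P X \<Longrightarrow> C \<subseteq> X \<Longrightarrow> X = C" by blast
  show ?thesis
  proof (intro exI[of _ C] conjI allI impI)
    fix D assume "submodule D R M \<and> C \<subseteq> D \<and> D \<inter> B = {\<zero>\<^bsub>M\<^esub>}"
    then show "D = C" using C(1) by (intro C(2)) (auto simp: P_def)
  qed (use C(1) in \<open>auto simp: P_def\<close>)
qed

end

text \<open>
  Both \<open>C\<close> and \<open>D\<close> are complements of each other, and the extension of the projection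
  \<open>C \<oplus> D \<rightarrow> D\<close> to \<open>M\<close> is idempotent: its image is an essential extension of \<open>D\<close>.
\<close>

lemma injective_module_disjoint_summands:
  assumes inj: "injective_module R M" and A: "submodule A R M" and B: "submodule B R M"
    and AB: "A \<inter> B = {\<zero>\<^bsub>M\<^esub>}"
  shows "\<exists>C D. submodule C R M \<and> submodule D R M \<and> A \<subseteq> C \<and> B \<subseteq> D \<and> C \<inter> D = {\<zero>\<^bsub>M\<^esub>} \<and>
    C <+>\<^bsub>M\<^esub> D = carrier M"
proof -
  interpret right_module R M using inj by (simp add: injective_module_def)
  \<comment> \<open>\<open>D\<close> is chosen maximal against \<open>A\<close>; as
    \<open>A \<subseteq> C\<close>, it is also maximal against the \<open>C\<close> chosen
    next.\<close>
  obtain D where D: "submodule D R M" "B \<subseteq> D" "D \<inter> A = {\<zero>\<^bsub>M\<^esub>}"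
    and Dmax: "\<And>X. submodule X R M \<Longrightarrow> D \<subseteq> X \<Longrightarrow> X \<inter> A = {\<zero>\<^bsub>M\<^esub>} \<Longrightarrow> X = D"
    using ex_maximal_disjoint[OF B, of A] AB by (metis Int_commute)
  obtain C where C: "submodule C R M" "A \<subseteq> C" "C \<inter> D = {\<zero>\<^bsub>M\<^esub>}"
    and Cmax: "\<And>X. submodule X R M \<Longrightarrow> C \<subseteq> X \<Longrightarrow> X \<inter> D = {\<zero>\<^bsub>M\<^esub>} \<Longrightarrow> X = C"
    using ex_maximal_disjoint[OF A, of D] D(3) by (metis Int_commute)
  have DC: "D \<inter> C = {\<zero>\<^bsub>M\<^esub>}" using C(3) by blast
  obtain \<pi> where pi: "\<pi> \<in> rmod_hom R (M\<lparr>carrier := D <+>\<^bsub>M\<^esub> C\<rparr>) M"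
    "\<And>d c. d \<in> D \<Longrightarrow> c \<in> C \<Longrightarrow> \<pi> (d \<oplus>\<^bsub>M\<^esub> c) = d"
    using ex_projection[OF D(1) C(1) DC] by blast
  obtain p where p: "p \<in> rmod_hom R M M" "\<And>x. x \<in> D <+>\<^bsub>M\<^esub> C \<Longrightarrow> p x = \<pi> x"
    using injective_module_extends[OF inj right_module_axioms submodule_set_add(1)[OF D(1) C(1)] pi(1)]
    by blast
  interpret p: right_module_hom R M M p
    by (intro right_module_homI right_module_axioms p(1))
  have pdc: "p (d \<oplus>\<^bsub>M\<^esub> c) = d" if "d \<in> D" "c \<in> C" for d c
    using p(2)[of "d \<oplus>\<^bsub>M\<^esub> c"] pi(2)[OF that] that unfolding mem_set_add by auto
  have pd: "p d = d" if "d \<in> D" for d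
    using pdc[OF that submoduleD(3)[OF C(1)]] submoduleD(2)[OF D(1) that] by simp
  have pc: "p c = \<zero>\<^bsub>M\<^esub>" if "c \<in> C" for c
    using pdc[OF submoduleD(3)[OF D(1)] that] submoduleD(2)[OF C(1) that] by simp
  let ?I = "p ` carrier M"
  have Isub: "submodule ?I R M" by (rule p.submodule_image[OF submodule_carrier])
  \<comment> \<open>If \<open>p x\<close> is a nonzero element of \<open>C\<close>, then
    \<open>x\<close> lies outside \<open>C\<close>, which \<open>p\<close> kills. Maximality of
    \<open>C\<close> gives a nonzero \<open>d = c + x r\<close> in \<open>D\<close>, and applying
    \<open>p\<close> yields \<open>d = (p x) r\<close>, which lies in \<open>C\<close> as
    well.\<close>
  have "?I \<inter> C = {\<zero>\<^bsub>M\<^esub>}"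
  proof (rule ccontr)
    assume "?I \<inter> C \<noteq> {\<zero>\<^bsub>M\<^esub>}"
    then obtain x where x: "x \<in> carrier M" "p x \<in> C" "p x \<noteq> \<zero>\<^bsub>M\<^esub>"
      using submoduleD(3)[OF Isub] submoduleD(3)[OF C(1)] by blast
    let ?X = "(\<lambda>a. a \<odot>\<^bsub>M\<^esub> x) ` carrier R"
    note X = submodule_cyclic[OF x(1)]
    note CX = submodule_set_add[OF C(1) X]
    have "x \<in> ?X" using x(1) by (intro image_eqI[of _ _ "\<one>\<^bsub>R\<^esub>"]) auto
    then have "x \<in> C <+>\<^bsub>M\<^esub> ?X" using CX(3) by blast
    moreover have "x \<notin> C" using pc x(3) by blast
    ultimately have "C <+>\<^bsub>M\<^esub> ?X \<noteq> C" by blast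
    then have "(C <+>\<^bsub>M\<^esub> ?X) \<inter> D \<noteq> {\<zero>\<^bsub>M\<^esub>}" using Cmax[OF CX(1,2)] by blast
    then obtain d where d: "d \<in> C <+>\<^bsub>M\<^esub> ?X" "d \<in> D" "d \<noteq> \<zero>\<^bsub>M\<^esub>"
      using submoduleD(3)[OF CX(1)] submoduleD(3)[OF D(1)] by blast
    then obtain c r where cr: "c \<in> C" "r \<in> carrier R" "d = c \<oplus>\<^bsub>M\<^esub> r \<odot>\<^bsub>M\<^esub> x"
      unfolding mem_set_add by blast
    have "d = p (c \<oplus>\<^bsub>M\<^esub> r \<odot>\<^bsub>M\<^esub> x)" using pd[OF d(2)] cr(3) by simp
    also have "\<dots> = r \<odot>\<^bsub>M\<^esub> p x"
      using submoduleD(2)[OF C(1) cr(1)] cr(2) x(1) pc[OF cr(1)] by simp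
    also have "\<dots> \<in> C" by (rule submoduleD(5)[OF C(1) cr(2) x(2)])
    finally show False using d C(3) by blast
  qed
  moreover have "\<zero>\<^bsub>M\<^esub> \<in> ?I \<inter> A" using submoduleD(3)[OF Isub] submoduleD(3)[OF A] by blast
  ultimately have "?I \<inter> A = {\<zero>\<^bsub>M\<^esub>}" using C(2) by blast
  moreover have "D \<subseteq> ?I"
    using pd submoduleD(2)[OF D(1)] by (metis imageI subsetI)
  \<comment> \<open>The image contains \<open>D\<close> and meets \<open>A\<close> trivially, so
    maximality of \<open>D\<close> makes it \<open>D\<close>. Likewise the kernel contains
    \<open>C\<close> and meets \<open>D\<close> trivially, so it is \<open>C\<close>.\<close>
  ultimately have I: "?I = D" using Dmax[OF Isub] by blast
  let ?K = "{x \<in> carrier M. p x = \<zero>\<^bsub>M\<^esub>}"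
  have K: "?K = C"
  proof (rule Cmax)
    show "submodule ?K R M" by (rule p.submodule_kernel[OF submodule_carrier])
    show "C \<subseteq> ?K" using pc submoduleD(1)[OF C(1)] by blast
    show "?K \<inter> D = {\<zero>\<^bsub>M\<^esub>}"
      using pd submoduleD(3)[OF D(1)] by (auto simp: pd)
  qed
  have "carrier M \<subseteq> C <+>\<^bsub>M\<^esub> D"
  proof
    fix x assume x: "x \<in> carrier M"
    then have px: "p x \<in> D" using I by blast
    have "x \<ominus>\<^bsub>M\<^esub> p x \<in> C"
      unfolding K[symmetric] using x pd[OF px] by (simp add: M.minus_eq M.r_neg)
    moreover have "x = (x \<ominus>\<^bsub>M\<^esub> p x) \<oplus>\<^bsub>M\<^esub> p x"
      using x by (simp add: M.minus_eq M.a_assoc M.l_neg)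
    ultimately show "x \<in> C <+>\<^bsub>M\<^esub> D" unfolding mem_set_add using px by blast
  qed
  then have "C <+>\<^bsub>M\<^esub> D = carrier M" using submoduleD(1)[OF submodule_set_add(1)[OF C(1) D(1)]] by blast
  then show ?thesis using C D by blast
qed

text \<open>Disjoint \<open>A\<close> and \<open>B\<close> can be enlarged to complementary direct
  summands, one of which must vanish.\<close>

lemma injective_indecomposable_uniform:
  assumes "injective_module R M" "indecomposable_module R M"
    and "submodule A R M" "submodule B R M" "A \<inter> B = {\<zero>\<^bsub>M\<^esub>}"
  shows "A = {\<zero>\<^bsub>M\<^esub>} \<or> B = {\<zero>\<^bsub>M\<^esub>}"
proof -
  interpret right_module R M using assms(1) by (simp add: injective_module_def)
  obtain C D where CD: "submodule C R M" "submodule D R M" "A \<subseteq> C" "B \<subseteq> D" "C \<inter> D = {\<zero>\<^bsub>M\<^esub>}"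
    "C <+>\<^bsub>M\<^esub> D = carrier M"
    using injective_module_disjoint_summands[OF assms(1,3-5)] by blast
  then have "C = {\<zero>\<^bsub>M\<^esub>} \<or> D = {\<zero>\<^bsub>M\<^esub>}" using assms(2) unfolding indecomposable_module_def by blast
  then show ?thesis using CD(3,4) submoduleD(3)[OF assms(3)] submoduleD(3)[OF assms(4)] by blast
qed

text \<open>Composing \<open>f\<close> with the inverse of \<open>k\<close> on its image reduces
  this to extension from a submodule.\<close>

lemma injective_module_extends_along:
  assumes inj: "injective_module R E" and M: "right_module R M" and N: "right_module R N"
    and k: "k \<in> rmod_hom R M N" "inj_on k (carrier M)" and f: "f \<in> rmod_hom R M E"
  shows "\<exists>g\<in>rmod_hom R N E. \<forall>x\<in>carrier M. g (k x) = f x"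
proof -
  interpret k: right_module_hom R M N k by (rule right_module_homI[OF M N k(1)])
  let ?I = "k ` carrier M"
  have I: "submodule ?I R N" by (rule k.submodule_image[OF k.M.submodule_carrier])
  have "inv_into (carrier M) k \<in> rmod_hom R (N\<lparr>carrier := ?I\<rparr>) M"
    by (rule rmod_hom_inverse)
      (use k in \<open>auto simp: k.M.right_module_axioms bij_betw_def intro!: rmod_hom_restrict_cod\<close>)
  then have "(\<lambda>y. f (inv_into (carrier M) k y)) \<in> rmod_hom R (N\<lparr>carrier := ?I\<rparr>) E"
    by (rule rmod_hom_compose[OF _ f])
  then obtain g where "g \<in> rmod_hom R N E" "\<And>y. y \<in> ?I \<Longrightarrow> g y = f (inv_into (carrier M) k y)"
    using injective_module_extends[OF inj N I] by blast
  then show ?thesis using k(2) by (intro bexI[of _ g]) auto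
qed

lemma injective_module_left_inverse:
  assumes inj: "injective_module R M" and N: "right_module R N"
    and f: "f \<in> rmod_hom R M N" "inj_on f (carrier M)"
  shows "\<exists>g\<in>rmod_hom R N M. \<forall>x\<in>carrier M. g (f x) = x"
proof -
  interpret right_module R M using inj by (simp add: injective_module_def)
  show ?thesis by (rule injective_module_extends_along[OF inj right_module_axioms N f rmod_hom_id])
qed

text \<open>An injective module splits off wherever it embeds: with a left inverse \<open>g\<close>
  of \<open>f\<close>, \<open>N\<close> is the direct sum of the image of \<open>f\<close> and the
  kernel of \<open>g\<close>. The image is nonzero, so the kernel vanishes.\<close>

lemma injective_to_indecomposable_bij:
  assumes inj: "injective_module R M" and N: "right_module R N" "indecomposable_module R N"
    and f: "f \<in> rmod_hom R M N" "inj_on f (carrier M)" and M0: "carrier M \<noteq> {\<zero>\<^bsub>M\<^esub>}"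
  shows "bij_betw f (carrier M) (carrier N)"
proof -
  interpret f: right_module_hom R M N f
    using inj N f by (intro right_module_homI) (auto simp: injective_module_def)
  obtain g where g: "g \<in> rmod_hom R N M" "\<And>x. x \<in> carrier M \<Longrightarrow> g (f x) = x"
    using injective_module_left_inverse[OF inj N(1) f] by blast
  interpret g: right_module_hom R N M g
    using g(1) by (intro right_module_homI f.M.right_module_axioms f.N.right_module_axioms)
  let ?I = "f ` carrier M" and ?K = "{y \<in> carrier N. g y = \<zero>\<^bsub>M\<^esub>}"
  have I: "submodule ?I R N" by (rule f.submodule_image[OF f.M.submodule_carrier])
  have K: "submodule ?K R N" by (rule g.submodule_kernel[OF f.N.submodule_carrier])
  have IK: "?I \<inter> ?K = {\<zero>\<^bsub>N\<^esub>}"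
  proof
    show "{\<zero>\<^bsub>N\<^esub>} \<subseteq> ?I \<inter> ?K" using f.N.submoduleD(3)[OF I] by simp
    show "?I \<inter> ?K \<subseteq> {\<zero>\<^bsub>N\<^esub>}" using g(2) f.zero by auto
  qed
  have sum: "?I <+>\<^bsub>N\<^esub> ?K = carrier N"
  proof
    show "?I <+>\<^bsub>N\<^esub> ?K \<subseteq> carrier N" by (rule f.N.submoduleD(1)[OF f.N.submodule_set_add(1)[OF I K]])
    show "carrier N \<subseteq> ?I <+>\<^bsub>N\<^esub> ?K"
    proof
      fix y assume y: "y \<in> carrier N"
      have "y \<ominus>\<^bsub>N\<^esub> f (g y) \<in> ?K" using y by (simp add: g(2) f.M.M.minus_eq f.M.M.r_neg)
      moreover have "y = f (g y) \<oplus>\<^bsub>N\<^esub> (y \<ominus>\<^bsub>N\<^esub> f (g y))"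
        using y by (simp add: f.N.M.minus_eq f.N.M.a_lcomm f.N.M.r_neg)
      moreover have "f (g y) \<in> ?I" using y by simp
      ultimately show "y \<in> ?I <+>\<^bsub>N\<^esub> ?K" unfolding f.N.mem_set_add by blast
    qed
  qed
  have "?I \<noteq> {\<zero>\<^bsub>N\<^esub>}"
  proof
    assume 0: "?I = {\<zero>\<^bsub>N\<^esub>}"
    have "x = \<zero>\<^bsub>M\<^esub>" if "x \<in> carrier M" for x
    proof -
      have "f x = \<zero>\<^bsub>N\<^esub>" using 0 that by blast
      then show ?thesis using g(2)[OF that] g.zero by simp
    qed
    then show False using M0 f.M.M.zero_closed by blast
  qed
  then have K0: "?K = {\<zero>\<^bsub>N\<^esub>}" using N(2) I K IK sum unfolding indecomposable_module_def by blast
  have "y \<in> ?I" if "y \<in> carrier N" for y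
  proof -
    have "y \<in> ?I <+>\<^bsub>N\<^esub> ?K" using that sum by simp
    then obtain x where "x \<in> ?I" "y = x \<oplus>\<^bsub>N\<^esub> \<zero>\<^bsub>N\<^esub>" unfolding K0 f.N.mem_set_add by blast
    then show ?thesis using f.N.submoduleD(2)[OF I] by simp
  qed
  then show ?thesis using f(2) f.closed by (auto simp: bij_betw_def)
qed

text \<open>The kernels of \<open>u\<close> and \<open>1 - u\<close> meet in zero, so uniformity
  makes one of the two maps injective, hence bijective.\<close>

lemma injective_indecomposable_endo_cases:
  assumes inj: "injective_module R M" and ind: "indecomposable_module R M"
    and u: "u \<in> rmod_hom R M M"
  shows "bij_betw u (carrier M) (carrier M) \<or> bij_betw (\<lambda>x. x \<ominus>\<^bsub>M\<^esub> u x) (carrier M) (carrier M)"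
proof -
  interpret right_module R M using inj by (simp add: injective_module_def)
  interpret u: right_module_hom R M M u by (intro right_module_homI right_module_axioms u)
  interpret v: right_module_hom R M M "\<lambda>x. x \<ominus>\<^bsub>M\<^esub> u x"
    by (intro right_module_homI right_module_axioms rmod_hom_minus rmod_hom_id u)
  let ?A = "{x \<in> carrier M. u x = \<zero>\<^bsub>M\<^esub>}" and ?B = "{x \<in> carrier M. x \<ominus>\<^bsub>M\<^esub> u x = \<zero>\<^bsub>M\<^esub>}"
  have A: "submodule ?A R M" by (rule u.submodule_kernel[OF submodule_carrier])
  have B: "submodule ?B R M" by (rule v.submodule_kernel[OF submodule_carrier])
  have M0: "carrier M \<noteq> {\<zero>\<^bsub>M\<^esub>}" using ind unfolding indecomposable_module_def by blast
  have "?A \<inter> ?B = {\<zero>\<^bsub>M\<^esub>}" by (auto simp: eq_minus_iff)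
  then have "?A = {\<zero>\<^bsub>M\<^esub>} \<or> ?B = {\<zero>\<^bsub>M\<^esub>}"
    by (rule injective_indecomposable_uniform[OF inj ind A B])
  then show ?thesis
  proof
    assume "?A = {\<zero>\<^bsub>M\<^esub>}"
    then have "inj_on u (carrier M)" unfolding u.inj_on_iff[OF submodule_carrier] by blast
    then show ?thesis
      using injective_to_indecomposable_bij[OF inj right_module_axioms ind u _ M0] by blast
  next
    assume "?B = {\<zero>\<^bsub>M\<^esub>}"
    then have "inj_on (\<lambda>x. x \<ominus>\<^bsub>M\<^esub> u x) (carrier M)"
      unfolding v.inj_on_iff[OF submodule_carrier] by blast
    then show ?thesis
      using injective_to_indecomposable_bij[OF inj right_module_axioms ind v.hom _ M0] by blast
  qed
qed

text \<open>A retract inherits injectivity: extend into \<open>M\<close>, then apply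
  \<open>e\<close>, which fixes the prescribed values.\<close>

lemma injective_module_idempotent_image:
  assumes inj: "injective_module R M" and e: "e \<in> rmod_hom R M M"
    and idem: "\<And>x. x \<in> carrier M \<Longrightarrow> e (e x) = e x"
  shows "injective_module R (M\<lparr>carrier := e ` carrier M\<rparr>)"
proof -
  interpret e: right_module_hom R M M e
    using inj e by (intro right_module_homI) (auto simp: injective_module_def)
  let ?N = "M\<lparr>carrier := e ` carrier M\<rparr>"
  have S: "submodule (e ` carrier M) R M" by (rule e.submodule_image[OF e.M.submodule_carrier])
  show ?thesis
    unfolding injective_module_def
  proof (intro conjI allI impI)
    show "right_module R ?N" by (rule e.M.right_module_submodule[OF S])
    fix B :: "('a, 'a + 'c) module" and A f
    assume "right_module R B \<and> submodule A R B \<and> f \<in> rmod_hom R (B\<lparr>carrier := A\<rparr>) ?N"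
    then have B: "right_module R B" and A: "submodule A R B" and f: "f \<in> rmod_hom R (B\<lparr>carrier := A\<rparr>) ?N"
      by auto
    obtain g where g: "g \<in> rmod_hom R B M" "\<And>x. x \<in> A \<Longrightarrow> g x = f x"
      using injective_module_extends[OF inj B A rmod_hom_extend_cod[OF f e.M.submoduleD(1)[OF S]]] by blast
    have "(\<lambda>x. e (g x)) \<in> rmod_hom R B ?N"
      using rmod_hom_compose[OF g(1) e] rmod_homD(1)[OF g(1)] by (intro rmod_hom_restrict_cod) auto
    moreover have "e (g x) = f x" if "x \<in> A" for x
    proof -
      have "f x \<in> e ` carrier M" using rmod_homD(1)[OF f, of x] that by simp
      then show ?thesis using g(2)[OF that] idem by auto
    qed
    ultimately show "\<exists>g\<in>rmod_hom R B ?N. \<forall>x\<in>A. g x = f x" by (intro bexI[of _ "\<lambda>x. e (g x)"]) auto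
  qed
qed

section \<open>Decomposition into indecomposable injective modules\<close>

context right_module
begin

lemma indecomposable_submodule_iff:
  assumes X: "submodule X R M"
  shows "indecomposable_module R (M\<lparr>carrier := X\<rparr>) \<longleftrightarrow> X \<noteq> {\<zero>\<^bsub>M\<^esub>} \<and>
    (\<forall>A B. submodule A R M \<and> A \<subseteq> X \<and> submodule B R M \<and> B \<subseteq> X \<and> A \<inter> B = {\<zero>\<^bsub>M\<^esub>} \<and>
      A <+>\<^bsub>M\<^esub> B = X \<longrightarrow> A = {\<zero>\<^bsub>M\<^esub>} \<or> B = {\<zero>\<^bsub>M\<^esub>})"
  unfolding indecomposable_module_def submodule_submodule_iff[OF X] by simp

text \<open>A splitting of the image of \<open>e\<close> into \<open>A\<close> and \<open>B\<close>
  yields the idempotent \<open>p\<close>, the projection onto \<open>A\<close> after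
  \<open>e\<close>, and with it the orthogonal sum of \<open>p\<close> and \<open>e - p\<close>.
  Primitivity makes one of them zero, and with it \<open>A\<close> or \<open>B\<close>.\<close>

lemma primitive_idem_indecomposable:
  assumes e: "ring.primitive_idem (endo_ring R M) e"
  shows "indecomposable_module R (M\<lparr>carrier := e ` carrier M\<rparr>)"
proof -
  let ?S = "endo_ring R M" and ?X = "e ` carrier M"
  interpret S: ring ?S by (rule endo_ring)
  have eS: "e \<in> carrier ?S" "e \<otimes>\<^bsub>?S\<^esub> e = e" "e \<noteq> \<zero>\<^bsub>?S\<^esub>"
    and prim: "\<And>a b. S.orth_idem a b \<Longrightarrow> e = a \<oplus>\<^bsub>?S\<^esub> b \<Longrightarrow> a = \<zero>\<^bsub>?S\<^esub> \<or> b = \<zero>\<^bsub>?S\<^esub>"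
    using e unfolding S.primitive_idem_def by auto
  interpret e: right_module_hom R M M e
    by (intro right_module_homI right_module_axioms endoD(1)[OF eS(1)])
  have idem: "e (e x) = e x" if "x \<in> carrier M" for x
    using fun_cong[OF eS(2), of x] unfolding endo_apply(1)[OF that] .
  have X: "submodule ?X R M" by (rule e.submodule_image[OF submodule_carrier])
  have X0: "?X \<noteq> {\<zero>\<^bsub>M\<^esub>}"
  proof
    assume "?X = {\<zero>\<^bsub>M\<^esub>}"
    then have "e x = \<zero>\<^bsub>M\<^esub>" if "x \<in> carrier M" for x using that by blast
    then have "e = \<zero>\<^bsub>?S\<^esub>" by (intro endo_eqI eS(1) endo_zero_closed) simp_all
    then show False using eS(3) by simp
  qed
  have "A = {\<zero>\<^bsub>M\<^esub>} \<or> B = {\<zero>\<^bsub>M\<^esub>}"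
    if A: "submodule A R M" "A \<subseteq> ?X" and B: "submodule B R M" "B \<subseteq> ?X"
      and AB: "A \<inter> B = {\<zero>\<^bsub>M\<^esub>}" and sum: "A <+>\<^bsub>M\<^esub> B = ?X" for A B
  proof -
    obtain \<pi> where pi: "\<pi> \<in> rmod_hom R (M\<lparr>carrier := ?X\<rparr>) M" "\<And>a b. a \<in> A \<Longrightarrow> b \<in> B \<Longrightarrow> \<pi> (a \<oplus>\<^bsub>M\<^esub> b) = a"
      using ex_projection[OF A(1) B(1) AB] unfolding sum by blast
    have piA: "\<pi> a = a" if "a \<in> A" for a
      using pi(2)[OF that submoduleD(3)[OF B(1)]] submoduleD(2)[OF A(1) that] by simp
    have piB: "\<pi> b = \<zero>\<^bsub>M\<^esub>" if "b \<in> B" for b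
      using pi(2)[OF submoduleD(3)[OF A(1)] that] submoduleD(2)[OF B(1) that] by simp
    have piX: "\<pi> y \<in> A" if y: "y \<in> ?X" for y
    proof -
      obtain a b where "a \<in> A" "b \<in> B" "y = a \<oplus>\<^bsub>M\<^esub> b"
        using y unfolding sum[symmetric] mem_set_add by blast
      then show ?thesis using pi(2) by simp
    qed
    have eA: "e a = a" if "a \<in> ?X" for a using that idem by blast
    define p where "p = restrict (\<lambda>x. \<pi> (e x)) (carrier M)"
    have "e \<in> rmod_hom R M (M\<lparr>carrier := ?X\<rparr>)"
      using endoD(1)[OF eS(1)] by (rule rmod_hom_restrict_cod) simp
    then have pS: "p \<in> carrier ?S"
      unfolding p_def by (rule rmod_hom_restrict[OF rmod_hom_compose[OF _ pi(1)]])
    have p: "p x = \<pi> (e x)" if "x \<in> carrier M" for x using that by (simp add: p_def)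
    have pA: "p x \<in> A" if "x \<in> carrier M" for x using piX[of "e x"] p that by simp
    have pfix: "p a = a" if "a \<in> A" for a
      using p[OF submoduleD(2)[OF A(1) that]] eA[OF subsetD[OF A(2) that]] piA[OF that] by simp
    have pp: "p \<otimes>\<^bsub>?S\<^esub> p = p"
      by (rule endo_eqI[OF endo_closed(1)[OF pS pS] pS]) (simp only: endo_apply pfix[OF pA])
    have pe: "p \<otimes>\<^bsub>?S\<^esub> e = p"
      by (rule endo_eqI[OF endo_closed(1)[OF pS eS(1)] pS]) (simp only: endo_apply p e.closed idem)
    have ep: "e \<otimes>\<^bsub>?S\<^esub> p = p"
    proof (rule endo_eqI[OF endo_closed(1)[OF eS(1) pS] pS])
      fix x assume x: "x \<in> carrier M"
      show "(e \<otimes>\<^bsub>?S\<^esub> p) x = p x"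
        unfolding endo_apply(1)[OF x] by (rule eA[OF subsetD[OF A(2) pA[OF x]]])
    qed
    note compl = S.orth_idem_complement[OF eS(1) pS eS(2) pp pe ep]
    have "p = \<zero>\<^bsub>?S\<^esub> \<or> e \<ominus>\<^bsub>?S\<^esub> p = \<zero>\<^bsub>?S\<^esub>" by (rule prim[OF compl])
    then show ?thesis
    proof
      assume p0: "p = \<zero>\<^bsub>?S\<^esub>"
      have "a = \<zero>\<^bsub>M\<^esub>" if "a \<in> A" for a
        using pfix[OF that] endo_apply(4)[OF submoduleD(2)[OF A(1) that]] unfolding p0 by simp
      then show ?thesis using submoduleD(3)[OF A(1)] by blast
    next
      assume 0: "e \<ominus>\<^bsub>?S\<^esub> p = \<zero>\<^bsub>?S\<^esub>"
      have ep: "e = p" using compl(2) unfolding 0 S.r_zero[OF pS] .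
      have "b = \<zero>\<^bsub>M\<^esub>" if "b \<in> B" for b
      proof -
        have eb: "e b = b" using that B(2) by (intro eA) blast
        have "p b = \<pi> b" using p[OF submoduleD(2)[OF B(1) that]] unfolding eb .
        moreover have "p b = b" using eb unfolding ep .
        ultimately show ?thesis using piB[OF that] by simp
      qed
      then show ?thesis using submoduleD(3)[OF B(1)] by blast
    qed
  qed
  then show ?thesis unfolding indecomposable_submodule_iff[OF X] using X0 by blast
qed

lemma endo_finsum_apply:
  assumes "finite F" "F \<subseteq> carrier (endo_ring R M)" "x \<in> carrier M"
  shows "finsum (endo_ring R M) (\<lambda>e. e) F x = finsum M (\<lambda>e. e x) F"
  using assms
proof (induction F rule: finite_induct)
  case empty
  interpret S: ring "endo_ring R M" by (rule endo_ring)
  show ?case using empty by simp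
next
  case (insert e F)
  interpret S: ring "endo_ring R M" by (rule endo_ring)
  have F: "F \<subseteq> carrier (endo_ring R M)" and e: "e \<in> carrier (endo_ring R M)" using insert.prems by auto
  have "finsum (endo_ring R M) (\<lambda>e. e) (insert e F) = e \<oplus>\<^bsub>endo_ring R M\<^esub> finsum (endo_ring R M) (\<lambda>e. e) F"
    using insert.hyps F e by (intro S.finsum_insert) auto
  moreover have "finsum M (\<lambda>e. e x) (insert e F) = e x \<oplus>\<^bsub>M\<^esub> finsum M (\<lambda>e. e x) F"
    using insert.hyps F endoD(2)[OF e insert.prems(2)] endoD(2)[OF _ insert.prems(2)]
    by (intro M.finsum_insert) auto
  ultimately show ?case using insert.IH[OF F insert.prems(2)] insert.prems(2) by simp
qed

text \<open>Hypothesis and conclusion speak of plain maps with pointwise laws on the carrier, which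
  frees later arguments from the extensional elements of \<open>endo_ring\<close>. The content is
  \<open>ex_primitive_decomposition\<close> for the identity.\<close>

theorem ex_indecomposable_decomposition:
  assumes fin: "\<And>f :: nat \<Rightarrow> 'm \<Rightarrow> 'm. (\<And>i. f i \<in> rmod_hom R M M) \<Longrightarrow>
      (\<And>i x. x \<in> carrier M \<Longrightarrow> f i (f i x) = f i x) \<Longrightarrow>
      (\<And>i j x. i \<noteq> j \<Longrightarrow> x \<in> carrier M \<Longrightarrow> f i (f j x) = \<zero>\<^bsub>M\<^esub>) \<Longrightarrow>
      \<exists>i. \<forall>x\<in>carrier M. f i x = \<zero>\<^bsub>M\<^esub>"
  shows "\<exists>F. finite F \<and>
    (\<forall>e\<in>F. e \<in> rmod_hom R M M \<and> (\<forall>x\<in>carrier M. e (e x) = e x) \<and>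
      indecomposable_module R (M\<lparr>carrier := e ` carrier M\<rparr>)) \<and>
    (\<forall>e\<in>F. \<forall>f\<in>F. e \<noteq> f \<longrightarrow> (\<forall>x\<in>carrier M. e (f x) = \<zero>\<^bsub>M\<^esub>)) \<and>
    (\<forall>x\<in>carrier M. finsum M (\<lambda>e. e x) F = x)"
proof -
  let ?S = "endo_ring R M"
  interpret S: ring ?S by (rule endo_ring)
  have ap: "f (g x) = h x" if "f \<otimes>\<^bsub>?S\<^esub> g = h" "x \<in> carrier M" for f g h x
    using fun_cong[OF that(1), of x] unfolding endo_apply(1)[OF that(2)] .
  have ap0: "f (g x) = \<zero>\<^bsub>M\<^esub>" if "f \<otimes>\<^bsub>?S\<^esub> g = \<zero>\<^bsub>?S\<^esub>" "x \<in> carrier M" for f g x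
    using ap[OF that] endo_apply(4)[OF that(2)] by simp
  have "\<exists>F. S.primitive_decomposition F \<one>\<^bsub>?S\<^esub>"
  proof (rule S.ex_primitive_decomposition)
    fix f :: "nat \<Rightarrow> 'm \<Rightarrow> 'm"
    assume o: "\<And>i j. i \<noteq> j \<Longrightarrow> S.orth_idem (f i) (f j)"
    \<comment> \<open>Idempotency is part of \<open>orth_idem\<close>, which is assumed for distinct
      indices only; any second index gives it.\<close>
    have fS: "f i \<in> carrier ?S" "f i \<otimes>\<^bsub>?S\<^esub> f i = f i" for i
      using o[of i "Suc i"] unfolding S.orth_idem_def by auto
    have "f i \<otimes>\<^bsub>?S\<^esub> f j = \<zero>\<^bsub>?S\<^esub>" if "i \<noteq> j" for i j
      using o[OF that] unfolding S.orth_idem_def by auto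
    then have "\<exists>i. \<forall>x\<in>carrier M. f i x = \<zero>\<^bsub>M\<^esub>"
      using fS by (intro fin ap ap0 endoD(1))
    then obtain i where "\<forall>x\<in>carrier M. f i x = \<zero>\<^bsub>M\<^esub>" by blast
    then have "f i = \<zero>\<^bsub>?S\<^esub>" by (intro endo_eqI fS(1) endo_zero_closed) simp
    then show "\<exists>i. f i = \<zero>\<^bsub>?S\<^esub>" by blast
  qed auto
  then obtain F where F: "finite F" "\<And>e. e \<in> F \<Longrightarrow> S.primitive_idem e"
    "\<And>e f. e \<in> F \<Longrightarrow> f \<in> F \<Longrightarrow> e \<noteq> f \<Longrightarrow> e \<otimes>\<^bsub>?S\<^esub> f = \<zero>\<^bsub>?S\<^esub>"
    "finsum ?S (\<lambda>e. e) F = \<one>\<^bsub>?S\<^esub>"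
    unfolding S.primitive_decomposition_def by blast
  have FS: "e \<in> carrier ?S" "e \<otimes>\<^bsub>?S\<^esub> e = e" if "e \<in> F" for e
    using F(2)[OF that] unfolding S.primitive_idem_def by auto
  have Fsub: "F \<subseteq> carrier ?S" using FS(1) by blast
  show ?thesis
  proof (intro exI[of _ F] conjI ballI impI)
    show "finsum M (\<lambda>e. e x) F = x" if "x \<in> carrier M" for x
      using endo_finsum_apply[OF F(1) Fsub that] endo_apply(3)[OF that] unfolding F(4) by simp
    show "indecomposable_module R (M\<lparr>carrier := e ` carrier M\<rparr>)" if "e \<in> F" for e
      by (rule primitive_idem_indecomposable[OF F(2)[OF that]])
  qed (use F(1) ap[OF FS(2)] ap0[OF F(3)] endoD(1)[OF FS(1)] in \<open>simp_all\<close>)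
qed

end

text \<open>The decomposition is recorded by its projections, since the later arguments compose and
  add them; the summands are their images.\<close>

locale indecomposable_decomposition = right_module R E
  for R :: "('r, 's) ring_scheme" and E :: "('r, 'e, 't) module_scheme" +
  fixes I :: "'i set" and e :: "'i \<Rightarrow> 'e \<Rightarrow> 'e"
  assumes injective: "injective_module R E"
    and fin: "finite I"
    and e_hom: "i \<in> I \<Longrightarrow> e i \<in> rmod_hom R E E"
    and e_idem: "i \<in> I \<Longrightarrow> x \<in> carrier E \<Longrightarrow> e i (e i x) = e i x"
    and e_orth: "i \<in> I \<Longrightarrow> j \<in> I \<Longrightarrow> i \<noteq> j \<Longrightarrow> x \<in> carrier E \<Longrightarrow> e i (e j x) = \<zero>\<^bsub>E\<^esub>"
    and e_sum: "x \<in> carrier E \<Longrightarrow> finsum E (\<lambda>i. e i x) I = x"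
    and e_indecomposable: "i \<in> I \<Longrightarrow> indecomposable_module R (E\<lparr>carrier := e i ` carrier E\<rparr>)"
begin

abbreviation summand :: "'i \<Rightarrow> 'e set" where "summand i \<equiv> e i ` carrier E"
abbreviation summand_module :: "'i \<Rightarrow> ('r, 'e, 't) module_scheme"
  where "summand_module i \<equiv> E\<lparr>carrier := summand i\<rparr>"

lemma endo_homI: "f \<in> rmod_hom R E E \<Longrightarrow> right_module_hom R E E f"
  by (intro right_module_homI right_module_axioms)

lemma right_module_hom_e: "i \<in> I \<Longrightarrow> right_module_hom R E E (e i)"
  by (intro endo_homI e_hom)

lemma e_closed: "i \<in> I \<Longrightarrow> x \<in> carrier E \<Longrightarrow> e i x \<in> carrier E"
  by (rule rmod_homD(1)[OF e_hom])

lemma e_zero: "i \<in> I \<Longrightarrow> e i \<zero>\<^bsub>E\<^esub> = \<zero>\<^bsub>E\<^esub>"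
  by (rule right_module_hom.zero[OF right_module_hom_e])

lemma submodule_summand: "i \<in> I \<Longrightarrow> submodule (summand i) R E"
  by (rule right_module_hom.submodule_image[OF right_module_hom_e submodule_carrier])

lemma mem_summand: "i \<in> I \<Longrightarrow> x \<in> summand i \<longleftrightarrow> x \<in> carrier E \<and> e i x = x"
  using e_idem e_closed by (metis image_iff)

lemma e_summand: "i \<in> I \<Longrightarrow> x \<in> summand i \<Longrightarrow> e i x = x"
  by (simp add: mem_summand)

lemma e_summand_other: "i \<in> I \<Longrightarrow> j \<in> I \<Longrightarrow> i \<noteq> j \<Longrightarrow> x \<in> summand j \<Longrightarrow> e i x = \<zero>\<^bsub>E\<^esub>"
  using e_orth by auto

lemma right_module_summand: "i \<in> I \<Longrightarrow> right_module R (summand_module i)"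
  by (rule right_module_submodule[OF submodule_summand])

lemma injective_summand: "i \<in> I \<Longrightarrow> injective_module R (summand_module i)"
  by (rule injective_module_idempotent_image[OF injective e_hom e_idem])

lemma summand_nonzero: "i \<in> I \<Longrightarrow> summand i \<noteq> {\<zero>\<^bsub>E\<^esub>}"
  using e_indecomposable[of i] unfolding indecomposable_module_def by simp

lemma uniform:
  assumes "i \<in> I" "submodule A R E" "A \<subseteq> summand i" "submodule B R E" "B \<subseteq> summand i"
    "A \<inter> B = {\<zero>\<^bsub>E\<^esub>}"
  shows "A = {\<zero>\<^bsub>E\<^esub>} \<or> B = {\<zero>\<^bsub>E\<^esub>}"
  using injective_indecomposable_uniform[OF injective_summand e_indecomposable, of i A B] assms
  unfolding submodule_submodule_iff[OF submodule_summand[OF assms(1)]] by simp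

text \<open>\<open>B\<close> may reach outside the summand; uniformity is applied to its trace
  there.\<close>

lemma nonzero_Int:
  assumes "i \<in> I" "submodule A R E" "A \<subseteq> summand i" "submodule B R E" "B \<inter> summand i \<noteq> {\<zero>\<^bsub>E\<^esub>}"
    "A \<noteq> {\<zero>\<^bsub>E\<^esub>}"
  shows "A \<inter> B \<noteq> {\<zero>\<^bsub>E\<^esub>}"
proof
  assume "A \<inter> B = {\<zero>\<^bsub>E\<^esub>}"
  then have "A \<inter> (B \<inter> summand i) = {\<zero>\<^bsub>E\<^esub>}" using assms(3) by blast
  then show False
    using uniform[OF assms(1-3) submodule_Int[OF assms(4) submodule_summand[OF assms(1)]]] assms(5,6)
    by blast
qed

text \<open>Uniformity keeps the intersection nonzero each time one more \<open>K j\<close> is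
  added.\<close>

lemma common_submodule:
  assumes i: "i \<in> I" and "finite J"
    and "\<And>j. j \<in> J \<Longrightarrow> submodule (K j) R E" "\<And>j. j \<in> J \<Longrightarrow> K j \<inter> summand i \<noteq> {\<zero>\<^bsub>E\<^esub>}"
  shows "\<exists>A. submodule A R E \<and> A \<subseteq> summand i \<and> A \<noteq> {\<zero>\<^bsub>E\<^esub>} \<and> (\<forall>j\<in>J. A \<subseteq> K j)"
  using assms(2-4)
proof (induction J rule: finite_induct)
  case empty
  show ?case using submodule_summand[OF i] summand_nonzero[OF i] by blast
next
  case (insert j J)
  obtain A where A: "submodule A R E" "A \<subseteq> summand i" "A \<noteq> {\<zero>\<^bsub>E\<^esub>}" "\<forall>j\<in>J. A \<subseteq> K j"
    using insert.IH insert.prems by blast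
  have "A \<inter> K j \<noteq> {\<zero>\<^bsub>E\<^esub>}" using nonzero_Int[OF i A(1,2) insert.prems(1,2)] A(3) by blast
  then show ?case using submodule_Int[OF A(1) insert.prems(1)] A(2,4)
    by (intro exI[of _ "A \<inter> K j"]) auto
qed

lemma nonzero_multiple:
  assumes "i \<in> I" "x \<in> summand i" "x \<noteq> \<zero>\<^bsub>E\<^esub>" "submodule K R E" "K \<inter> summand i \<noteq> {\<zero>\<^bsub>E\<^esub>}"
  shows "\<exists>a\<in>carrier R. a \<odot>\<^bsub>E\<^esub> x \<noteq> \<zero>\<^bsub>E\<^esub> \<and> a \<odot>\<^bsub>E\<^esub> x \<in> K"
proof -
  let ?X = "(\<lambda>a. a \<odot>\<^bsub>E\<^esub> x) ` carrier R"
  have x: "x \<in> carrier E" using assms(1,2) by (simp add: mem_summand)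
  have X: "submodule ?X R E" by (rule submodule_cyclic[OF x])
  have "?X \<subseteq> summand i" using submoduleD(5)[OF submodule_summand[OF assms(1)] _ assms(2)] by blast
  moreover have "x \<in> ?X" using x by (intro image_eqI[of _ _ "\<one>\<^bsub>R\<^esub>"]) simp_all
  ultimately have "?X \<inter> K \<noteq> {\<zero>\<^bsub>E\<^esub>}" using nonzero_Int[OF assms(1) X _ assms(4,5)] assms(3) by blast
  then show ?thesis using submoduleD(3)[OF X] submoduleD(3)[OF assms(4)] by blast
qed

lemma e_finsum:
  assumes "finite F" "F \<subseteq> I" "j \<in> I" "x \<in> carrier E"
  shows "e j (finsum E (\<lambda>i. e i x) F) = (if j \<in> F then e j x else \<zero>\<^bsub>E\<^esub>)"
proof -
  interpret ej: right_module_hom R E E "e j" by (rule right_module_hom_e[OF assms(3)])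
  have "e j (finsum E (\<lambda>i. e i x) F) = finsum E (\<lambda>k. e j (e k x)) F"
    using assms(2) e_closed[OF _ assms(4)] by (intro ej.finsum assms(1)) auto
  also have "\<dots> = (if j \<in> F then e j (e j x) else \<zero>\<^bsub>E\<^esub>)"
    using assms e_orth[OF assms(3)] e_closed[OF assms(3) e_closed[OF assms(3,4)]]
    by (intro finsum_single) auto
  finally show ?thesis using e_idem[OF assms(3,4)] by simp
qed

text \<open>The induction is on a set \<open>F\<close> of summands that supports \<open>x\<close>,
  which is what the condition on the sum over \<open>F\<close> expresses. Successive multiples bring
  the components of \<open>x\<close> into \<open>N\<close>.\<close>

lemma essential_multiple:
  assumes N: "submodule N R E" "\<And>i. i \<in> I \<Longrightarrow> N \<inter> summand i \<noteq> {\<zero>\<^bsub>E\<^esub>}"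
    and F: "finite F" "F \<subseteq> I"
  shows "x \<in> carrier E \<Longrightarrow> x \<noteq> \<zero>\<^bsub>E\<^esub> \<Longrightarrow> finsum E (\<lambda>i. e i x) F = x \<Longrightarrow>
    \<exists>a\<in>carrier R. a \<odot>\<^bsub>E\<^esub> x \<noteq> \<zero>\<^bsub>E\<^esub> \<and> a \<odot>\<^bsub>E\<^esub> x \<in> N"
  using F
proof (induction F arbitrary: x rule: finite_induct)
  case empty
  then show ?case by simp
next
  case (insert i F)
  have i: "i \<in> I" and F: "F \<subseteq> I" using insert.prems by auto
  interpret ei: right_module_hom R E E "e i" by (rule right_module_hom_e[OF i])
  let ?x = "e i x" and ?y = "finsum E (\<lambda>i. e i x) F"
  have xE: "x \<in> carrier E" by (rule insert.prems(1))
  have cl: "?x \<in> carrier E" "?y \<in> carrier E"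
    using e_closed[OF _ xE] i F by (auto intro!: M.finsum_closed)
  have x: "x = ?x \<oplus>\<^bsub>E\<^esub> ?y"
    using insert.prems(3) insert.hyps e_closed[OF _ xE] i F by (subst (asm) M.finsum_insert) auto
  have ey: "e j ?y = (if j \<in> F then e j x else \<zero>\<^bsub>E\<^esub>)" if "j \<in> I" for j
    by (rule e_finsum[OF insert.hyps(1) F that xE])
  have ysum: "finsum E (\<lambda>i. e i ?y) F = ?y"
    using ey F e_closed[OF _ xE] by (intro M.finsum_cong') auto
  have eiy: "e i ?y = \<zero>\<^bsub>E\<^esub>" using ey[OF i] insert.hyps(2) by simp
  note xi = imageI[OF xE, of "e i"]
  show ?case
  proof (cases "?y = \<zero>\<^bsub>E\<^esub>")
    case True
    then have "x = ?x" using x cl(1) by simp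
    then have "x \<in> summand i" using xi by simp
    then show ?thesis by (rule nonzero_multiple[OF i _ insert.prems(2) N(1) N(2)[OF i]])
  next
    case False
    then obtain a where a: "a \<in> carrier R" "a \<odot>\<^bsub>E\<^esub> ?y \<noteq> \<zero>\<^bsub>E\<^esub>" "a \<odot>\<^bsub>E\<^esub> ?y \<in> N"
      using insert.IH[OF cl(2) _ ysum F] by blast
    have ax: "a \<odot>\<^bsub>E\<^esub> x = a \<odot>\<^bsub>E\<^esub> ?x \<oplus>\<^bsub>E\<^esub> a \<odot>\<^bsub>E\<^esub> ?y"
      using smult_r_distr[OF a(1) cl] x by simp
    \<comment> \<open>If \<open>a\<close> kills the new component, the multiple found for the other
      ones suffices; otherwise a further factor \<open>b\<close> moves the new component into
      \<open>N\<close>.\<close>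
    show ?thesis
    proof (cases "a \<odot>\<^bsub>E\<^esub> ?x = \<zero>\<^bsub>E\<^esub>")
      case True
      then have "a \<odot>\<^bsub>E\<^esub> x = a \<odot>\<^bsub>E\<^esub> ?y" using ax a(1) cl by simp
      then show ?thesis using a by (intro bexI[of _ a]) auto
    next
      case False
      have "a \<odot>\<^bsub>E\<^esub> ?x \<in> summand i" by (rule submoduleD(5)[OF submodule_summand[OF i] a(1) xi])
      then obtain b where b: "b \<in> carrier R" "b \<odot>\<^bsub>E\<^esub> (a \<odot>\<^bsub>E\<^esub> ?x) \<noteq> \<zero>\<^bsub>E\<^esub>" "b \<odot>\<^bsub>E\<^esub> (a \<odot>\<^bsub>E\<^esub> ?x) \<in> N"
        using nonzero_multiple[OF i _ False N(1) N(2)[OF i]] by blast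
      have bax: "(a \<otimes>\<^bsub>R\<^esub> b) \<odot>\<^bsub>E\<^esub> x = b \<odot>\<^bsub>E\<^esub> (a \<odot>\<^bsub>E\<^esub> ?x) \<oplus>\<^bsub>E\<^esub> b \<odot>\<^bsub>E\<^esub> (a \<odot>\<^bsub>E\<^esub> ?y)"
        using smult_assoc[OF a(1) b(1) xE] ax smult_r_distr[OF b(1), of "a \<odot>\<^bsub>E\<^esub> ?x" "a \<odot>\<^bsub>E\<^esub> ?y"] a(1) cl
        by simp
      have "(a \<otimes>\<^bsub>R\<^esub> b) \<odot>\<^bsub>E\<^esub> x \<in> N"
        unfolding bax by (rule submoduleD(4)[OF N(1) b(3) submoduleD(5)[OF N(1) b(1) a(3)]])
      \<comment> \<open>The factor \<open>b\<close> may annihilate the part on \<open>F\<close>; the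
        product is nonzero because its \<open>i\<close>-th component is.\<close>
      moreover have "(a \<otimes>\<^bsub>R\<^esub> b) \<odot>\<^bsub>E\<^esub> x \<noteq> \<zero>\<^bsub>E\<^esub>"
      proof
        assume 0: "(a \<otimes>\<^bsub>R\<^esub> b) \<odot>\<^bsub>E\<^esub> x = \<zero>\<^bsub>E\<^esub>"
        have "b \<odot>\<^bsub>E\<^esub> (a \<odot>\<^bsub>E\<^esub> ?x) = (a \<otimes>\<^bsub>R\<^esub> b) \<odot>\<^bsub>E\<^esub> ?x"
          using smult_assoc[OF a(1) b(1) cl(1)] by simp
        also have "\<dots> = e i ((a \<otimes>\<^bsub>R\<^esub> b) \<odot>\<^bsub>E\<^esub> x)" using a(1) b(1) xE by simp
        also have "\<dots> = \<zero>\<^bsub>E\<^esub>" unfolding 0 by simp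
        finally show False using b(2) by simp
      qed
      ultimately show ?thesis using a(1) b(1) by (intro bexI[of _ "a \<otimes>\<^bsub>R\<^esub> b"]) auto
    qed
  qed
qed

text \<open>In a uniform summand the nonzero trace of \<open>N\<close> is essential;
  \<open>essential_multiple\<close> passes this on to the direct sum.\<close>

lemma essential:
  assumes N: "submodule N R E" "\<And>i. i \<in> I \<Longrightarrow> N \<inter> summand i \<noteq> {\<zero>\<^bsub>E\<^esub>}"
    and B: "submodule B R E" "N \<inter> B = {\<zero>\<^bsub>E\<^esub>}"
  shows "B = {\<zero>\<^bsub>E\<^esub>}"
proof (rule ccontr)
  assume "B \<noteq> {\<zero>\<^bsub>E\<^esub>}"
  then obtain x where x: "x \<in> B" "x \<noteq> \<zero>\<^bsub>E\<^esub>" using submoduleD(3)[OF B(1)] by blast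
  have xE: "x \<in> carrier E" by (rule submoduleD(2)[OF B(1) x(1)])
  obtain a where "a \<in> carrier R" "a \<odot>\<^bsub>E\<^esub> x \<noteq> \<zero>\<^bsub>E\<^esub>" "a \<odot>\<^bsub>E\<^esub> x \<in> N"
    using essential_multiple[OF N fin subset_refl xE x(2) e_sum[OF xE]] by blast
  then show False using submoduleD(5)[OF B(1) _ x(1)] B(2) by blast
qed

lemma eq_zeroI:
  assumes "x \<in> carrier E" "\<And>i. i \<in> I \<Longrightarrow> e i x = \<zero>\<^bsub>E\<^esub>"
  shows "x = \<zero>\<^bsub>E\<^esub>"
proof -
  have "finsum E (\<lambda>i. e i x) I = finsum E (\<lambda>i. \<zero>\<^bsub>E\<^esub>) I" using assms(2) by (intro M.finsum_cong') auto
  then show ?thesis using e_sum[OF assms(1)] by simp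
qed

lemma summand_endo_cases:
  assumes i: "i \<in> I" and u: "u \<in> rmod_hom R (summand_module i) (summand_module i)"
  shows "bij_betw u (summand i) (summand i) \<or>
    bij_betw (\<lambda>x. x \<ominus>\<^bsub>E\<^esub> u x) (summand i) (summand i)"
proof -
  have "bij_betw (\<lambda>x. x \<ominus>\<^bsub>summand_module i\<^esub> u x) (summand i) (summand i) =
    bij_betw (\<lambda>x. x \<ominus>\<^bsub>E\<^esub> u x) (summand i) (summand i)"
  proof (rule bij_betw_cong)
    fix x assume x: "x \<in> summand i"
    have "u x \<in> summand i" using rmod_homD(1)[OF u, of x] x by simp
    then show "x \<ominus>\<^bsub>summand_module i\<^esub> u x = x \<ominus>\<^bsub>E\<^esub> u x"
      by (rule submodule_minus[OF submodule_summand[OF i]])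
  qed
  then show ?thesis
    using injective_indecomposable_endo_cases[OF injective_summand[OF i] e_indecomposable[OF i] u]
    by simp
qed

end

section \<open>Components of endomorphisms and extension of maps from one summand\<close>

context indecomposable_decomposition
begin

lemma component_hom:
  assumes "i \<in> I" "j \<in> I" "g \<in> rmod_hom R E E"
  shows "(\<lambda>x. e j (g x)) \<in> rmod_hom R (summand_module i) (summand_module j)"
proof -
  have "(\<lambda>x. e j (g x)) \<in> rmod_hom R E E" by (rule rmod_hom_compose[OF assms(3) e_hom[OF assms(2)]])
  then have "(\<lambda>x. e j (g x)) \<in> rmod_hom R E (summand_module j)"
    using rmod_homD(1)[OF assms(3)] by (intro rmod_hom_restrict_cod) auto
  then show ?thesis
    by (rule rmod_hom_restrict_dom[OF _ submoduleD(1)[OF submodule_summand[OF assms(1)]]])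
qed

lemma summand_bij:
  assumes "i \<in> I" "j \<in> I" "f \<in> rmod_hom R (summand_module i) (summand_module j)"
    "\<And>x. x \<in> summand i \<Longrightarrow> f x = \<zero>\<^bsub>E\<^esub> \<Longrightarrow> x = \<zero>\<^bsub>E\<^esub>"
  shows "bij_betw f (summand i) (summand j)"
proof -
  interpret f: right_module_hom R "summand_module i" "summand_module j" f
    by (intro right_module_homI right_module_summand assms)
  have "inj_on f (carrier (summand_module i))"
    unfolding f.inj_on_iff[OF f.M.submodule_carrier] using assms(4) by simp
  then show ?thesis
    using injective_to_indecomposable_bij[OF injective_summand[OF assms(1)] right_module_summand[OF assms(2)]
        e_indecomposable[OF assms(2)] assms(3)] summand_nonzero[OF assms(1)] by simp
qed

text \<open>By \<open>summand_bij\<close> an injective component would be an isomorphism between the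
  two summands.\<close>

lemma component_kernel:
  assumes ij: "i \<in> I" "j \<in> I" and ni: "\<not> rmod_isomorphic R (summand_module i) (summand_module j)"
    and g: "g \<in> rmod_hom R E E"
  shows "{x \<in> carrier E. e j (g x) = \<zero>\<^bsub>E\<^esub>} \<inter> summand i \<noteq> {\<zero>\<^bsub>E\<^esub>}"
proof
  assume 0: "{x \<in> carrier E. e j (g x) = \<zero>\<^bsub>E\<^esub>} \<inter> summand i = {\<zero>\<^bsub>E\<^esub>}"
  note hom = component_hom[OF ij g]
  have "bij_betw (\<lambda>x. e j (g x)) (summand i) (summand j)"
  proof (rule summand_bij[OF ij hom])
    fix x assume "x \<in> summand i" "e j (g x) = \<zero>\<^bsub>E\<^esub>"
    moreover from this have "x \<in> carrier E" using mem_summand[OF ij(1)] by blast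
    ultimately show "x = \<zero>\<^bsub>E\<^esub>" using 0 by blast
  qed
  then have "(\<lambda>x. e j (g x)) \<in> rmod_iso R (summand_module i) (summand_module j)"
    using hom unfolding rmod_iso_def by simp
  then show False using ni unfolding rmod_isomorphic_def by blast
qed

text \<open>This acts as \<open>v\<close> on the \<open>i\<close>-th summand and as the identity on
  the sum of the others, so an automorphism of one summand becomes an automorphism of
  \<open>E\<close>.\<close>

definition extend :: "'i \<Rightarrow> ('e \<Rightarrow> 'e) \<Rightarrow> 'e \<Rightarrow> 'e"
  where "extend i v x = v (e i x) \<oplus>\<^bsub>E\<^esub> (x \<ominus>\<^bsub>E\<^esub> e i x)"

lemma summand_hom_cod:
  assumes "i \<in> I" "j \<in> I" "v \<in> rmod_hom R (summand_module i) (summand_module j)"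
  shows "(\<lambda>x. v (e i x)) \<in> rmod_hom R E E"
proof -
  have "e i \<in> rmod_hom R E (summand_module i)" by (rule rmod_hom_restrict_cod[OF e_hom[OF assms(1)] subset_refl])
  then show ?thesis
    by (rule rmod_hom_compose)
      (rule rmod_hom_extend_cod[OF assms(3) submoduleD(1)[OF submodule_summand[OF assms(2)]]])
qed

lemma extend_hom:
  assumes "i \<in> I" "v \<in> rmod_hom R (summand_module i) (summand_module i)"
  shows "extend i v \<in> rmod_hom R E E"
  unfolding extend_def[abs_def]
  by (intro rmod_hom_add rmod_hom_minus right_module_axioms rmod_hom_id e_hom
      summand_hom_cod[OF assms(1) assms(1) assms(2)] assms(1))

lemma e_extend:
  assumes i: "i \<in> I" and v: "v \<in> rmod_hom R (summand_module i) (summand_module i)" and x: "x \<in> carrier E"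
  shows "e i (extend i v x) = v (e i x)" "extend i v x \<ominus>\<^bsub>E\<^esub> v (e i x) = x \<ominus>\<^bsub>E\<^esub> e i x"
proof -
  interpret ei: right_module_hom R E E "e i" by (rule right_module_hom_e[OF i])
  have "v (e i x) \<in> summand i" using rmod_homD(1)[OF v, of "e i x"] x by simp
  then have v: "v (e i x) \<in> carrier E" "e i (v (e i x)) = v (e i x)" using mem_summand[OF i] by auto
  show "e i (extend i v x) = v (e i x)"
    using v x e_idem[OF i x] by (simp add: extend_def M.minus_eq M.r_neg)
  show "extend i v x \<ominus>\<^bsub>E\<^esub> v (e i x) = x \<ominus>\<^bsub>E\<^esub> e i x"
    unfolding extend_def using v(1) x by (simp add: M.minus_eq M.a_comm[of "v (e i x)"] M.a_assoc M.r_neg)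
qed

lemma extend_inverse:
  assumes i: "i \<in> I" and v: "v \<in> rmod_hom R (summand_module i) (summand_module i)"
    and w: "\<And>y. y \<in> summand i \<Longrightarrow> w (v y) = y" and x: "x \<in> carrier E"
  shows "extend i w (extend i v x) = x"
proof -
  have "extend i w (extend i v x) = w (v (e i x)) \<oplus>\<^bsub>E\<^esub> (x \<ominus>\<^bsub>E\<^esub> e i x)"
    unfolding extend_def[of i w] e_extend[OF i v x] ..
  also have "w (v (e i x)) = e i x" using x by (intro w) simp
  finally show ?thesis
    using x e_closed[OF i x] by (simp add: M.minus_eq M.a_lcomm M.r_neg)
qed

lemma extend_iso:
  assumes i: "i \<in> I" and v: "v \<in> rmod_hom R (summand_module i) (summand_module i)"
    and b: "bij_betw v (summand i) (summand i)"
  shows "extend i v \<in> rmod_iso R E E"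
proof (rule rmod_isoI)
  let ?w = "inv_into (summand i) v"
  have w: "?w \<in> rmod_hom R (summand_module i) (summand_module i)"
    using rmod_hom_inverse[OF right_module_summand[OF i] v] b by simp
  show "extend i v \<in> rmod_hom R E E" by (rule extend_hom[OF i v])
  show "extend i ?w \<in> rmod_hom R E E" by (rule extend_hom[OF i w])
  show "extend i ?w (extend i v x) = x" if "x \<in> carrier E" for x
    by (rule extend_inverse[OF i v bij_betw_inv_into_left[OF b] that])
  show "extend i v (extend i ?w x) = x" if "x \<in> carrier E" for x
    by (rule extend_inverse[OF i w bij_betw_inv_into_right[OF b] that])
qed

lemma summand_minus_hom:
  assumes i: "i \<in> I" and u: "u \<in> rmod_hom R (summand_module i) (summand_module i)"
  shows "(\<lambda>x. x \<ominus>\<^bsub>E\<^esub> u x) \<in> rmod_hom R (summand_module i) (summand_module i)"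
proof (rule rmod_hom_cong[OF right_module_summand[OF i]])
  interpret N: right_module R "summand_module i" by (rule right_module_summand[OF i])
  show "(\<lambda>x. x \<ominus>\<^bsub>summand_module i\<^esub> u x) \<in> rmod_hom R (summand_module i) (summand_module i)"
    by (intro rmod_hom_minus N.right_module_axioms N.rmod_hom_id u)
  show "x \<ominus>\<^bsub>E\<^esub> u x = x \<ominus>\<^bsub>summand_module i\<^esub> u x" if "x \<in> carrier (summand_module i)" for x
  proof -
    have "u x \<in> summand i" using rmod_homD(1)[OF u that] by simp
    then show ?thesis by (rule submodule_minus[OF submodule_summand[OF i], symmetric])
  qed
qed

end

section \<open>Automorphism-invariant submodules\<close>

text \<open>\<open>L\<close> stands for the image of \<open>M\<close> in its envelope. Essentiality
  is put in contrapositive form, ready to be applied to kernels and images.\<close>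

locale automorphism_invariant_submodule = indecomposable_decomposition R E I e
  for R :: "('r, 's) ring_scheme" and E :: "('r, 'e, 't) module_scheme"
    and I :: "'i set" and e :: "'i \<Rightarrow> 'e \<Rightarrow> 'e" +
  fixes L :: "'e set"
  assumes L_submodule: "submodule L R E"
    and L_essential: "submodule B R E \<Longrightarrow> L \<inter> B = {\<zero>\<^bsub>E\<^esub>} \<Longrightarrow> B = {\<zero>\<^bsub>E\<^esub>}"
    and L_invariant: "f \<in> rmod_iso R E E \<Longrightarrow> x \<in> L \<Longrightarrow> f x \<in> L"
    and L_indecomposable: "indecomposable_module R (E\<lparr>carrier := L\<rparr>)"
    and L_not_quasi_injective: "\<exists>f\<in>rmod_hom R E E. \<exists>x\<in>L. f x \<notin> L"
begin

lemma L_closed: "x \<in> L \<Longrightarrow> x \<in> carrier E"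
  by (rule submoduleD(2)[OF L_submodule])

text \<open>The identity \<open>x = p x + (x - p x)\<close> splits \<open>L\<close> into its
  intersections with the image and the kernel of \<open>p\<close>. One of these is zero by
  indecomposability, and essentiality of \<open>L\<close> makes the image or the kernel itself
  zero.\<close>

lemma preserving_idempotent_cases:
  assumes p: "p \<in> rmod_hom R E E" and idem: "\<And>x. x \<in> carrier E \<Longrightarrow> p (p x) = p x"
    and L: "\<And>x. x \<in> L \<Longrightarrow> p x \<in> L"
  shows "(\<forall>x\<in>carrier E. p x = \<zero>\<^bsub>E\<^esub>) \<or> (\<forall>x\<in>carrier E. p x = x)"
proof -
  interpret p: right_module_hom R E E p by (rule endo_homI[OF p])
  let ?A = "p ` carrier E" and ?B = "{x \<in> carrier E. p x = \<zero>\<^bsub>E\<^esub>}"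
  have A: "submodule ?A R E" by (rule p.submodule_image[OF submodule_carrier])
  have B: "submodule ?B R E" by (rule p.submodule_kernel[OF submodule_carrier])
  note LA = submodule_Int[OF L_submodule A] and LB = submodule_Int[OF L_submodule B]
  have "(L \<inter> ?A) \<inter> (L \<inter> ?B) = {\<zero>\<^bsub>E\<^esub>}"
    using submoduleD(3)[OF LA] submoduleD(3)[OF LB] by (auto simp: idem)
  moreover have "(L \<inter> ?A) <+>\<^bsub>E\<^esub> (L \<inter> ?B) = L"
  proof
    show "(L \<inter> ?A) <+>\<^bsub>E\<^esub> (L \<inter> ?B) \<subseteq> L"
      using submoduleD(4)[OF L_submodule] by (auto simp: mem_set_add)
    show "L \<subseteq> (L \<inter> ?A) <+>\<^bsub>E\<^esub> (L \<inter> ?B)"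
    proof
      fix x assume x: "x \<in> L"
      note xE = L_closed[OF x]
      have "p x \<in> L \<inter> ?A" using L[OF x] xE by blast
      moreover have "p (x \<ominus>\<^bsub>E\<^esub> p x) = \<zero>\<^bsub>E\<^esub>"
        using xE p.closed[OF xE] by (simp add: idem M.minus_eq M.r_neg)
      then have "x \<ominus>\<^bsub>E\<^esub> p x \<in> L \<inter> ?B"
        using submoduleD(7)[OF L_submodule x L[OF x]] L_closed by blast
      moreover have "x = p x \<oplus>\<^bsub>E\<^esub> (x \<ominus>\<^bsub>E\<^esub> p x)"
        using xE by (simp add: M.minus_eq M.a_lcomm M.r_neg)
      ultimately show "x \<in> (L \<inter> ?A) <+>\<^bsub>E\<^esub> (L \<inter> ?B)" unfolding mem_set_add by blast
    qed
  qed
  ultimately have "L \<inter> ?A = {\<zero>\<^bsub>E\<^esub>} \<or> L \<inter> ?B = {\<zero>\<^bsub>E\<^esub>}"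
    using L_indecomposable LA LB unfolding indecomposable_submodule_iff[OF L_submodule] by blast
  then show ?thesis
  proof
    assume "L \<inter> ?A = {\<zero>\<^bsub>E\<^esub>}"
    then have "?A = {\<zero>\<^bsub>E\<^esub>}" by (rule L_essential[OF A])
    then show ?thesis by blast
  next
    assume "L \<inter> ?B = {\<zero>\<^bsub>E\<^esub>}"
    then have B0: "?B = {\<zero>\<^bsub>E\<^esub>}" by (rule L_essential[OF B])
    have "p x = x" if x: "x \<in> carrier E" for x
    proof -
      have "x \<ominus>\<^bsub>E\<^esub> p x \<in> ?B" using x p.closed[OF x] by (simp add: idem M.minus_eq M.r_neg)
      then have "x \<ominus>\<^bsub>E\<^esub> p x = \<zero>\<^bsub>E\<^esub>" unfolding B0 by blast
      then show ?thesis using eq_minus_iff[OF x p.closed[OF x]] by simp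
    qed
    then show ?thesis by blast
  qed
qed

text \<open>The map \<open>1 + h\<close> is an automorphism with inverse \<open>1 - h\<close>;
  subtracting \<open>x\<close> from its value at \<open>x\<close> leaves \<open>h x\<close>.\<close>

lemma square_zero_preserves:
  assumes h: "h \<in> rmod_hom R E E" and hh: "\<And>x. x \<in> carrier E \<Longrightarrow> h (h x) = \<zero>\<^bsub>E\<^esub>" and x: "x \<in> L"
  shows "h x \<in> L"
proof -
  interpret h: right_module_hom R E E h by (rule endo_homI[OF h])
  let ?f = "\<lambda>x. x \<oplus>\<^bsub>E\<^esub> h x" and ?g = "\<lambda>x. x \<ominus>\<^bsub>E\<^esub> h x"
  have "?f \<in> rmod_iso R E E"
  proof (rule rmod_isoI[of _ _ _ ?g])
    show "?f \<in> rmod_hom R E E" by (intro rmod_hom_add right_module_axioms rmod_hom_id h)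
    show "?g \<in> rmod_hom R E E" by (intro rmod_hom_minus right_module_axioms rmod_hom_id h)
    fix y assume y: "y \<in> carrier E"
    show "?g (?f y) = y" "?f (?g y) = y"
      using y hh h.closed[OF y] by (simp_all add: M.minus_eq M.a_assoc M.r_neg M.l_neg)
  qed
  then have "x \<oplus>\<^bsub>E\<^esub> h x \<in> L" using x by (rule L_invariant)
  then have "\<ominus>\<^bsub>E\<^esub> x \<oplus>\<^bsub>E\<^esub> (x \<oplus>\<^bsub>E\<^esub> h x) \<in> L"
    by (rule submoduleD(4)[OF L_submodule submoduleD(6)[OF L_submodule x]])
  then show ?thesis using L_closed[OF x] h.closed by (simp add: M.r_neg1)
qed

text \<open>Otherwise \<open>e i\<close> would be zero or the identity. The first kills
  \<open>summand i\<close>; the second, by orthogonality, kills \<open>summand j\<close>.\<close>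

lemma projection_not_preserving:
  assumes ij: "i \<in> I" "j \<in> I" "i \<noteq> j" and L: "\<And>x. x \<in> L \<Longrightarrow> e i x \<in> L"
  shows False
  using preserving_idempotent_cases[OF e_hom[OF ij(1)] e_idem[OF ij(1)] L]
proof
  assume "\<forall>x\<in>carrier E. e i x = \<zero>\<^bsub>E\<^esub>"
  then have "summand i = {\<zero>\<^bsub>E\<^esub>}" using submoduleD(3)[OF submodule_summand[OF ij(1)]] by blast
  then show False using summand_nonzero[OF ij(1)] by blast
next
  assume "\<forall>x\<in>carrier E. e i x = x"
  then have "e j x = \<zero>\<^bsub>E\<^esub>" if "x \<in> carrier E" for x
    using e_orth[OF ij that] e_closed[OF ij(2) that] by simp
  then have "summand j = {\<zero>\<^bsub>E\<^esub>}" using submoduleD(3)[OF submodule_summand[OF ij(2)]] by blast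
  then show False using summand_nonzero[OF ij(2)] by blast
qed

text \<open>Both \<open>f\<close> after \<open>e i\<close> and the inverse of \<open>f\<close> after
  \<open>e j\<close> land in a summand that they annihilate, so they have square zero and preserve
  \<open>L\<close>. Composed they give \<open>e i\<close>.\<close>

lemma not_isomorphic:
  assumes ij: "i \<in> I" "j \<in> I" "i \<noteq> j"
  shows "\<not> rmod_isomorphic R (summand_module i) (summand_module j)"
proof
  assume "rmod_isomorphic R (summand_module i) (summand_module j)"
  then obtain f where f: "f \<in> rmod_hom R (summand_module i) (summand_module j)"
    "bij_betw f (summand i) (summand j)"
    unfolding rmod_isomorphic_def rmod_iso_def by auto
  let ?g = "inv_into (summand i) f"
  have g: "?g \<in> rmod_hom R (summand_module j) (summand_module i)"
    using rmod_hom_inverse[OF right_module_summand[OF ij(1)] f(1)] f(2) by simp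
  have fj: "f (e i x) \<in> summand j" if "x \<in> carrier E" for x
    using rmod_homD(1)[OF f(1), of "e i x"] that by simp
  have gi: "?g (e j x) \<in> summand i" if "x \<in> carrier E" for x
    using rmod_homD(1)[OF g, of "e j x"] that by simp
  have f0: "f \<zero>\<^bsub>E\<^esub> = \<zero>\<^bsub>E\<^esub>"
    using right_module_hom.zero[OF right_module_homI[OF right_module_summand[OF ij(1)]
        right_module_summand[OF ij(2)] f(1)]] by simp
  have g0: "?g \<zero>\<^bsub>E\<^esub> = \<zero>\<^bsub>E\<^esub>"
    using right_module_hom.zero[OF right_module_homI[OF right_module_summand[OF ij(2)]
        right_module_summand[OF ij(1)] g]] by simp
  have fL: "f (e i x) \<in> L" if "x \<in> L" for x
  proof (rule square_zero_preserves[OF summand_hom_cod[OF ij(1,2) f(1)] _ that])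
    show "f (e i (f (e i x))) = \<zero>\<^bsub>E\<^esub>" if "x \<in> carrier E" for x
      using e_summand_other[OF ij fj[OF that]] f0 by simp
  qed
  have gL: "?g (e j x) \<in> L" if "x \<in> L" for x
  proof (rule square_zero_preserves[OF summand_hom_cod[OF ij(2,1) g] _ that])
    show "?g (e j (?g (e j x))) = \<zero>\<^bsub>E\<^esub>" if "x \<in> carrier E" for x
      using e_summand_other[OF ij(2,1) ij(3)[symmetric] gi[OF that]] g0 by simp
  qed
  show False
  proof (rule projection_not_preserving[OF ij])
    fix x assume x: "x \<in> L"
    have "?g (e j (f (e i x))) = ?g (f (e i x))"
      using e_summand[OF ij(2) fj[OF L_closed[OF x]]] by simp
    also have "\<dots> = e i x"
      using L_closed[OF x] by (intro bij_betw_inv_into_left[OF f(2)]) blast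
    finally show "e i x \<in> L" using gL[OF fL[OF x]] by simp
  qed
qed

lemma not_both_bij:
  assumes ij: "i \<in> I" "j \<in> I" "i \<noteq> j"
    and u: "u \<in> rmod_hom R (summand_module i) (summand_module i)"
    and b: "bij_betw u (summand i) (summand i)" "bij_betw (\<lambda>x. x \<ominus>\<^bsub>E\<^esub> u x) (summand i) (summand i)"
  shows False
proof (rule projection_not_preserving[OF ij])
  fix x assume x: "x \<in> L"
  note i = ij(1)
  let ?w = "\<lambda>x. x \<ominus>\<^bsub>E\<^esub> u x"
  let ?W = "inv_into (summand i) ?w"
  have W: "?W \<in> rmod_hom R (summand_module i) (summand_module i)"
    using rmod_hom_inverse[OF right_module_summand[OF i] summand_minus_hom[OF i u]] b(2) by simp
  have Wb: "bij_betw ?W (summand i) (summand i)" by (rule bij_betw_inv_into[OF b(2)])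
  have xE: "x \<in> carrier E" "e i x \<in> carrier E" using L_closed[OF x] e_closed[OF i] by blast+
  have "u (e i x) \<in> summand i" using rmod_homD(1)[OF u, of "e i x"] xE(1) by simp
  then have uE: "u (e i x) \<in> carrier E" using mem_summand[OF i] by blast
  have wi: "?w (e i x) \<in> summand i"
    using rmod_homD(1)[OF summand_minus_hom[OF i u], of "e i x"] xE(1) by simp
  then have wE: "?w (e i x) \<in> carrier E" "e i (?w (e i x)) = ?w (e i x)"
    using mem_summand[OF i] by blast+
  \<comment> \<open>As \<open>extend i u\<close> changes only the \<open>i\<close>-th component of
    \<open>x\<close>, subtracting its value from \<open>x\<close> leaves \<open>1 - u\<close>
    applied to \<open>e i x\<close>.\<close>
  have "extend i u x \<in> L" by (rule L_invariant[OF extend_iso[OF i u b(1)] x])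
  then have "x \<ominus>\<^bsub>E\<^esub> extend i u x \<in> L" by (rule submoduleD(7)[OF L_submodule x])
  also have "x \<ominus>\<^bsub>E\<^esub> extend i u x = ?w (e i x)"
  proof -
    have "x \<ominus>\<^bsub>E\<^esub> extend i u x = x \<oplus>\<^bsub>E\<^esub> ((\<ominus>\<^bsub>E\<^esub> x \<oplus>\<^bsub>E\<^esub> e i x) \<oplus>\<^bsub>E\<^esub> \<ominus>\<^bsub>E\<^esub> u (e i x))"
      unfolding extend_def using xE uE by (simp add: M.minus_eq M.minus_add M.a_comm)
    then show ?thesis using xE uE by (simp add: M.minus_eq M.a_assoc M.r_neg2)
  qed
  \<comment> \<open>Extending the inverse of \<open>1 - u\<close> to an automorphism undoes that
    factor and isolates \<open>e i x\<close> inside \<open>L\<close>.\<close>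
  finally have "extend i ?W (?w (e i x)) \<in> L" by (rule L_invariant[OF extend_iso[OF i W Wb]])
  moreover have "extend i ?W (?w (e i x)) = e i x"
  proof -
    have "?W (?w (e i x)) = e i x"
      using xE(1) by (intro bij_betw_inv_into_left[OF b(2)]) blast
    then have "extend i ?W (?w (e i x)) = e i x \<oplus>\<^bsub>E\<^esub> (?w (e i x) \<ominus>\<^bsub>E\<^esub> ?w (e i x))"
      unfolding extend_def wE(2) by simp
    also have "?w (e i x) \<ominus>\<^bsub>E\<^esub> ?w (e i x) = \<zero>\<^bsub>E\<^esub>" using eq_minus_iff[OF wE(1) wE(1)] by simp
    finally show ?thesis using xE(2) by simp
  qed
  ultimately show "e i x \<in> L" by simp
qed

lemma ex_other_index:
  assumes i: "i \<in> I" shows "\<exists>j\<in>I. j \<noteq> i"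
proof (rule ccontr)
  assume "\<not> (\<exists>j\<in>I. j \<noteq> i)"
  then have I: "I = {i}" using i by blast
  have ei: "e i x = x" if "x \<in> carrier E" for x
    using e_sum[OF that] e_closed[OF i that] unfolding I by simp
  \<comment> \<open>With a single index \<open>e i\<close> is the identity, so
    \<open>summand_endo_cases\<close> speaks of all endomorphisms of \<open>E\<close>.\<close>
  have S: "summand i = carrier E" using ei e_closed[OF i] by force
  obtain f x where f: "f \<in> rmod_hom R E E" "x \<in> L" "f x \<notin> L" using L_not_quasi_injective by blast
  have f': "f \<in> rmod_hom R (summand_module i) (summand_module i)" using f(1) unfolding S by simp
  have fE: "f x \<in> carrier E" "x \<in> carrier E" using rmod_homD(1)[OF f(1)] L_closed[OF f(2)] by blast+
  show False using summand_endo_cases[OF i f']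
  proof
    assume "bij_betw f (summand i) (summand i)"
    then have "f \<in> rmod_iso R E E" using f(1) unfolding S rmod_iso_def by simp
    then show False using L_invariant f by blast
  next
    assume "bij_betw (\<lambda>x. x \<ominus>\<^bsub>E\<^esub> f x) (summand i) (summand i)"
    then have "(\<lambda>x. x \<ominus>\<^bsub>E\<^esub> f x) \<in> rmod_iso R E E"
      using rmod_hom_minus[OF right_module_axioms right_module_axioms rmod_hom_id f(1)]
      unfolding S rmod_iso_def by simp
    then have "x \<ominus>\<^bsub>E\<^esub> f x \<in> L" using f(2) by (rule L_invariant)
    then have "x \<ominus>\<^bsub>E\<^esub> (x \<ominus>\<^bsub>E\<^esub> f x) \<in> L" by (rule submoduleD(7)[OF L_submodule f(2)])
    moreover have "x \<ominus>\<^bsub>E\<^esub> (x \<ominus>\<^bsub>E\<^esub> f x) = f x"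
      using fE by (simp add: M.minus_eq M.minus_add M.r_neg2)
    ultimately show False using f(3) by simp
  qed
qed

lemma index_nonempty: "I \<noteq> {}"
proof
  assume I: "I = {}"
  have "x = \<zero>\<^bsub>E\<^esub>" if "x \<in> carrier E" for x using e_sum[OF that] unfolding I by simp
  then have "L = {\<zero>\<^bsub>E\<^esub>}" using L_closed submoduleD(3)[OF L_submodule] by blast
  then show False using L_indecomposable unfolding indecomposable_submodule_iff[OF L_submodule] by blast
qed

text \<open>The kernels of the finitely many off-diagonal components of \<open>g\<close> all meet
  \<open>summand i\<close>, since the summands are not isomorphic, and uniformity gives them a
  common nonzero part \<open>A\<close>. Thus \<open>g\<close> maps \<open>A\<close> into
  \<open>summand i\<close>.\<close>

lemma diagonal_submodule:
  assumes i: "i \<in> I" and g: "g \<in> rmod_hom R E E"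
  shows "\<exists>A. submodule A R E \<and> A \<subseteq> summand i \<and> A \<noteq> {\<zero>\<^bsub>E\<^esub>} \<and>
    (\<forall>x\<in>A. \<forall>j\<in>I. j \<noteq> i \<longrightarrow> e j (g x) = \<zero>\<^bsub>E\<^esub>)"
proof -
  have "\<exists>A. submodule A R E \<and> A \<subseteq> summand i \<and> A \<noteq> {\<zero>\<^bsub>E\<^esub>} \<and>
    (\<forall>j\<in>I - {i}. A \<subseteq> {x \<in> carrier E. e j (g x) = \<zero>\<^bsub>E\<^esub>})"
  proof (rule common_submodule[OF i])
    fix j assume j: "j \<in> I - {i}"
    then have jI: "j \<in> I" "i \<noteq> j" by auto
    show "submodule {x \<in> carrier E. e j (g x) = \<zero>\<^bsub>E\<^esub>} R E"
      by (rule right_module_hom.submodule_kernel[OF endo_homI[OF rmod_hom_compose[OF g e_hom[OF jI(1)]]]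
          submodule_carrier])
    show "{x \<in> carrier E. e j (g x) = \<zero>\<^bsub>E\<^esub>} \<inter> summand i \<noteq> {\<zero>\<^bsub>E\<^esub>}"
      by (rule component_kernel[OF i jI(1) not_isomorphic[OF i jI] g])
  qed (simp add: fin)
  then show ?thesis by blast
qed

text \<open>On an essential submodule assembled from the \<open>A i\<close> the map \<open>h\<close>
  is diagonal, hence injective there, hence on \<open>E\<close>. Its image then meets every summand,
  which yields surjectivity.\<close>

lemma bij_of_diagonal:
  assumes h: "h \<in> rmod_hom R E E"
    and diag: "\<And>i x. i \<in> I \<Longrightarrow> x \<in> summand i \<Longrightarrow> e i (h x) = \<zero>\<^bsub>E\<^esub> \<Longrightarrow> x = \<zero>\<^bsub>E\<^esub>"
  shows "bij_betw h (carrier E) (carrier E)"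
proof -
  interpret h: right_module_hom R E E h by (rule endo_homI[OF h])
  have "\<forall>i\<in>I. \<exists>A. submodule A R E \<and> A \<subseteq> summand i \<and> A \<noteq> {\<zero>\<^bsub>E\<^esub>} \<and>
    (\<forall>x\<in>A. \<forall>j\<in>I. j \<noteq> i \<longrightarrow> e j (h x) = \<zero>\<^bsub>E\<^esub>)"
    using diagonal_submodule[OF _ h] by blast
  from bchoice[OF this] obtain A where A: "\<And>i. i \<in> I \<Longrightarrow> submodule (A i) R E"
    "\<And>i. i \<in> I \<Longrightarrow> A i \<subseteq> summand i" "\<And>i. i \<in> I \<Longrightarrow> A i \<noteq> {\<zero>\<^bsub>E\<^esub>}"
    "\<And>i j x. i \<in> I \<Longrightarrow> x \<in> A i \<Longrightarrow> j \<in> I \<Longrightarrow> j \<noteq> i \<Longrightarrow> e j (h x) = \<zero>\<^bsub>E\<^esub>"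
    by blast
  \<comment> \<open>This is the direct sum of the \<open>A i\<close>, described so that membership
    can be tested by the projections.\<close>
  let ?N = "{x \<in> carrier E. \<forall>i\<in>I. e i x \<in> A i}"
  have N: "submodule ?N R E"
  proof (rule submoduleI)
    show "\<zero>\<^bsub>E\<^esub> \<in> ?N" using submoduleD(3)[OF A(1)] by (simp add: e_zero)
    show "x \<oplus>\<^bsub>E\<^esub> y \<in> ?N" if "x \<in> ?N" "y \<in> ?N" for x y
      using that submoduleD(4)[OF A(1)] by (simp add: right_module_hom.add[OF right_module_hom_e])
    show "a \<odot>\<^bsub>E\<^esub> x \<in> ?N" if "a \<in> carrier R" "x \<in> ?N" for a x
      using that submoduleD(5)[OF A(1)] by (simp add: right_module_hom.smult[OF right_module_hom_e])
  qed blast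
  have AN: "A i \<subseteq> ?N" if i: "i \<in> I" for i
  proof
    fix x assume x: "x \<in> A i"
    then have xi: "x \<in> summand i" using A(2)[OF i] by blast
    have "e j x \<in> A j" if j: "j \<in> I" for j
    proof (cases "j = i")
      case True
      then show ?thesis using e_summand[OF i xi] x by simp
    next
      case False
      then show ?thesis using e_summand_other[OF j i False xi] submoduleD(3)[OF A(1)[OF j]] by simp
    qed
    then show "x \<in> ?N" using xi mem_summand[OF i] by blast
  qed
  have Ni: "?N \<inter> summand i \<noteq> {\<zero>\<^bsub>E\<^esub>}" if "i \<in> I" for i
    using AN[OF that] A(2,3)[OF that] submoduleD(3)[OF A(1)[OF that]] by blast
  let ?K = "{x \<in> carrier E. h x = \<zero>\<^bsub>E\<^esub>}"
  have K: "submodule ?K R E" by (rule h.submodule_kernel[OF submodule_carrier])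
  have "?N \<inter> ?K \<subseteq> {\<zero>\<^bsub>E\<^esub>}"
  proof
    fix x assume "x \<in> ?N \<inter> ?K"
    then have x: "x \<in> carrier E" "\<And>i. i \<in> I \<Longrightarrow> e i x \<in> A i" "h x = \<zero>\<^bsub>E\<^esub>" by blast+
    have "e i x = \<zero>\<^bsub>E\<^esub>" if i: "i \<in> I" for i
    proof (rule diag[OF i])
      show "e i x \<in> summand i" using x(1) by blast
      interpret eh: right_module_hom R E E "\<lambda>x. e i (h x)"
        by (rule endo_homI[OF rmod_hom_compose[OF h e_hom[OF i]]])
      \<comment> \<open>For \<open>j \<noteq> i\<close> the component \<open>e j x\<close> lies in
        \<open>A j\<close>, where \<open>h\<close> has no \<open>i\<close>-th part, so only the
        diagonal term survives.\<close>
      have "e i (h (finsum E (\<lambda>j. e j x) I)) = finsum E (\<lambda>j. e i (h (e j x))) I"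
        by (rule eh.finsum[OF fin e_closed[OF _ x(1)]])
      also have "\<dots> = (if i \<in> I then e i (h (e i x)) else \<zero>\<^bsub>E\<^esub>)"
      proof (rule finsum_single)
        fix j assume j: "j \<in> I" "j \<noteq> i"
        show "e i (h (e j x)) = \<zero>\<^bsub>E\<^esub>" by (rule A(4)[OF j(1) x(2)[OF j(1)] i j(2)[symmetric]])
      qed (rule fin, rule eh.closed[OF e_closed[OF i x(1)]])
      finally show "e i (h (e i x)) = \<zero>\<^bsub>E\<^esub>" using e_sum[OF x(1)] x(3) e_zero[OF i] i by simp
    qed
    then show "x \<in> {\<zero>\<^bsub>E\<^esub>}" using eq_zeroI[OF x(1)] by blast
  qed
  then have NK: "?N \<inter> ?K = {\<zero>\<^bsub>E\<^esub>}" using submoduleD(3)[OF N] submoduleD(3)[OF K] by blast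
  have "?K = {\<zero>\<^bsub>E\<^esub>}" by (rule essential[OF N Ni K NK])
  then have inj: "inj_on h (carrier E)" unfolding h.inj_on_iff[OF submodule_carrier] by blast
  \<comment> \<open>Injectivity of \<open>E\<close> makes the image of \<open>h\<close> a direct
    summand, complemented by \<open>?B\<close>, the kernel of \<open>h\<close> after
    \<open>l\<close>. The image is essential, so \<open>?B\<close> is zero.\<close>
  obtain l where l: "l \<in> rmod_hom R E E" "\<And>x. x \<in> carrier E \<Longrightarrow> l (h x) = x"
    using injective_module_left_inverse[OF injective right_module_axioms h inj] by blast
  interpret hl: right_module_hom R E E "\<lambda>x. h (l x)"
    by (rule endo_homI[OF rmod_hom_compose[OF l(1) h]])
  let ?P = "h ` carrier E" and ?B = "{x \<in> carrier E. h (l x) = \<zero>\<^bsub>E\<^esub>}"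
  have P: "submodule ?P R E" by (rule h.submodule_image[OF submodule_carrier])
  have B: "submodule ?B R E" by (rule hl.submodule_kernel[OF submodule_carrier])
  have Pi: "?P \<inter> summand i \<noteq> {\<zero>\<^bsub>E\<^esub>}" if i: "i \<in> I" for i
  proof -
    obtain x where x: "x \<in> A i" "x \<noteq> \<zero>\<^bsub>E\<^esub>" using A(3)[OF i] submoduleD(3)[OF A(1)[OF i]] by blast
    have xE: "x \<in> carrier E" by (rule submoduleD(2)[OF A(1)[OF i] x(1)])
    have hx: "h x \<in> carrier E" using xE by simp
    have "h x = finsum E (\<lambda>j. e j (h x)) I" using e_sum[OF hx] by simp
    also have "\<dots> = (if i \<in> I then e i (h x) else \<zero>\<^bsub>E\<^esub>)"
      by (rule finsum_single) (rule fin, erule A(4)[OF i x(1)], assumption, rule e_closed[OF i hx])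
    finally have "h x = e i (h x)" using i by simp
    then have "h x \<in> summand i" using mem_summand[OF i] hx by metis
    moreover have "h x \<noteq> \<zero>\<^bsub>E\<^esub>" using inj_onD[OF inj _ xE M.zero_closed] x(2) by auto
    ultimately show ?thesis using xE by blast
  qed
  have "?P \<inter> ?B \<subseteq> {\<zero>\<^bsub>E\<^esub>}" using l(2) by auto
  then have PB: "?P \<inter> ?B = {\<zero>\<^bsub>E\<^esub>}" using submoduleD(3)[OF P] submoduleD(3)[OF B] by blast
  have B0: "?B = {\<zero>\<^bsub>E\<^esub>}" by (rule essential[OF P Pi B PB])
  have "y \<in> ?P" if y: "y \<in> carrier E" for y
  proof -
    have hl: "h (l y) \<in> carrier E" "l y \<in> carrier E" using hl.closed[OF y] rmod_homD(1)[OF l(1) y] by blast+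
    have "h (l (y \<ominus>\<^bsub>E\<^esub> h (l y))) = \<zero>\<^bsub>E\<^esub>"
      using hl.minus[OF y hl(1)] l(2)[OF hl(2)] eq_minus_iff[OF hl(1) hl(1)] by simp
    then have "y \<ominus>\<^bsub>E\<^esub> h (l y) \<in> ?B" using y hl(1) by simp
    then have "y \<ominus>\<^bsub>E\<^esub> h (l y) = \<zero>\<^bsub>E\<^esub>" unfolding B0 by blast
    then have "y = h (l y)" using eq_minus_iff[OF y hl(1)] by simp
    then show ?thesis using hl(2) by (metis imageI)
  qed
  then show ?thesis using inj h.closed by (auto simp: bij_betw_def)
qed

lemma summand_endo_Quot:
  assumes i: "i \<in> I"
  shows "endo_ring R (summand_module i) Quot jacobson_radical (endo_ring R (summand_module i)) \<simeq>
    residue_ring 2"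
proof -
  interpret N: right_module R "summand_module i" by (rule right_module_summand[OF i])
  obtain j where j: "j \<in> I" "i \<noteq> j" using ex_other_index[OF i] by blast
  show ?thesis
  proof (rule N.endo_Quot_jacobson_radical_iso)
    fix f assume f: "f \<in> rmod_hom R (summand_module i) (summand_module i)"
    have "bij_betw (\<lambda>x. x \<ominus>\<^bsub>summand_module i\<^esub> f x) (summand i) (summand i) =
      bij_betw (\<lambda>x. x \<ominus>\<^bsub>E\<^esub> f x) (summand i) (summand i)"
    proof (rule bij_betw_cong)
      fix x assume x: "x \<in> summand i"
      have "f x \<in> summand i" using rmod_homD(1)[OF f, of x] x by simp
      then show "x \<ominus>\<^bsub>summand_module i\<^esub> f x = x \<ominus>\<^bsub>E\<^esub> f x"
        by (rule submodule_minus[OF submodule_summand[OF i]])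
    qed
    then show "bij_betw f (carrier (summand_module i)) (carrier (summand_module i)) \<longleftrightarrow>
      \<not> bij_betw (\<lambda>x. x \<ominus>\<^bsub>summand_module i\<^esub> f x) (carrier (summand_module i)) (carrier (summand_module i))"
      using summand_endo_cases[OF i f] not_both_bij[OF i j f] by auto
  qed
qed

text \<open>
  Subtracting from \<open>g\<close> the projection \<open>p\<close> onto the summands on which the diagonal component of
  \<open>g\<close> is not injective leaves an automorphism, so \<open>p\<close> preserves \<open>L\<close> and is \<open>0\<close> or \<open>1\<close>.
\<close>

lemma preserving_endo_cases:
  assumes g: "g \<in> rmod_hom R E E" and L: "\<And>x. x \<in> L \<Longrightarrow> g x \<in> L"
  shows "bij_betw g (carrier E) (carrier E) \<or> bij_betw (\<lambda>x. x \<ominus>\<^bsub>E\<^esub> g x) (carrier E) (carrier E)"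
proof -
  interpret g: right_module_hom R E E g by (rule endo_homI[OF g])
  define U where "U = {i \<in> I. \<exists>x\<in>summand i. e i (g x) = \<zero>\<^bsub>E\<^esub> \<and> x \<noteq> \<zero>\<^bsub>E\<^esub>}"
  define p where "p x = finsum E (\<lambda>i. e i x) U" for x
  have U: "finite U" "U \<subseteq> I" using fin by (auto simp: U_def)
  have p: "p \<in> rmod_hom R E E"
    unfolding p_def[abs_def] using U e_hom by (intro rmod_hom_finsum right_module_axioms) auto
  interpret p: right_module_hom R E E p by (rule endo_homI[OF p])
  have ep: "e j (p x) = (if j \<in> U then e j x else \<zero>\<^bsub>E\<^esub>)" if "j \<in> I" "x \<in> carrier E" for j x
    unfolding p_def by (rule e_finsum[OF U that])
  have pp: "p (p x) = p x" if x: "x \<in> carrier E" for x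
  proof -
    have "p (p x) = finsum E (\<lambda>i. e i (p x)) U" by (rule p_def)
    also have "\<dots> = finsum E (\<lambda>i. e i x) U"
      using ep[OF _ x] U(2) e_closed[OF _ x] by (intro M.finsum_cong') auto
    finally show ?thesis unfolding p_def .
  qed
  define h where "h x = g x \<ominus>\<^bsub>E\<^esub> p x" for x
  have h: "h \<in> rmod_hom R E E"
    unfolding h_def[abs_def] by (intro rmod_hom_minus right_module_axioms g p)
  have hb: "bij_betw h (carrier E) (carrier E)"
  proof (rule bij_of_diagonal[OF h])
    fix i x assume i: "i \<in> I" and xi: "x \<in> summand i" and 0: "e i (h x) = \<zero>\<^bsub>E\<^esub>"
    have x: "x \<in> carrier E" "e i x = x" using xi mem_summand[OF i] by blast+
    interpret ei: right_module_hom R E E "e i" by (rule right_module_hom_e[OF i])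
    interpret eg: right_module_hom R E E "\<lambda>x. e i (g x)"
      by (rule endo_homI[OF rmod_hom_compose[OF g e_hom[OF i]]])
    interpret d: right_module_hom R E E "\<lambda>x. x \<ominus>\<^bsub>E\<^esub> e i (g x)"
      by (rule endo_homI[OF rmod_hom_minus[OF right_module_axioms right_module_axioms rmod_hom_id
              rmod_hom_compose[OF g e_hom[OF i]]]])
    have "e i (g x) \<ominus>\<^bsub>E\<^esub> e i (p x) = \<zero>\<^bsub>E\<^esub>" using 0 x(1) unfolding h_def by simp
    then have eq: "e i (g x) = e i (p x)" using eq_minus_iff[of "e i (g x)" "e i (p x)"] x(1) by simp
    \<comment> \<open>Outside \<open>U\<close> the \<open>i\<close>-th diagonal components of
      \<open>h\<close> and \<open>g\<close> agree; inside \<open>U\<close> the one of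
      \<open>h\<close> is that of \<open>g\<close> minus the identity.\<close>
    show "x = \<zero>\<^bsub>E\<^esub>"
    proof (cases "i \<in> U")
      case False
      then have "e i (g x) = \<zero>\<^bsub>E\<^esub>" using eq ep[OF i x(1)] by simp
      then show ?thesis using False i xi unfolding U_def by blast
    next
      case True
      \<comment> \<open>The kernel \<open>?A\<close> is nonzero by the choice of \<open>U\<close>,
        so uniformity makes the set \<open>?B\<close> of fixed points zero, and \<open>x\<close> is
        such a point.\<close>
      let ?A = "{y \<in> summand i. e i (g y) = \<zero>\<^bsub>E\<^esub>}" and ?B = "{y \<in> summand i. y \<ominus>\<^bsub>E\<^esub> e i (g y) = \<zero>\<^bsub>E\<^esub>}"
      note S = submodule_summand[OF i]
      have A: "submodule ?A R E" by (rule eg.submodule_kernel[OF S])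
      have B: "submodule ?B R E" by (rule d.submodule_kernel[OF S])
      have "?A \<inter> ?B \<subseteq> {\<zero>\<^bsub>E\<^esub>}"
      proof
        fix y assume "y \<in> ?A \<inter> ?B"
        then have y: "y \<in> summand i" "e i (g y) = \<zero>\<^bsub>E\<^esub>" "y \<ominus>\<^bsub>E\<^esub> e i (g y) = \<zero>\<^bsub>E\<^esub>" by blast+
        have "y \<in> carrier E" by (rule submoduleD(2)[OF S y(1)])
        then show "y \<in> {\<zero>\<^bsub>E\<^esub>}" using y(2,3) by (simp add: M.minus_eq)
      qed
      then have "?A \<inter> ?B = {\<zero>\<^bsub>E\<^esub>}" using submoduleD(3)[OF A] submoduleD(3)[OF B] by blast
      then have "?A = {\<zero>\<^bsub>E\<^esub>} \<or> ?B = {\<zero>\<^bsub>E\<^esub>}" by (intro uniform[OF i A _ B]) blast+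
      moreover have "?A \<noteq> {\<zero>\<^bsub>E\<^esub>}" using True unfolding U_def by blast
      moreover have "e i (g x) = x" using eq ep[OF i x(1)] True x(2) by simp
      then have "x \<in> ?B" using xi eq_minus_iff[OF x(1) x(1)] by simp
      ultimately show ?thesis by blast
    qed
  qed
  have hiso: "h \<in> rmod_iso R E E" using h hb unfolding rmod_iso_def by simp
  have gph: "g x = p x \<oplus>\<^bsub>E\<^esub> h x" "g x \<ominus>\<^bsub>E\<^esub> h x = p x" if "x \<in> carrier E" for x
    using that by (simp_all add: h_def M.minus_eq M.minus_add M.a_lcomm M.r_neg M.r_neg2)
  have "p x \<in> L" if "x \<in> L" for x
    using submoduleD(7)[OF L_submodule L[OF that] L_invariant[OF hiso that]]
    unfolding gph(2)[OF L_closed[OF that]] .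
  then consider "\<forall>x\<in>carrier E. p x = \<zero>\<^bsub>E\<^esub>" | "\<forall>x\<in>carrier E. p x = x"
    using preserving_idempotent_cases[OF p pp] by blast
  then show ?thesis
  proof cases
    case 1
    have "bij_betw h (carrier E) (carrier E) = bij_betw g (carrier E) (carrier E)"
    proof (rule bij_betw_cong)
      fix x assume x: "x \<in> carrier E"
      show "h x = g x" using 1 x by (simp add: h_def M.minus_eq)
    qed
    then show ?thesis using hb by blast
  next
    \<comment> \<open>Here \<open>h = g - 1\<close>, so \<open>1 - g\<close> is the negative of
      \<open>h\<close>.\<close>
    case 2
    have "bij_betw (\<lambda>x. \<ominus>\<^bsub>E\<^esub> x) (carrier E) (carrier E)"
      by (rule bij_betwI[of _ _ _ "\<lambda>x. \<ominus>\<^bsub>E\<^esub> x"]) simp_all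
    from bij_betw_trans[OF hb this] have "bij_betw ((\<lambda>x. \<ominus>\<^bsub>E\<^esub> x) \<circ> h) (carrier E) (carrier E)" .
    moreover have "bij_betw ((\<lambda>x. \<ominus>\<^bsub>E\<^esub> x) \<circ> h) (carrier E) (carrier E) =
      bij_betw (\<lambda>x. x \<ominus>\<^bsub>E\<^esub> g x) (carrier E) (carrier E)"
    proof (rule bij_betw_cong)
      fix x assume x: "x \<in> carrier E"
      have "p x = x" using 2 x by blast
      then show "((\<lambda>x. \<ominus>\<^bsub>E\<^esub> x) \<circ> h) x = x \<ominus>\<^bsub>E\<^esub> g x"
        using x by (simp add: h_def M.minus_eq M.minus_add M.a_comm)
    qed
    ultimately show ?thesis by blast
  qed
qed

text \<open>The inverse automorphism preserves \<open>L\<close> as well.\<close>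

lemma preserving_automorphism_surj:
  assumes g: "g \<in> rmod_hom R E E" "bij_betw g (carrier E) (carrier E)" and y: "y \<in> L"
  shows "\<exists>x\<in>L. g x = y"
proof -
  let ?g = "inv_into (carrier E) g"
  have "?g \<in> rmod_iso R E E"
    using rmod_hom_inverse[OF right_module_axioms g] bij_betw_inv_into[OF g(2)]
    unfolding rmod_iso_def by simp
  then have "?g y \<in> L" using y by (rule L_invariant)
  then show ?thesis using bij_betw_inv_into_right[OF g(2) L_closed[OF y]] by blast
qed

lemma trivial_kernel_on_E:
  assumes g: "g \<in> rmod_hom R E E" and L: "\<And>x. x \<in> L \<Longrightarrow> g x = \<zero>\<^bsub>E\<^esub> \<Longrightarrow> x = \<zero>\<^bsub>E\<^esub>"
    and x: "x \<in> carrier E" "g x = \<zero>\<^bsub>E\<^esub>"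
  shows "x = \<zero>\<^bsub>E\<^esub>"
proof -
  let ?K = "{x \<in> carrier E. g x = \<zero>\<^bsub>E\<^esub>}"
  have K: "submodule ?K R E"
    by (rule right_module_hom.submodule_kernel[OF endo_homI[OF g] submodule_carrier])
  have "L \<inter> ?K = {\<zero>\<^bsub>E\<^esub>}"
    using L submoduleD(3)[OF K] submoduleD(3)[OF L_submodule] by blast
  then have "?K = {\<zero>\<^bsub>E\<^esub>}" by (rule L_essential[OF K])
  then show ?thesis using x by blast
qed

text \<open>On a nonzero \<open>A\<close> inside one summand where \<open>g\<close> is diagonal,
  \<open>e i\<close> after \<open>g\<close> agrees with \<open>g\<close>, so this component and 1
  minus it are injective on \<open>A\<close>. Uniformity extends this to the summand, where
  \<open>not_both_bij\<close> forbids it.\<close>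

lemma endo_not_both_injective:
  assumes g: "g \<in> rmod_hom R E E"
    and inj: "\<And>x. x \<in> carrier E \<Longrightarrow> g x = \<zero>\<^bsub>E\<^esub> \<Longrightarrow> x = \<zero>\<^bsub>E\<^esub>"
      "\<And>x. x \<in> carrier E \<Longrightarrow> x \<ominus>\<^bsub>E\<^esub> g x = \<zero>\<^bsub>E\<^esub> \<Longrightarrow> x = \<zero>\<^bsub>E\<^esub>"
  shows False
proof -
  obtain i where i: "i \<in> I" using index_nonempty by blast
  obtain j where j: "j \<in> I" "i \<noteq> j" using ex_other_index[OF i] by blast
  obtain A where A: "submodule A R E" "A \<subseteq> summand i" "A \<noteq> {\<zero>\<^bsub>E\<^esub>}"
    "\<And>x j. x \<in> A \<Longrightarrow> j \<in> I \<Longrightarrow> j \<noteq> i \<Longrightarrow> e j (g x) = \<zero>\<^bsub>E\<^esub>"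
    using diagonal_submodule[OF i g] by blast
  interpret g: right_module_hom R E E g by (rule endo_homI[OF g])
  interpret u: right_module_hom R E E "\<lambda>x. e i (g x)"
    by (rule endo_homI[OF rmod_hom_compose[OF g e_hom[OF i]]])
  interpret d: right_module_hom R E E "\<lambda>x. x \<ominus>\<^bsub>E\<^esub> e i (g x)"
    by (rule endo_homI[OF rmod_hom_minus[OF right_module_axioms right_module_axioms rmod_hom_id
            rmod_hom_compose[OF g e_hom[OF i]]]])
  note S = submodule_summand[OF i]
  have gA: "e i (g x) = g x" if "x \<in> A" for x
  proof -
    have gx: "g x \<in> carrier E" using submoduleD(2)[OF A(1) that] by simp
    have "g x = finsum E (\<lambda>j. e j (g x)) I" using e_sum[OF gx] by simp
    also have "\<dots> = (if i \<in> I then e i (g x) else \<zero>\<^bsub>E\<^esub>)"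
      by (rule finsum_single) (rule fin, erule A(4)[OF that], assumption, rule e_closed[OF i gx])
    finally show ?thesis using i by simp
  qed
  let ?B = "{x \<in> summand i. e i (g x) = \<zero>\<^bsub>E\<^esub>}" and ?C = "{x \<in> summand i. x \<ominus>\<^bsub>E\<^esub> e i (g x) = \<zero>\<^bsub>E\<^esub>}"
  have B: "submodule ?B R E" by (rule u.submodule_kernel[OF S])
  have C: "submodule ?C R E" by (rule d.submodule_kernel[OF S])
  have "A \<inter> ?B \<subseteq> {\<zero>\<^bsub>E\<^esub>}"
  proof
    fix y assume "y \<in> A \<inter> ?B"
    then have y: "y \<in> A" "e i (g y) = \<zero>\<^bsub>E\<^esub>" by blast+
    show "y \<in> {\<zero>\<^bsub>E\<^esub>}"
      using inj(1)[OF submoduleD(2)[OF A(1) y(1)]] y(2) unfolding gA[OF y(1)] by simp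
  qed
  then have "A \<inter> ?B = {\<zero>\<^bsub>E\<^esub>}" using submoduleD(3)[OF A(1)] submoduleD(3)[OF B] by blast
  then have B0: "?B = {\<zero>\<^bsub>E\<^esub>}" using uniform[OF i A(1,2) B] A(3) by blast
  have "A \<inter> ?C \<subseteq> {\<zero>\<^bsub>E\<^esub>}"
  proof
    fix y assume "y \<in> A \<inter> ?C"
    then have y: "y \<in> A" "y \<ominus>\<^bsub>E\<^esub> e i (g y) = \<zero>\<^bsub>E\<^esub>" by blast+
    show "y \<in> {\<zero>\<^bsub>E\<^esub>}"
      using inj(2)[OF submoduleD(2)[OF A(1) y(1)]] y(2) unfolding gA[OF y(1)] by simp
  qed
  then have "A \<inter> ?C = {\<zero>\<^bsub>E\<^esub>}" using submoduleD(3)[OF A(1)] submoduleD(3)[OF C] by blast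
  then have C0: "?C = {\<zero>\<^bsub>E\<^esub>}" using uniform[OF i A(1,2) C] A(3) by blast
  note hom = component_hom[OF i i g]
  have B0': "x = \<zero>\<^bsub>E\<^esub>" if "x \<in> summand i" "e i (g x) = \<zero>\<^bsub>E\<^esub>" for x
  proof -
    have "x \<in> ?B" using that by blast
    then show ?thesis unfolding B0 by (rule singletonD)
  qed
  have C0': "x = \<zero>\<^bsub>E\<^esub>" if "x \<in> summand i" "x \<ominus>\<^bsub>E\<^esub> e i (g x) = \<zero>\<^bsub>E\<^esub>" for x
  proof -
    have "x \<in> ?C" using that by blast
    then show ?thesis unfolding C0 by (rule singletonD)
  qed
  have b1: "bij_betw (\<lambda>x. e i (g x)) (summand i) (summand i)"
    by (rule summand_bij[OF i i hom B0'])
  have b2: "bij_betw (\<lambda>x. x \<ominus>\<^bsub>E\<^esub> e i (g x)) (summand i) (summand i)"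
    by (rule summand_bij[OF i i summand_minus_hom[OF i hom] C0'])
  show False by (rule not_both_bij[OF i j hom b1 b2])
qed

end

section \<open>Transfer between a module and its envelope\<close>

text \<open>Applying \<open>p j\<close> after \<open>f\<close> to a vanishing sum isolates its
  \<open>j\<close>-th term. It is used with \<open>f\<close> the identity for the summands of
  \<open>E\<close>, and with \<open>f\<close> the embedding for submodules of
  \<open>M\<close>.\<close>

lemma (in right_module_hom) independent_family_by_projections:
  assumes inj: "inj_on f (carrier M)" and X: "\<And>i. i \<in> I \<Longrightarrow> submodule (X i) R M"
    and p: "\<And>i. i \<in> I \<Longrightarrow> p i \<in> rmod_hom R N N"
    and same: "\<And>i x. i \<in> I \<Longrightarrow> x \<in> X i \<Longrightarrow> p i (f x) = f x"
    and other: "\<And>i j x. i \<in> I \<Longrightarrow> j \<in> I \<Longrightarrow> i \<noteq> j \<Longrightarrow> x \<in> X j \<Longrightarrow> p i (f x) = \<zero>\<^bsub>N\<^esub>"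
  shows "independent_family R M I X"
  unfolding independent_family_def
proof (intro conjI ballI allI impI)
  fix F x j
  assume "finite F \<and> F \<subseteq> I \<and> (\<forall>i\<in>F. x i \<in> X i) \<and> finsum M x F = \<zero>\<^bsub>M\<^esub>" and j: "j \<in> F"
  then have F: "finite F" "F \<subseteq> I" "\<And>i. i \<in> F \<Longrightarrow> x i \<in> X i" "finsum M x F = \<zero>\<^bsub>M\<^esub>" by blast+
  have jI: "j \<in> I" using F(2) j by blast
  interpret pj: right_module_hom R N N "p j"
    by (rule right_module_homI[OF N.right_module_axioms N.right_module_axioms p[OF jI]])
  have xM: "x i \<in> carrier M" if "i \<in> F" for i
    using M.submoduleD(2)[OF X F(3)[OF that]] F(2) that by blast
  have "\<zero>\<^bsub>N\<^esub> = p j (f (finsum M x F))" unfolding F(4) by simp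
  also have "\<dots> = p j (finsum N (\<lambda>i. f (x i)) F)" by (simp only: finsum[OF F(1) xM])
  also have "\<dots> = finsum N (\<lambda>i. p j (f (x i))) F" by (rule pj.finsum[OF F(1) closed[OF xM]])
  also have "\<dots> = (if j \<in> F then p j (f (x j)) else \<zero>\<^bsub>N\<^esub>)"
  proof (rule N.finsum_single)
    fix i assume i: "i \<in> F" "i \<noteq> j"
    then have "i \<in> I" using F(2) by blast
    then show "p j (f (x i)) = \<zero>\<^bsub>N\<^esub>" using other[OF jI _ _ F(3)[OF i(1)]] i(2) by blast
  qed (rule F(1), rule pj.closed[OF closed[OF xM[OF j]]])
  also have "\<dots> = f (x j)" using j same[OF jI F(3)[OF j]] by simp
  finally show "x j = \<zero>\<^bsub>M\<^esub>"
    using inj_onD[OF inj _ xM[OF j] M.M.zero_closed] by simp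
qed (rule X)

lemma (in indecomposable_decomposition) internal_direct_sum: "internal_direct_sum R E I summand"
  unfolding internal_direct_sum_def
proof (intro conjI ballI)
  interpret id: right_module_hom R E E "\<lambda>x. x" by (rule endo_homI[OF rmod_hom_id])
  show "independent_family R E I summand"
    by (rule id.independent_family_by_projections[OF inj_on_id2 submodule_summand e_hom e_summand
          e_summand_other])
  show "\<exists>F x. finite F \<and> F \<subseteq> I \<and> (\<forall>i\<in>F. x i \<in> summand i) \<and> m = finsum E x F" if "m \<in> carrier E" for m
    using fin e_sum[OF that] that by (intro exI[of _ I] exI[of _ "\<lambda>i. e i m"]) simp
qed

text \<open>Preimages under \<open>f\<close> turn a splitting of the image into a splitting of
  \<open>M\<close>.\<close>

lemma (in right_module_hom) image_indecomposable:
  assumes inj: "inj_on f (carrier M)" and ind: "indecomposable_module R M"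
  shows "indecomposable_module R (N\<lparr>carrier := f ` carrier M\<rparr>)"
proof -
  let ?L = "f ` carrier M"
  have L: "submodule ?L R N" by (rule submodule_image[OF M.submodule_carrier])
  have eq0: "x = \<zero>\<^bsub>M\<^esub>" if "x \<in> carrier M" "f x = \<zero>\<^bsub>N\<^esub>" for x
    using inj_onD[OF inj _ that(1) M.M.zero_closed] that(2) by simp
  have L0: "?L \<noteq> {\<zero>\<^bsub>N\<^esub>}"
  proof
    assume 0: "?L = {\<zero>\<^bsub>N\<^esub>}"
    have "x = \<zero>\<^bsub>M\<^esub>" if "x \<in> carrier M" for x using eq0[OF that] 0 that by blast
    then have "carrier M = {\<zero>\<^bsub>M\<^esub>}" using M.M.zero_closed by blast
    then show False using ind unfolding indecomposable_module_def by blast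
  qed
  have "A = {\<zero>\<^bsub>N\<^esub>} \<or> B = {\<zero>\<^bsub>N\<^esub>}"
    if A: "submodule A R N" "A \<subseteq> ?L" and B: "submodule B R N" "B \<subseteq> ?L"
      and AB: "A \<inter> B = {\<zero>\<^bsub>N\<^esub>}" and sum: "A <+>\<^bsub>N\<^esub> B = ?L" for A B
  proof -
    let ?A = "{x \<in> carrier M. f x \<in> A}" and ?B = "{x \<in> carrier M. f x \<in> B}"
    have A': "submodule ?A R M" by (rule submodule_vimage[OF A(1)])
    have B': "submodule ?B R M" by (rule submodule_vimage[OF B(1)])
    have "?A \<inter> ?B \<subseteq> {\<zero>\<^bsub>M\<^esub>}" using eq0 AB by blast
    then have AB': "?A \<inter> ?B = {\<zero>\<^bsub>M\<^esub>}" using M.submoduleD(3)[OF A'] M.submoduleD(3)[OF B'] by blast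
    have "carrier M \<subseteq> ?A <+>\<^bsub>M\<^esub> ?B"
    proof
      fix x assume x: "x \<in> carrier M"
      then have "f x \<in> A <+>\<^bsub>N\<^esub> B" unfolding sum by blast
      then obtain a b where ab: "a \<in> A" "b \<in> B" "f x = a \<oplus>\<^bsub>N\<^esub> b" unfolding N.mem_set_add by blast
      obtain y where y: "y \<in> carrier M" "a = f y" using ab(1) A(2) by blast
      obtain z where z: "z \<in> carrier M" "b = f z" using ab(2) B(2) by blast
      have "f x = f (y \<oplus>\<^bsub>M\<^esub> z)" using ab(3) y z by simp
      then have "x = y \<oplus>\<^bsub>M\<^esub> z" using inj_onD[OF inj _ x M.M.a_closed[OF y(1) z(1)]] by simp
      moreover have "y \<in> ?A" "z \<in> ?B" using y z ab(1,2) by blast+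
      ultimately show "x \<in> ?A <+>\<^bsub>M\<^esub> ?B" unfolding M.mem_set_add by blast
    qed
    then have "?A <+>\<^bsub>M\<^esub> ?B = carrier M"
      using M.submoduleD(1)[OF M.submodule_set_add(1)[OF A' B']] by blast
    then have "?A = {\<zero>\<^bsub>M\<^esub>} \<or> ?B = {\<zero>\<^bsub>M\<^esub>}"
      using ind A' B' AB' unfolding indecomposable_module_def by blast
    then show ?thesis
    proof
      assume 0: "?A = {\<zero>\<^bsub>M\<^esub>}"
      have "a = \<zero>\<^bsub>N\<^esub>" if a: "a \<in> A" for a
      proof -
        obtain y where y: "y \<in> carrier M" "a = f y" using a A(2) by blast
        then have "y = \<zero>\<^bsub>M\<^esub>" using a 0 by blast
        then show ?thesis using y(2) by simp
      qed
      then show ?thesis using N.submoduleD(3)[OF A(1)] by blast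
    next
      assume 0: "?B = {\<zero>\<^bsub>M\<^esub>}"
      have "b = \<zero>\<^bsub>N\<^esub>" if b: "b \<in> B" for b
      proof -
        obtain y where y: "y \<in> carrier M" "b = f y" using b B(2) by blast
        then have "y = \<zero>\<^bsub>M\<^esub>" using b 0 by blast
        then show ?thesis using y(2) by simp
      qed
      then show ?thesis using N.submoduleD(3)[OF B(1)] by blast
    qed
  qed
  then show ?thesis unfolding N.indecomposable_submodule_iff[OF L] using L0 by blast
qed

text \<open>If every \<open>f n\<close> were nonzero, its image would meet the essential image of
  \<open>M\<close>, and the preimages \<open>X n\<close> would be an infinite independent family of
  nonzero submodules of \<open>M\<close>.\<close>

lemma envelope_orthogonal_idempotents:
  fixes f :: "nat \<Rightarrow> 'e \<Rightarrow> 'e"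
  assumes fg: "finite_Goldie_dimension R M" and env: "injective_envelope R M E \<iota>"
    and hom: "\<And>i. f i \<in> rmod_hom R E E"
    and idem: "\<And>i x. x \<in> carrier E \<Longrightarrow> f i (f i x) = f i x"
    and orth: "\<And>i j x. i \<noteq> j \<Longrightarrow> x \<in> carrier E \<Longrightarrow> f i (f j x) = \<zero>\<^bsub>E\<^esub>"
  shows "\<exists>i. \<forall>x\<in>carrier E. f i x = \<zero>\<^bsub>E\<^esub>"
proof (rule ccontr)
  assume nz: "\<not> (\<exists>i. \<forall>x\<in>carrier E. f i x = \<zero>\<^bsub>E\<^esub>)"
  have env': "right_module R M" "right_module R E" "\<iota> \<in> rmod_hom R M E" "inj_on \<iota> (carrier M)"
    "essential_submodule R E (\<iota> ` carrier M)"
    using env unfolding injective_envelope_def injective_module_def by blast+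
  interpret i: right_module_hom R M E \<iota> by (rule right_module_homI[OF env'(1-3)])
  define X where "X n = {m \<in> carrier M. \<iota> m \<in> f n ` carrier E}" for n
  have S: "submodule (f n ` carrier E) R E" for n
    by (rule right_module_hom.submodule_image[OF right_module_homI[OF env'(2,2) hom]
          i.N.submodule_carrier])
  have "independent_family R M UNIV X"
  proof (rule i.independent_family_by_projections[OF env'(4), where p = f])
    show "submodule (X n) R M" for n unfolding X_def by (rule i.submodule_vimage[OF S])
    show "f n (\<iota> x) = \<iota> x" if "x \<in> X n" for n x using that idem unfolding X_def by force
    show "f m (\<iota> x) = \<zero>\<^bsub>E\<^esub>" if "m \<noteq> n" "x \<in> X n" for m n x
      using that orth[OF that(1)] unfolding X_def by force
  qed (rule hom)
  moreover have "X n \<noteq> {\<zero>\<^bsub>M\<^esub>}" for n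
  proof -
    obtain x where "x \<in> carrier E" "f n x \<noteq> \<zero>\<^bsub>E\<^esub>" using nz by blast
    then have "f n ` carrier E \<noteq> {\<zero>\<^bsub>E\<^esub>}" by blast
    then have ne: "\<iota> ` carrier M \<inter> f n ` carrier E \<noteq> {\<zero>\<^bsub>E\<^esub>}"
      using env'(5) S unfolding essential_submodule_def by blast
    have "\<zero>\<^bsub>E\<^esub> \<in> \<iota> ` carrier M \<inter> f n ` carrier E"
      using i.N.submoduleD(3)[OF S] i.N.submoduleD(3)[OF i.submodule_image[OF i.M.submodule_carrier]]
      by blast
    then obtain m where "m \<in> carrier M" "\<iota> m \<in> f n ` carrier E" "\<iota> m \<noteq> \<zero>\<^bsub>E\<^esub>" using ne by blast
    moreover from this have "m \<noteq> \<zero>\<^bsub>M\<^esub>" using i.zero by metis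
    ultimately show ?thesis unfolding X_def by blast
  qed
  ultimately show False using fg unfolding finite_Goldie_dimension_def by blast
qed

text \<open>The finite set of projections is numbered bijectively, so that distinct indices carry
  orthogonal projections.\<close>

lemma ex_indexed_decomposition:
  fixes E :: "('r, 'e, 'u) module_scheme"
  assumes fg: "finite_Goldie_dimension R M" and env: "injective_envelope R M E \<iota>"
  shows "\<exists>n (e :: nat \<Rightarrow> _). indecomposable_decomposition R E {1..n} e"
proof -
  have inj: "injective_module R E" using env unfolding injective_envelope_def by blast
  interpret right_module R E using inj unfolding injective_module_def by blast
  have "\<exists>F. finite F \<and>
    (\<forall>e\<in>F. e \<in> rmod_hom R E E \<and> (\<forall>x\<in>carrier E. e (e x) = e x) \<and>
      indecomposable_module R (E\<lparr>carrier := e ` carrier E\<rparr>)) \<and>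
    (\<forall>e\<in>F. \<forall>f\<in>F. e \<noteq> f \<longrightarrow> (\<forall>x\<in>carrier E. e (f x) = \<zero>\<^bsub>E\<^esub>)) \<and>
    (\<forall>x\<in>carrier E. finsum E (\<lambda>e. e x) F = x)"
  proof (rule ex_indecomposable_decomposition)
    fix f :: "nat \<Rightarrow> 'e \<Rightarrow> 'e"
    assume f: "\<And>i. f i \<in> rmod_hom R E E" "\<And>i x. x \<in> carrier E \<Longrightarrow> f i (f i x) = f i x"
      "\<And>i j x. i \<noteq> j \<Longrightarrow> x \<in> carrier E \<Longrightarrow> f i (f j x) = \<zero>\<^bsub>E\<^esub>"
    show "\<exists>i. \<forall>x\<in>carrier E. f i x = \<zero>\<^bsub>E\<^esub>"
      by (rule envelope_orthogonal_idempotents[OF fg env f])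
  qed
  then obtain F where F0: "finite F"
    "\<forall>e\<in>F. e \<in> rmod_hom R E E \<and> (\<forall>x\<in>carrier E. e (e x) = e x) \<and>
      indecomposable_module R (E\<lparr>carrier := e ` carrier E\<rparr>)"
    "\<forall>e\<in>F. \<forall>f\<in>F. e \<noteq> f \<longrightarrow> (\<forall>x\<in>carrier E. e (f x) = \<zero>\<^bsub>E\<^esub>)"
    "\<forall>x\<in>carrier E. finsum E (\<lambda>e. e x) F = x"
    by (elim exE conjE)
  have F: "\<And>e. e \<in> F \<Longrightarrow> e \<in> rmod_hom R E E"
    "\<And>e x. e \<in> F \<Longrightarrow> x \<in> carrier E \<Longrightarrow> e (e x) = e x"
    "\<And>e f x. e \<in> F \<Longrightarrow> f \<in> F \<Longrightarrow> e \<noteq> f \<Longrightarrow> x \<in> carrier E \<Longrightarrow> e (f x) = \<zero>\<^bsub>E\<^esub>"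
    "\<And>x. x \<in> carrier E \<Longrightarrow> finsum E (\<lambda>e. e x) F = x"
    "\<And>e. e \<in> F \<Longrightarrow> indecomposable_module R (E\<lparr>carrier := e ` carrier E\<rparr>)"
    by (use F0(2) in blast, use F0(2) in blast, use F0(3) in blast, use F0(4) in blast, use F0(2) in blast)
  obtain e where e: "bij_betw e {1..card F} F" using ex_bij_betw_nat_finite_1[OF F0(1)] by blast
  have eF: "e i \<in> F" if "i \<in> {1..card F}" for i using e that by (rule bij_betwE[rule_format])
  have "finsum E (\<lambda>i. e i x) {1..card F} = x" if x: "x \<in> carrier E" for x
  proof -
    have "e ` {1..card F} = F" "inj_on e {1..card F}" using e unfolding bij_betw_def by blast+
    moreover have "f x \<in> carrier E" if "f \<in> F" for f using rmod_homD(1)[OF F(1)[OF that] x] .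
    ultimately have "finsum E (\<lambda>f. f x) F = finsum E (\<lambda>i. e i x) {1..card F}"
      using M.finsum_reindex[of "\<lambda>f. f x" e "{1..card F}"] by simp
    then show ?thesis using F(4)[OF x] by simp
  qed
  moreover have "e i (e j x) = \<zero>\<^bsub>E\<^esub>" if "i \<in> {1..card F}" "j \<in> {1..card F}" "i \<noteq> j" "x \<in> carrier E" for i j x
    using F(3)[OF eF[OF that(1)] eF[OF that(2)] _ that(4)] inj_onD[OF bij_betw_imp_inj_on[OF e]] that(1-3)
    by blast
  ultimately have "indecomposable_decomposition R E {1..card F} e"
    by (intro indecomposable_decomposition.intro indecomposable_decomposition_axioms.intro
        right_module_axioms inj F(1,2,5) eF) simp_all
  then show ?thesis by blast
qed

theorem theorem4p1:
  fixes R :: "('r, 's) ring_scheme"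
    and M :: "('r, 'm, 't) module_scheme"
    and E :: "('r, 'e, 'u) module_scheme"
    and \<iota> :: "'m \<Rightarrow> 'e"
  assumes "ring R"
    and "right_module R M"
    and "indecomposable_module R M"
    and "finite_Goldie_dimension R M"
    and "injective_envelope R M E \<iota>"
    and "automorphism_invariant R M E \<iota>"
    and "\<not> quasi_injective R M E \<iota>"
  shows "(endo_ring R M Quot jacobson_radical (endo_ring R M)) \<simeq> residue_ring 2 \<and>
    (\<exists>(n :: nat) (Es :: nat \<Rightarrow> 'e set). n \<ge> 2 \<and>
      internal_direct_sum R E {1..n} Es \<and>
      (\<forall>i \<in> {1..n}. indecomposable_module R (E\<lparr>carrier := Es i\<rparr>)) \<and>
      (\<forall>i \<in> {1..n}. injective_module R (E\<lparr>carrier := Es i\<rparr>)) \<and>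
      (\<forall>i \<in> {1..n}. \<forall>j \<in> {1..n}. i \<noteq> j \<longrightarrow>
        \<not> rmod_isomorphic R (E\<lparr>carrier := Es i\<rparr>) (E\<lparr>carrier := Es j\<rparr>)) \<and>
      (\<forall>i \<in> {1..n}.
        (endo_ring R (E\<lparr>carrier := Es i\<rparr>) Quot jacobson_radical (endo_ring R (E\<lparr>carrier := Es i\<rparr>)))
          \<simeq> residue_ring 2))"
proof -
  have env: "right_module R M" "injective_module R E" "right_module R E" "\<iota> \<in> rmod_hom R M E"
    "inj_on \<iota> (carrier M)" "essential_submodule R E (\<iota> ` carrier M)"
    using assms(5) unfolding injective_envelope_def injective_module_def by blast+
  interpret M: right_module R M by (rule env(1))
  interpret i: right_module_hom R M E \<iota> by (rule right_module_homI[OF env(1,3,4)])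
  obtain n and e :: "nat \<Rightarrow> 'e \<Rightarrow> 'e" where dec: "indecomposable_decomposition R E {1..n} e"
    using ex_indexed_decomposition[OF assms(4,5)] by blast
  interpret D: automorphism_invariant_submodule R E "{1..n}" e "\<iota> ` carrier M"
  proof (intro automorphism_invariant_submodule.intro automorphism_invariant_submodule_axioms.intro dec)
    show "submodule (\<iota> ` carrier M) R E" by (rule i.submodule_image[OF M.submodule_carrier])
    show "B = {\<zero>\<^bsub>E\<^esub>}" if "submodule B R E" "\<iota> ` carrier M \<inter> B = {\<zero>\<^bsub>E\<^esub>}" for B
      using env(6) that unfolding essential_submodule_def by blast
    show "f x \<in> \<iota> ` carrier M" if "f \<in> rmod_iso R E E" "x \<in> \<iota> ` carrier M" for f x
      using assms(6) that unfolding automorphism_invariant_def by blast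
    show "indecomposable_module R (E\<lparr>carrier := \<iota> ` carrier M\<rparr>)"
      by (rule i.image_indecomposable[OF env(5) assms(3)])
    show "\<exists>f\<in>rmod_hom R E E. \<exists>x\<in>\<iota> ` carrier M. f x \<notin> \<iota> ` carrier M"
      using assms(7) unfolding quasi_injective_def by blast
  qed
  have eq0: "x = \<zero>\<^bsub>M\<^esub>" if "x \<in> carrier M" "\<iota> x = \<zero>\<^bsub>E\<^esub>" for x
    using inj_onD[OF env(5) _ that(1) M.zero_closed] that(2) by simp
  \<comment> \<open>Surjectivity of \<open>f\<close> is the point: the preimage under
    \<open>g\<close> of an element of the image of \<open>\<iota>\<close> lies in that image again,
    by invariance under the inverse of \<open>g\<close>.\<close>
  have bij: "bij_betw f (carrier M) (carrier M)"
    if f: "f \<in> rmod_hom R M M" and g: "g \<in> rmod_hom R E E" "bij_betw g (carrier E) (carrier E)"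
      and gf: "\<And>x. x \<in> carrier M \<Longrightarrow> g (\<iota> x) = \<iota> (f x)" for f g
  proof -
    note fM = rmod_homD(1)[OF f]
    have "inj_on f (carrier M)"
    proof (rule inj_onI)
      fix x y assume xy: "x \<in> carrier M" "y \<in> carrier M" "f x = f y"
      then have "g (\<iota> x) = g (\<iota> y)" using gf by simp
      then have "\<iota> x = \<iota> y"
        using inj_onD[OF bij_betw_imp_inj_on[OF g(2)] _ i.closed[OF xy(1)] i.closed[OF xy(2)]] by blast
      then show "x = y" using inj_onD[OF env(5) _ xy(1,2)] by blast
    qed
    moreover have "y \<in> f ` carrier M" if y: "y \<in> carrier M" for y
    proof -
      obtain x where x: "x \<in> carrier M" "g (\<iota> x) = \<iota> y"
        using D.preserving_automorphism_surj[OF g imageI[OF y]] by blast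
      then have "f x = y" using gf[OF x(1)] inj_onD[OF env(5) _ fM[OF x(1)] y] by simp
      then show ?thesis using x(1) by blast
    qed
    ultimately show ?thesis using fM unfolding bij_betw_def by blast
  qed
  \<comment> \<open>In the other direction only a trivial kernel of \<open>g\<close> is derived,
    from essentiality; this is what \<open>endo_not_both_injective\<close> asks for.\<close>
  have ker: "y = \<zero>\<^bsub>E\<^esub>"
    if f: "f \<in> rmod_hom R M M" "bij_betw f (carrier M) (carrier M)" and g: "g \<in> rmod_hom R E E"
      and gf: "\<And>x. x \<in> carrier M \<Longrightarrow> g (\<iota> x) = \<iota> (f x)" and y: "y \<in> carrier E" "g y = \<zero>\<^bsub>E\<^esub>" for f g y
  proof (rule D.trivial_kernel_on_E[OF g _ y])
    interpret f: right_module_hom R M M f by (rule right_module_homI[OF env(1,1) f(1)])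
    fix z assume "z \<in> \<iota> ` carrier M" and gz: "g z = \<zero>\<^bsub>E\<^esub>"
    then obtain x where x: "x \<in> carrier M" "z = \<iota> x" by blast
    then have "f x = \<zero>\<^bsub>M\<^esub>" using gz gf[OF x(1)] by (intro eq0 f.closed) simp_all
    then have "x = \<zero>\<^bsub>M\<^esub>"
      using bij_betw_imp_inj_on[OF f(2)] x(1) unfolding f.inj_on_iff[OF M.submodule_carrier] by blast
    then show "z = \<zero>\<^bsub>E\<^esub>" using x(2) by simp
  qed
  have "endo_ring R M Quot jacobson_radical (endo_ring R M) \<simeq> residue_ring 2"
  proof (rule M.endo_Quot_jacobson_radical_iso)
    fix f assume f: "f \<in> rmod_hom R M M"
    let ?f = "\<lambda>x. x \<ominus>\<^bsub>M\<^esub> f x"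
    have f': "?f \<in> rmod_hom R M M" by (rule rmod_hom_minus[OF env(1,1) M.rmod_hom_id f])
    note fM = rmod_homD(1)[OF f]
    \<comment> \<open>Any extension serves: it maps the image of \<open>M\<close> into itself
      because it extends an endomorphism of \<open>M\<close>, and \<open>1 - g\<close> extends
      \<open>1 - f\<close>.\<close>
    obtain g where g: "g \<in> rmod_hom R E E" "\<And>x. x \<in> carrier M \<Longrightarrow> g (\<iota> x) = \<iota> (f x)"
      using injective_module_extends_along[OF env(2,1,3,4,5) rmod_hom_compose[OF f env(4)]] by blast
    let ?g = "\<lambda>x. x \<ominus>\<^bsub>E\<^esub> g x"
    have g': "?g \<in> rmod_hom R E E" by (rule rmod_hom_minus[OF env(3,3) i.N.rmod_hom_id g(1)])
    have gf': "?g (\<iota> x) = \<iota> (?f x)" if "x \<in> carrier M" for x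
      unfolding g(2)[OF that] i.minus[OF that fM[OF that]] ..
    have "g y \<in> \<iota> ` carrier M" if "y \<in> \<iota> ` carrier M" for y
      using that g(2) fM by blast
    then have "bij_betw g (carrier E) (carrier E) \<or> bij_betw ?g (carrier E) (carrier E)"
      by (rule D.preserving_endo_cases[OF g(1)])
    then have "bij_betw f (carrier M) (carrier M) \<or> bij_betw ?f (carrier M) (carrier M)"
      using bij[OF f g(1) _ g(2)] bij[OF f' g' _ gf'] by blast
    moreover have "\<not> (bij_betw f (carrier M) (carrier M) \<and> bij_betw ?f (carrier M) (carrier M))"
    proof
      assume b: "bij_betw f (carrier M) (carrier M) \<and> bij_betw ?f (carrier M) (carrier M)"
      show False
        by (rule D.endo_not_both_injective[OF g(1) ker[OF f conjunct1[OF b] g] ker[OF f' conjunct2[OF b] g' gf']])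
    qed
    ultimately show "bij_betw f (carrier M) (carrier M) \<longleftrightarrow> \<not> bij_betw ?f (carrier M) (carrier M)"
      by blast
  qed
  moreover have "n \<ge> 2"
  proof (rule ccontr)
    assume "\<not> n \<ge> 2"
    moreover have "n \<noteq> 0" using D.index_nonempty by auto
    ultimately have "n = 1" by simp
    then show False using D.ex_other_index[of 1] by auto
  qed
  ultimately show ?thesis
    using D.internal_direct_sum D.e_indecomposable D.injective_summand D.not_isomorphic
      D.summand_endo_Quot
    by (intro conjI exI[of _ n] exI[of _ D.summand] ballI impI)
qed

end
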